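(* Let $1\le q\le p\le\infty$ and let $X,Y$ be Banach lattices. Then $$\mathcal R_{p,q}(X,Y)=\big(X\otimes_{r_{p,q}}Y^*\big)^*\cap\mathcal L(X,Y)$$ isometrically, via trace duality. That is, a bounded linear operator $T:X\to Y$ is $(p,q)$-regular if and only if the linear functional $\varphi_T$ on $X\otimes Y^*$ determined by $\varphi_T(x\otimes y^* )=\langle T x,y^*\rangle$ is bounded with respect to the norm $r_{p,q}$, and in this case $\rho_{p,q}(T)=\|\varphi_T\|_{(X\otimes_{r_{p,q}}Y^* )^*}$.
   Context: A linear map $T:X\to Y$ between Banach lattices is $(p,q)$-regular if there is $K>0$ with $\big\|(\sum_{i=1}^n|Tx_i|^p)^{1/p}\big\|\le K\big\|(\sum_{i=1}^n|x_i|^q)^{1/q}\big\|$ for every finite family $\{x_i\}_{i=1}^n\subset X$ (with $\bigvee_i|\cdot|$ replacing the corresponding expression when an exponent is $\infty$); the expressions are defined by Krivine's functional calculus. $\rho_{p,q}(T)$ is the smallest such $K$, and $\mathcal R_{p,q}(X,Y)$ is the space of $(p,q)$-regular operators with $\rho_{p,q}$. $\mathcal L(X,Y)$ is the space of bounded linear operators. For Banach lattices $X,Z$ and $z$ in the algebraic tensor product $X\otimes Z$, with $1/p+1/p'=1$, $$\phi_{p,q}(z)=\inf\Big\{\big\|(\textstyle\sum_i|x_i|^q)^{1/q}\big\|_X\,\big\|(\sum_i|z_i|^{p'})^{1/p'}\big\|_Z:\ z=\sum_{i=1}^n x_i\otimes z_i\Big\},$$ $$r_{p,q}(z)=\inf\Big\{\sum_{j=1}^m\phi_{p,q}(z_j):\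 z=\sum_{j=1}^m z_j\Big\}.$$ $X\otimes_{r_{p,q}}Z$ denotes $X\otimes Z$ with the norm $r_{p,q}$. An element $\varphi\in(X\otimes Y^* )^*$ is identified with the operator $T_\varphi:X\to Y^{**}$, $\langle T_\varphi x,y^*\rangle=\varphi(x\otimes y^* )$; the intersection with $\mathcal L(X,Y)$ means those functionals for which $T_\varphi$ takes values in $Y$. *)

theory Defs
  imports "HOL-Analysis.Analysis" "HOL-Library.Lattice_Algebras"
begin

section \<open>Banach lattices\<close>

class banach_lattice = banach + ordered_real_vector + lattice_ab_group_add_abs +
  assumes norm_mono_abs: "\<bar>x\<bar> \<le> \<bar>y\<bar> \<Longrightarrow> norm x \<le> norm y"

instance real :: banach_lattice
  by standard auto

lemma norm_abs_lattice [simp]: "norm \<bar>x\<bar> = norm x"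
  for x :: "'a::banach_lattice"
  by (intro antisym norm_mono_abs) simp_all


section \<open>The dual Banach lattice\<close>

text \<open>
  The type \<open>'a dual\<close> is a copy of the type of bounded linear functionals. A copy is needed because the
  lattice structure exists only for the codomain \<^typ>\<open>real\<close>, so it cannot be a type class
  instance of the type of bounded linear operators.
\<close>

typedef (overloaded) 'a dual = "UNIV :: ('a::real_normed_vector \<Rightarrow>\<^sub>L real) set"
  morphisms blinfun_of_dual dual_of_blinfun
  by simp

setup_lifting type_definition_dual

lift_definition dual_apply :: "'a::real_normed_vector dual \<Rightarrow> 'a \<Rightarrow> real"
  is blinfun_apply .

instantiation dual :: (real_normed_vector) real_normed_vector
begin

lift_definition zero_dual :: "'a dual" is 0 .
lift_definition plus_dual :: "'a dual \<Rightarrow> 'a dual \<Rightarrow> 'a dual" is plus .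
lift_definition minus_dual :: "'a dual \<Rightarrow> 'a dual \<Rightarrow> 'a dual" is minus .
lift_definition uminus_dual :: "'a dual \<Rightarrow> 'a dual" is uminus .
lift_definition scaleR_dual :: "real \<Rightarrow> 'a dual \<Rightarrow> 'a dual" is scaleR .
lift_definition norm_dual :: "'a dual \<Rightarrow> real" is norm .

definition dist_dual :: "'a dual \<Rightarrow> 'a dual \<Rightarrow> real"
  where "dist_dual f g = norm (f - g)"

definition sgn_dual :: "'a dual \<Rightarrow> 'a dual"
  where "sgn_dual f = inverse (norm f) *\<^sub>R f"

definition uniformity_dual :: "('a dual \<times> 'a dual) filter"
  where "uniformity_dual = (INF e\<in>{0 <..}. principal {(f, g). dist f g < e})"

definition open_dual :: "'a dual set \<Rightarrow> bool"
  where "open_dual S = (\<forall>f\<in>S. \<forall>\<^sub>F (f', g) in uniformity. f' = f \<longrightarrow> g \<in> S)"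

instance
  apply standard
  unfolding dist_dual_def open_dual_def sgn_dual_def uniformity_dual_def
  apply (rule refl | (transfer, force simp: norm_triangle_ineq algebra_simps))+
  done

end

lemma dual_eqI: "(\<And>x. dual_apply f x = dual_apply g x) \<Longrightarrow> f = g"
  by transfer (rule blinfun_eqI)

lemma dual_apply_simps [simp]:
  "dual_apply 0 x = 0"
  "dual_apply (f + g) x = dual_apply f x + dual_apply g x"
  "dual_apply (f - g) x = dual_apply f x - dual_apply g x"
  "dual_apply (- f) x = - dual_apply f x"
  "dual_apply (c *\<^sub>R f) x = c * dual_apply f x"
  by (transfer, simp add: blinfun.bilinear_simps)+

lemma bounded_linear_dual_apply: "bounded_linear (dual_apply f)"
  by transfer (rule blinfun.bounded_linear_right)

lemmas linear_dual_apply = bounded_linear.linear [OF bounded_linear_dual_apply]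

lemma dual_apply_bound: "\<bar>dual_apply f x\<bar> \<le> norm f * norm x"
  by transfer (metis norm_blinfun real_norm_def)

lemma dual_norm_le: "0 \<le> b \<Longrightarrow> (\<And>x. \<bar>dual_apply f x\<bar> \<le> b * norm x) \<Longrightarrow> norm f \<le> b"
  by transfer (auto intro: norm_blinfun_bound)

lemma dual_of_bounded_linear:
  assumes "bounded_linear h"
  shows "\<exists>f. dual_apply f = h"
proof
  show "dual_apply (dual_of_blinfun (Blinfun h)) = h"
    using assms
    by (simp add: dual_apply.rep_eq dual_of_blinfun_inverse bounded_linear_Blinfun_apply)
qed

instance dual :: (real_normed_vector) banach
proof
  fix X :: "nat \<Rightarrow> 'a dual"
  assume X: "Cauchy X"
  have eq: "dist (blinfun_of_dual f) (blinfun_of_dual g) = dist f g" for f g :: "'a dual"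
    by (simp add: dist_norm minus_dual.rep_eq norm_dual.rep_eq)
  have "Cauchy (\<lambda>n. blinfun_of_dual (X n))"
    using X by (simp add: Cauchy_def eq)
  then obtain l where "(\<lambda>n. blinfun_of_dual (X n)) \<longlonglongrightarrow> l"
    using Cauchy_convergent convergent_def by blast
  then have "(\<lambda>n. dist (blinfun_of_dual (X n)) (blinfun_of_dual (dual_of_blinfun l))) \<longlonglongrightarrow> 0"
    by (subst (asm) tendsto_dist_iff) (simp add: dual_of_blinfun_inverse)
  then have "X \<longlonglongrightarrow> dual_of_blinfun l"
    unfolding eq by (subst tendsto_dist_iff)
  then show "convergent X"
    by (auto simp: convergent_def)
qed

lemma nonneg_decomp:
  fixes x :: "'a::lattice_ab_group_add"
  obtains "x = pprt x - pprt (- x)" "0 \<le> pprt x" "0 \<le> pprt (- x)"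
  using that prts[of x] by (simp add: pprt_neg)

lemma norm_pprt_le: "norm (pprt x) \<le> norm x"
  for x :: "'a::banach_lattice"
proof (rule norm_mono_abs)
  have "pprt x \<le> \<bar>x\<bar>"
    unfolding pprt_def by (intro sup_least abs_ge_self abs_ge_zero)
  then show "\<bar>pprt x\<bar> \<le> \<bar>x\<bar>"
    by simp
qed

lemma additive_cone_extend:
  fixes S :: "'a::banach_lattice \<Rightarrow> real"
  assumes add: "\<And>x y. 0 \<le> x \<Longrightarrow> 0 \<le> y \<Longrightarrow> S (x + y) = S x + S y"
    and hom: "\<And>c x. 0 < c \<Longrightarrow> 0 \<le> x \<Longrightarrow> S (c *\<^sub>R x) = c * S x"
    and bound: "\<And>x. 0 \<le> x \<Longrightarrow> \<bar>S x\<bar> \<le> C * norm x"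
  shows "\<exists>h. \<forall>x\<ge>0. dual_apply h x = S x"
proof -
  define L where "L x = S (pprt x) - S (pprt (- x))" for x
  have S0: "S 0 = 0"
    using add[of 0 0] by simp
  have L_diff: "L (a - b) = S a - S b" if "0 \<le> a" "0 \<le> b" for a b
  proof -
    have p: "0 \<le> pprt (a - b)" "0 \<le> pprt (- (a - b))"
      and e: "a - b = pprt (a - b) - pprt (- (a - b))"
      using nonneg_decomp[of "a - b"] by blast+
    have "a + pprt (- (a - b)) = pprt (a - b) + b"
      using e by (metis add_diff_cancel_left' add.commute diff_add_cancel diff_add_eq)
    then have "S a + S (pprt (- (a - b))) = S (pprt (a - b)) + S b"
      using add p that by metis
    then show ?thesis
      by (simp add: L_def)
  qed
  have L_pos: "L x = S x" if "0 \<le> x" for x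
    using L_diff[of x 0] that S0 by simp
  have L_add: "L (x + y) = L x + L y" for x y
  proof -
    have "x + y = (pprt x + pprt y) - (pprt (- x) + pprt (- y))"
      using nonneg_decomp[of x] nonneg_decomp[of y] by (metis add_diff_add)
    then have "L (x + y) = S (pprt x + pprt y) - S (pprt (- x) + pprt (- y))"
      using L_diff by (metis add_nonneg_nonneg zero_le_pprt)
    then show ?thesis
      by (simp add: add L_def)
  qed
  have L_neg: "L (- x) = - L x" for x
    by (simp add: L_def)
  have L_pos_scale: "L (c *\<^sub>R x) = c * L x" if "0 < c" for c x
  proof -
    have "c *\<^sub>R x = c *\<^sub>R pprt x - c *\<^sub>R pprt (- x)"
      using nonneg_decomp[of x] by (metis scaleR_diff_right)
    moreover have "0 \<le> c *\<^sub>R pprt x" "0 \<le> c *\<^sub>R pprt (- x)"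
      using that by (simp_all add: scaleR_nonneg_nonneg)
    ultimately have "L (c *\<^sub>R x) = S (c *\<^sub>R pprt x) - S (c *\<^sub>R pprt (- x))"
      using L_diff by metis
    then show ?thesis
      using that by (simp add: hom L_def right_diff_distrib)
  qed
  have L_scale: "L (c *\<^sub>R x) = c * L x" for c x
  proof (cases c "0::real" rule: linorder_cases)
    case less
    have "L (c *\<^sub>R x) = L ((- c) *\<^sub>R (- x))"
      by simp
    also have "\<dots> = (- c) * L (- x)"
      using less by (intro L_pos_scale) simp
    finally show ?thesis
      by (simp add: L_neg)
  next
    case equal
    then show ?thesis
      using L_pos[of 0] S0 by simp
  next
    case greater
    then show ?thesis
      by (rule L_pos_scale)
  qed
  have C0: "C * norm x \<le> \<bar>C\<bar> * norm x" for x :: 'a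
    by (simp add: mult_right_mono)
  have "bounded_linear L"
  proof (rule bounded_linear_intro[where K = "2 * \<bar>C\<bar>"])
    fix x
    have b: "\<bar>S (pprt y)\<bar> \<le> \<bar>C\<bar> * norm y" for y
      using bound[of "pprt y"] C0[of "pprt y"] norm_pprt_le[of y]
      by (smt (verit) abs_ge_zero mult_left_mono zero_le_pprt)
    have "norm (L x) \<le> \<bar>C\<bar> * norm x + \<bar>C\<bar> * norm x"
      using b[of x] b[of "- x"] unfolding L_def real_norm_def norm_minus_cancel by linarith
    then show "norm (L x) \<le> norm x * (2 * \<bar>C\<bar>)"
      by (simp add: algebra_simps)
  qed (simp_all add: L_add L_scale)
  then show ?thesis
    using dual_of_bounded_linear L_pos by metis
qed

text \<open>The Riesz--Kantorovich formula.\<close>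

lemma riesz_kantorovich:
  fixes f g :: "'a::banach_lattice dual"
  shows "\<exists>h. \<forall>x\<ge>0. dual_apply h x
           = (SUP u\<in>{0..x}. dual_apply f u + dual_apply g (x - u))"
    (is "\<exists>h. \<forall>x\<ge>0. dual_apply h x = (SUP u\<in>{0..x}. ?F x u)")
proof (rule additive_cone_extend)
  let ?S = "\<lambda>x. SUP u\<in>{0..x}. ?F x u"
  have lin: "dual_apply k (a + b) = dual_apply k a + dual_apply k b"
    "dual_apply k (a - b) = dual_apply k a - dual_apply k b"
    "dual_apply k (c *\<^sub>R a) = c * dual_apply k a" for k :: "'a dual" and a b c
    using linear_dual_apply[of k] by (simp_all add: linear_add linear_diff linear_cmul)
  have F_bound: "\<bar>?F x u\<bar> \<le> (norm f + norm g) * norm x" if "u \<in> {0..x}" for x u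
  proof -
    have "norm u \<le> norm x" "norm (x - u) \<le> norm x"
      using that by (auto intro!: norm_mono_abs simp: abs_of_nonneg)
    then have "norm f * norm u \<le> norm f * norm x" "norm g * norm (x - u) \<le> norm g * norm x"
      by (simp_all add: mult_left_mono)
    then show ?thesis
      using dual_apply_bound[of f u] dual_apply_bound[of g "x - u"]
      by (simp add: distrib_right)
  qed
  have bdd: "bdd_above (?F x ` {0..x})" for x
    using F_bound by (intro bdd_aboveI2[where M = "(norm f + norm g) * norm x"]) (smt (verit))
  have upper: "?F x u \<le> ?S x" if "u \<in> {0..x}" for x u
    using that bdd by (rule cSUP_upper)
  have least: "?S x \<le> m" if "0 \<le> x" "\<And>u. u \<in> {0..x} \<Longrightarrow> ?F x u \<le> m" for x m
    using that by (intro cSUP_least) auto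
  show "?S (x + y) = ?S x + ?S y" if x: "0 \<le> x" and y: "0 \<le> y" for x y
  proof (rule antisym)
    show "?S (x + y) \<le> ?S x + ?S y"
    proof (rule least)
      fix u assume u: "u \<in> {0..x + y}"
      have a: "inf u x \<in> {0..x}"
        using u x by simp
      have "u - inf u x = sup 0 (u - x)"
        using diff_inf_eq_sup[of u u x] by (simp add: add_sup_distrib_left)
      also have "\<dots> \<in> {0..y}"
        using u y by (simp add: algebra_simps)
      finally have b: "u - inf u x \<in> {0..y}" .
      have "?F (x + y) u = ?F x (inf u x) + ?F y (u - inf u x)"
        by (simp add: lin del: diff_inf_eq_sup)
      then show "?F (x + y) u \<le> ?S x + ?S y"
        using upper[OF a] upper[OF b] by linarith
    qed (use x y in simp)
    have "?S y \<le> ?S (x + y) - ?F x u" if u: "u \<in> {0..x}" for u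
    proof (rule least)
      fix v assume v: "v \<in> {0..y}"
      have "u + v \<in> {0..x + y}"
        using u v by (auto intro: add_mono)
      then have "?F (x + y) (u + v) \<le> ?S (x + y)"
        by (rule upper)
      then show "?F y v \<le> ?S (x + y) - ?F x u"
        by (simp add: lin)
    qed (rule y)
    then have "?S x \<le> ?S (x + y) - ?S y"
      by (intro least) (auto simp: x algebra_simps)
    then show "?S x + ?S y \<le> ?S (x + y)"
      by simp
  qed
  have le: "?S (c *\<^sub>R x) \<le> c * ?S x" if c: "0 < c" and x: "0 \<le> x" for c x
  proof (rule least)
    show "0 \<le> c *\<^sub>R x"
      using c x by (simp add: scaleR_nonneg_nonneg)
    fix u assume u: "u \<in> {0..c *\<^sub>R x}"
    define v where "v = inverse c *\<^sub>R u"
    have u_eq: "u = c *\<^sub>R v"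
      using c by (simp add: v_def)
    have "inverse c *\<^sub>R u \<le> inverse c *\<^sub>R (c *\<^sub>R x)" "0 \<le> inverse c *\<^sub>R u"
      using u c by (intro scaleR_left_mono scaleR_nonneg_nonneg; simp)+
    then have "v \<in> {0..x}"
      using c by (simp add: v_def)
    then have "c * ?F x v \<le> c * ?S x"
      using c upper by simp
    then show "?F (c *\<^sub>R x) u \<le> c * ?S x"
      by (simp add: u_eq lin algebra_simps)
  qed
  show "?S (c *\<^sub>R x) = c * ?S x" if c: "0 < c" and x: "0 \<le> x" for c x
  proof (rule antisym)
    have "?S (inverse c *\<^sub>R (c *\<^sub>R x)) \<le> inverse c * ?S (c *\<^sub>R x)"
      using c x by (intro le) (simp_all add: scaleR_nonneg_nonneg)
    then show "c * ?S x \<le> ?S (c *\<^sub>R x)"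
      using c by (simp add: field_simps)
  qed (rule le[OF c x])
  show "\<bar>?S x\<bar> \<le> (norm f + norm g) * norm x" if x: "0 \<le> x" for x
  proof (rule abs_leI)
    show "?S x \<le> (norm f + norm g) * norm x"
      using F_bound[of _ x] by (intro least x) (smt (verit))
    show "- ?S x \<le> (norm f + norm g) * norm x"
      using F_bound[of 0 x] upper[of 0 x] x by simp
  qed
qed

instantiation dual :: (banach_lattice) banach_lattice
begin

definition less_eq_dual :: "'a dual \<Rightarrow> 'a dual \<Rightarrow> bool"
  where "f \<le> g \<longleftrightarrow> (\<forall>x\<ge>0. dual_apply f x \<le> dual_apply g x)"

definition less_dual :: "'a dual \<Rightarrow> 'a dual \<Rightarrow> bool"
  where "f < g \<longleftrightarrow> f \<le> g \<and> f \<noteq> (g :: 'a dual)"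

definition sup_dual :: "'a dual \<Rightarrow> 'a dual \<Rightarrow> 'a dual"
  where "sup_dual f g = (THE h. f \<le> h \<and> g \<le> h \<and> (\<forall>k. f \<le> k \<and> g \<le> k \<longrightarrow> h \<le> k))"

definition inf_dual :: "'a dual \<Rightarrow> 'a dual \<Rightarrow> 'a dual"
  where "inf_dual f g = (THE h. h \<le> f \<and> h \<le> g \<and> (\<forall>k. k \<le> f \<and> k \<le> g \<longrightarrow> k \<le> h))"

definition abs_dual :: "'a dual \<Rightarrow> 'a dual"
  where "abs_dual f = sup f (- f)"

instance
proof
  fix f g h :: "'a dual" and a b :: real
  show refl: "f \<le> f" for f :: "'a dual"
    by (simp add: less_eq_dual_def)
  have anti: "f = g" if "f \<le> g" "g \<le> f" for f g :: "'a dual"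
  proof (rule dual_eqI)
    fix x :: 'a
    have pos: "dual_apply f y = dual_apply g y" if "0 \<le> y" for y
      using \<open>f \<le> g\<close> \<open>g \<le> f\<close> that by (force simp: less_eq_dual_def)
    have x: "x = pprt x - pprt (- x)"
      using nonneg_decomp by blast
    have "dual_apply k x = dual_apply k (pprt x) - dual_apply k (pprt (- x))" for k
      using linear_diff[OF linear_dual_apply] x by metis
    then show "dual_apply f x = dual_apply g x"
      by (simp add: pos)
  qed
  have sup_ex: "\<exists>h. f \<le> h \<and> g \<le> h \<and> (\<forall>k. f \<le> k \<and> g \<le> k \<longrightarrow> h \<le> k) \<and>
      (\<forall>x\<ge>0. dual_apply h x = (SUP u\<in>{0..x}. dual_apply f u + dual_apply g (x - u)))"
    for f g :: "'a dual"
  proof -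
    obtain h where h: "\<And>x. 0 \<le> x \<Longrightarrow>
        dual_apply h x = (SUP u\<in>{0..x}. dual_apply f u + dual_apply g (x - u))"
      using riesz_kantorovich[of f g] by blast
    have bdd: "bdd_above ((\<lambda>u. dual_apply f u + dual_apply g (x - u)) ` {0..x})" for x
    proof (rule bdd_aboveI2)
      fix u assume "u \<in> {0..x}"
      then have "norm u \<le> norm x" "norm (x - u) \<le> norm x"
        by (auto intro!: norm_mono_abs simp: abs_of_nonneg)
      then have "norm f * norm u \<le> norm f * norm x" "norm g * norm (x - u) \<le> norm g * norm x"
        by (simp_all add: mult_left_mono)
      then show "dual_apply f u + dual_apply g (x - u) \<le> norm f * norm x + norm g * norm x"
        using dual_apply_bound[of f u] dual_apply_bound[of g "x - u"] by linarith
    qed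
    have upper: "dual_apply f u + dual_apply g (x - u) \<le> dual_apply h x"
      if "0 \<le> u" "u \<le> x" for u x
    proof -
      have "0 \<le> x" using that by (rule order_trans)
      then show ?thesis
        using that by (auto simp: h intro!: cSUP_upper2[OF bdd])
    qed
    have "f \<le> h"
      unfolding less_eq_dual_def
      using upper[of x x for x] by (simp add: linear_0[OF linear_dual_apply])
    moreover have "g \<le> h"
      unfolding less_eq_dual_def
      using upper[of 0 x for x] by (simp add: linear_0[OF linear_dual_apply])
    moreover have "h \<le> k" if "f \<le> k" "g \<le> k" for k
      unfolding less_eq_dual_def
    proof (intro allI impI)
      fix x :: 'a assume x: "0 \<le> x"
      have "dual_apply f u + dual_apply g (x - u) \<le> dual_apply k x" if "u \<in> {0..x}" for u
      proof -
        have "dual_apply f u \<le> dual_apply k u" "dual_apply g (x - u) \<le> dual_apply k (x - u)"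
          using \<open>f \<le> k\<close> \<open>g \<le> k\<close> that by (auto simp: less_eq_dual_def)
        then show ?thesis
          by (simp add: linear_diff[OF linear_dual_apply])
      qed
      then show "dual_apply h x \<le> dual_apply k x"
        using x by (auto simp: h intro!: cSUP_least)
    qed
    ultimately show ?thesis
      using h by blast
  qed
  have sup_the: "f \<le> sup f g \<and> g \<le> sup f g \<and> (\<forall>k. f \<le> k \<and> g \<le> k \<longrightarrow> sup f g \<le> k)"
    for f g :: "'a dual"
    unfolding sup_dual_def
    by (rule theI') (use sup_ex[of f g] anti in blast)
  have sup_formula: "dual_apply (sup f g) x
      = (SUP u\<in>{0..x}. dual_apply f u + dual_apply g (x - u))" if "0 \<le> x"
    for f g :: "'a dual" and x
    using sup_ex[of f g] sup_the[of f g] anti that by metis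
  have neg: "- f \<le> - g \<longleftrightarrow> g \<le> f" for f g :: "'a dual"
    by (auto simp: less_eq_dual_def)
  have inf_ex: "\<exists>h. h \<le> f \<and> h \<le> g \<and> (\<forall>k. k \<le> f \<and> k \<le> g \<longrightarrow> k \<le> h)" for f g :: "'a dual"
    using sup_the[of "- f" "- g"] neg
    by (intro exI[of _ "- sup (- f) (- g)"]) (metis minus_minus)
  have inf_the: "inf f g \<le> f \<and> inf f g \<le> g \<and> (\<forall>k. k \<le> f \<and> k \<le> g \<longrightarrow> k \<le> inf f g)"
    for f g :: "'a dual"
    unfolding inf_dual_def
    by (rule theI') (use inf_ex[of f g] anti in blast)
  show "f < g \<longleftrightarrow> f \<le> g \<and> \<not> g \<le> f"
    using anti refl unfolding less_dual_def by blast
  show "f \<le> h" if "f \<le> g" "g \<le> h"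
    using that by (force simp: less_eq_dual_def)
  show "f = g" if "f \<le> g" "g \<le> f"
    using that by (rule anti)
  show "h + f \<le> h + g" if "f \<le> g"
    using that by (simp add: less_eq_dual_def)
  show "a *\<^sub>R f \<le> a *\<^sub>R g" if "f \<le> g" "0 \<le> a"
    using that by (simp add: less_eq_dual_def mult_left_mono)
  show "a *\<^sub>R f \<le> b *\<^sub>R f" if "a \<le> b" "0 \<le> f"
    using that by (simp add: less_eq_dual_def mult_right_mono)
  show "inf f g \<le> f" "inf f g \<le> g" "f \<le> sup f g" "g \<le> sup f g"
    using inf_the sup_the by blast+
  show "f \<le> inf g h" if "f \<le> g" "f \<le> h"
    using inf_the that by blast
  show "sup g h \<le> f" if "g \<le> f" "h \<le> f"
    using sup_the that by blast
  show "\<bar>f\<bar> = sup f (- f)"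
    by (rule abs_dual_def)
  show "norm f \<le> norm g" if le: "\<bar>f\<bar> \<le> \<bar>g\<bar>"
  proof (rule dual_norm_le)
    fix x :: 'a
    have "\<bar>dual_apply f x\<bar> \<le> dual_apply \<bar>f\<bar> \<bar>x\<bar>"
    proof -
      have d: "dual_apply f y \<le> dual_apply \<bar>f\<bar> y" "- dual_apply f y \<le> dual_apply \<bar>f\<bar> y"
        if "0 \<le> y" for y
        using sup_the[of f "- f"] that by (auto simp: abs_dual_def less_eq_dual_def)
      have x: "x = pprt x - pprt (- x)" and p: "0 \<le> pprt x" "0 \<le> pprt (- x)"
        using nonneg_decomp by blast+
      have ax: "\<bar>x\<bar> = pprt x + pprt (- x)"
        by (simp add: abs_prts pprt_neg)
      have "dual_apply f x = dual_apply f (pprt x) - dual_apply f (pprt (- x))"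
        using x linear_diff[OF linear_dual_apply] by metis
      moreover have "dual_apply \<bar>f\<bar> \<bar>x\<bar>
          = dual_apply \<bar>f\<bar> (pprt x) + dual_apply \<bar>f\<bar> (pprt (- x))"
        unfolding ax by (rule linear_add[OF linear_dual_apply])
      ultimately show ?thesis
        using d[OF p(1)] d[OF p(2)] by linarith
    qed
    also have "\<dots> \<le> dual_apply \<bar>g\<bar> \<bar>x\<bar>"
      using le by (simp add: less_eq_dual_def)
    also have "\<dots> = (SUP u\<in>{0..\<bar>x\<bar>}. dual_apply g u + dual_apply (- g) (\<bar>x\<bar> - u))"
      by (simp only: abs_dual_def sup_formula abs_ge_zero)
    also have "\<dots> \<le> norm g * norm x"
    proof (rule cSUP_least)
      fix u assume u: "u \<in> {0..\<bar>x\<bar>}"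
      have "u + u - \<bar>x\<bar> \<le> \<bar>x\<bar>" "- (u + u - \<bar>x\<bar>) \<le> \<bar>x\<bar>"
        using u by (auto simp: algebra_simps intro: add_mono)
      then have "\<bar>u + u - \<bar>x\<bar>\<bar> \<le> \<bar>x\<bar>"
        by (rule abs_leI)
      then have "norm (u + u - \<bar>x\<bar>) \<le> norm x"
        by (auto intro: norm_mono_abs)
      then have "norm g * norm (u + u - \<bar>x\<bar>) \<le> norm g * norm x"
        by (simp add: mult_left_mono)
      moreover have "dual_apply g u + dual_apply (- g) (\<bar>x\<bar> - u) = dual_apply g (u + u - \<bar>x\<bar>)"
        by (simp add: linear_diff[OF linear_dual_apply] linear_add[OF linear_dual_apply])
      ultimately show "dual_apply g u + dual_apply (- g) (\<bar>x\<bar> - u) \<le> norm g * norm x"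
        using dual_apply_bound[of g "u + u - \<bar>x\<bar>"] by linarith
    qed simp
    finally show "\<bar>dual_apply f x\<bar> \<le> norm g * norm x" .
  qed simp
qed

end


section \<open>Krivine's functional calculus\<close>

text \<open>
  \<open>krivine_functions n\<close> is the vector lattice of continuous, positively homogeneous functions on
  \<open>n\<close>-dimensional real space. A point is a sequence of which only the first \<open>n\<close> coordinates matter;
  for functions depending only on these coordinates, continuity in the product topology
  is ordinary continuity.
\<close>

definition krivine_functions :: "nat \<Rightarrow> ((nat \<Rightarrow> real) \<Rightarrow> real) set"
  where "krivine_functions n =
    {h. (\<forall>a b. (\<forall>i<n. a i = b i) \<longrightarrow> h a = h b) \<and>
        continuous_on UNIV h \<and>
        (\<forall>t\<ge>0. \<forall>a. h (\<lambda>i. t * a i) = t * h a)}"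

definition krivine_hom ::
    "nat \<Rightarrow> (nat \<Rightarrow> 'a::banach_lattice) \<Rightarrow> (((nat \<Rightarrow> real) \<Rightarrow> real) \<Rightarrow> 'a) \<Rightarrow> bool"
  where "krivine_hom n x \<tau> \<longleftrightarrow>
    (\<forall>i<n. \<tau> (\<lambda>a. a i) = x i) \<and>
    (\<forall>c. \<forall>h\<in>krivine_functions n. \<tau> (\<lambda>a. c * h a) = c *\<^sub>R \<tau> h) \<and>
    (\<forall>g\<in>krivine_functions n. \<forall>h\<in>krivine_functions n.
       \<tau> (\<lambda>a. g a + h a) = \<tau> g + \<tau> h \<and>
       \<tau> (\<lambda>a. max (g a) (h a)) = sup (\<tau> g) (\<tau> h) \<and>
       \<tau> (\<lambda>a. min (g a) (h a)) = inf (\<tau> g) (\<tau> h))"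

text \<open>
  By Krivine's theorem there is exactly one lattice homomorphism on \<open>krivine_functions n\<close> that maps
  the \<open>i\<close>-th coordinate function to \<open>x i\<close>; \<open>krivine n x h\<close>, for \<open>h\<close> in \<open>krivine_functions n\<close>, is the
  element usually written \<open>h(x\<^sub>1, \<dots>, x\<^sub>n)\<close>.
\<close>

definition krivine :: "nat \<Rightarrow> (nat \<Rightarrow> 'a::banach_lattice) \<Rightarrow> ((nat \<Rightarrow> real) \<Rightarrow> real) \<Rightarrow> 'a"
  where "krivine n x h = (THE y. \<exists>\<tau>. krivine_hom n x \<tau> \<and> \<tau> h = y)"

text \<open>The expression \<open>(\<Sum>\<^sub>i |x\<^sub>i|\<^sup>p)\<^sup>1\<^sup>/\<^sup>p\<close>, for \<open>n > 0\<close> and an exponent \<open>p \<ge> 1\<close>.\<close>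

definition power_sum :: "ennreal \<Rightarrow> nat \<Rightarrow> (nat \<Rightarrow> 'a::banach_lattice) \<Rightarrow> 'a"
  where "power_sum p n x =
    (if p = \<infinity> then \<Squnion>\<^sub>f\<^sub>i\<^sub>n ((\<lambda>i. \<bar>x i\<bar>) ` {..<n})
     else krivine n x (\<lambda>a. (\<Sum>i<n. \<bar>a i\<bar> powr enn2real p) powr (1 / enn2real p)))"

text \<open>With \<open>1 / 0 = \<infinity>\<close> and \<open>1 / \<infinity> = 0\<close> in \<^typ>\<open>ennreal\<close>, this covers \<open>p = 1\<close> and \<open>p = \<infinity>\<close>.\<close>

definition conjugate_exponent :: "ennreal \<Rightarrow> ennreal"
  where "conjugate_exponent p = inverse (1 - inverse p)"

lemma conjugate_exponent:
  assumes "1 \<le> p"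
  shows "inverse p + inverse (conjugate_exponent p) = 1"
proof -
  have "inverse p \<le> 1"
    using assms by (cases p) (auto simp: inverse_ennreal inverse_le_1_iff simp flip: ennreal_1)
  moreover have "inverse (inverse x) = x" for x :: ennreal
  proof (cases x)
    case (real r)
    then show ?thesis
      by (cases "r = 0") (auto simp: inverse_ennreal)
  qed simp
  ultimately show ?thesis
    by (simp add: conjugate_exponent_def add_diff_inverse_ennreal)
qed


section \<open>Regular operators\<close>

definition regular_bound ::
    "ennreal \<Rightarrow> ennreal \<Rightarrow> ('a::banach_lattice \<Rightarrow> 'b::banach_lattice) \<Rightarrow> real \<Rightarrow> bool"
  where "regular_bound p q T K \<longleftrightarrow>
    (\<forall>n>0. \<forall>x. norm (power_sum p n (\<lambda>i. T (x i))) \<le> K * norm (power_sum q n x))"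

definition regular_operators ::
    "ennreal \<Rightarrow> ennreal \<Rightarrow> ('a::banach_lattice \<Rightarrow> 'b::banach_lattice) set"
  where "regular_operators p q = {T. linear T \<and> (\<exists>K>0. regular_bound p q T K)}"

text \<open>
  The infimum is attained: the admissible constants form a closed set. (Zero is included so that
  the zero operator has norm zero.)
\<close>

definition regular_norm ::
    "ennreal \<Rightarrow> ennreal \<Rightarrow> ('a::banach_lattice \<Rightarrow> 'b::banach_lattice) \<Rightarrow> real"
  where "regular_norm p q T = Inf {K. 0 \<le> K \<and> regular_bound p q T K}"


section \<open>The algebraic tensor product\<close>

text \<open>
  The algebraic tensor product is realised as the linear span of the evaluations
  \<open>x \<otimes> z : B \<mapsto> B x z\<close> inside the algebraic dual of the space of real bilinear forms. Functionals are
  set to zero off the bilinear forms, to make the representation unique.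
\<close>

definition tensor_sum_eval ::
    "('a::real_vector \<times> 'b::real_vector) list \<Rightarrow> ('a \<Rightarrow> 'b \<Rightarrow> real) \<Rightarrow> real"
  where "tensor_sum_eval xs B = (if bilinear B then \<Sum>(x, z)\<leftarrow>xs. B x z else 0)"

typedef (overloaded) ('a::real_vector, 'b::real_vector) tensor =
  "range (tensor_sum_eval :: ('a \<times> 'b) list \<Rightarrow> _)"
  morphisms tensor_eval Abs_tensor
  by blast

setup_lifting type_definition_tensor

lift_definition tensor :: "'a::real_vector \<Rightarrow> 'b::real_vector \<Rightarrow> ('a, 'b) tensor"
  is "\<lambda>x z. tensor_sum_eval [(x, z)]"
  by blast

lemma tensor_sum_eval_append:
  "tensor_sum_eval (xs @ ys) B = tensor_sum_eval xs B + tensor_sum_eval ys B"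
  by (simp add: tensor_sum_eval_def)

lemma tensor_sum_eval_scale:
  "tensor_sum_eval (map (\<lambda>(x, z). (c *\<^sub>R x, z)) xs) B = c * tensor_sum_eval xs B"
  by (induction xs)
     (auto simp: tensor_sum_eval_def bilinear_lmul distrib_left split: if_splits)

lemma range_tensor_sum_eval_add:
  assumes "u \<in> range tensor_sum_eval" "v \<in> range tensor_sum_eval"
  shows "(\<lambda>B. u B + v B) \<in> range tensor_sum_eval"
proof -
  obtain xs ys where "u = tensor_sum_eval xs" "v = tensor_sum_eval ys"
    using assms by blast
  then have "(\<lambda>B. u B + v B) = tensor_sum_eval (xs @ ys)"
    by (simp add: fun_eq_iff tensor_sum_eval_append)
  then show ?thesis
    by simp
qed

lemma range_tensor_sum_eval_scale:
  assumes "u \<in> range tensor_sum_eval"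
  shows "(\<lambda>B. c * u B) \<in> range tensor_sum_eval"
proof -
  obtain xs where "u = tensor_sum_eval xs"
    using assms by blast
  then have "(\<lambda>B. c * u B) = tensor_sum_eval (map (\<lambda>(x, z). (c *\<^sub>R x, z)) xs)"
    by (simp add: fun_eq_iff tensor_sum_eval_scale)
  then show ?thesis
    by simp
qed

instantiation tensor :: (real_vector, real_vector) real_vector
begin

lift_definition zero_tensor :: "('a, 'b) tensor" is "\<lambda>B. 0"
  by (rule image_eqI[of _ _ "[]"]) (simp_all add: tensor_sum_eval_def fun_eq_iff)

lift_definition plus_tensor :: "('a, 'b) tensor \<Rightarrow> ('a, 'b) tensor \<Rightarrow> ('a, 'b) tensor"
  is "\<lambda>u v B. u B + v B"
  by (rule range_tensor_sum_eval_add)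

lift_definition scaleR_tensor :: "real \<Rightarrow> ('a, 'b) tensor \<Rightarrow> ('a, 'b) tensor"
  is "\<lambda>c u B. c * u B"
  by (rule range_tensor_sum_eval_scale)

definition uminus_tensor :: "('a, 'b) tensor \<Rightarrow> ('a, 'b) tensor"
  where "- u = (-1) *\<^sub>R (u :: ('a, 'b) tensor)"

definition minus_tensor :: "('a, 'b) tensor \<Rightarrow> ('a, 'b) tensor \<Rightarrow> ('a, 'b) tensor"
  where "u - v = u + (-1) *\<^sub>R (v :: ('a, 'b) tensor)"

instance
  by standard
     (unfold uminus_tensor_def minus_tensor_def, (transfer, simp add: fun_eq_iff algebra_simps)+)

end

lemma tensor_eval_simps [simp]:
  "tensor_eval 0 B = 0"
  "tensor_eval (u + v) B = tensor_eval u B + tensor_eval v B"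
  "tensor_eval (c *\<^sub>R u) B = c * tensor_eval u B"
  by (transfer, simp)+

lemma linear_tensor_eval: "linear (\<lambda>u. tensor_eval u B)"
  by (simp add: linear_iff)

lemma tensor_eval_tensor: "bilinear B \<Longrightarrow> tensor_eval (tensor x z) B = B x z"
  by transfer (simp add: tensor_sum_eval_def)

lemma tensor_bilinear:
  "tensor (x + x') z = tensor x z + tensor x' z"
  "tensor x (z + z') = tensor x z + tensor x z'"
  "tensor (c *\<^sub>R x) z = c *\<^sub>R tensor x z"
  "tensor x (c *\<^sub>R z) = c *\<^sub>R tensor x z"
  by (transfer, auto simp: tensor_sum_eval_def fun_eq_iff
        bilinear_ladd bilinear_radd bilinear_lmul bilinear_rmul)+

lemma tensor_as_sum: "\<exists>xs. u = (\<Sum>(x, z)\<leftarrow>xs. tensor x z)"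
proof -
  obtain xs where xs: "tensor_eval u = tensor_sum_eval xs"
    using tensor_eval[of u] by blast
  have "tensor_eval (\<Sum>(x, z)\<leftarrow>ys. tensor x z) = tensor_sum_eval ys" for ys :: "('a \<times> 'b) list"
  proof (induction ys)
    case Nil
    then show ?case
      by (simp add: fun_eq_iff tensor_sum_eval_def)
  next
    case (Cons y ys)
    have "tensor_eval (tensor (fst y) (snd y)) = tensor_sum_eval [y]"
      by (simp add: tensor.rep_eq)
    moreover have "tensor_sum_eval (y # ys) B = tensor_sum_eval [y] B + tensor_sum_eval ys B" for B
      using tensor_sum_eval_append[of "[y]" ys] by simp
    ultimately show ?case
      using Cons by (simp add: fun_eq_iff case_prod_beta)
  qed
  then have "u = (\<Sum>(x, z)\<leftarrow>xs. tensor x z)"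
    using xs by (simp add: tensor_eval_inject [symmetric])
  then show ?thesis
    by blast
qed

lemma linear_tensor_eqI:
  fixes \<phi> \<psi> :: "('a::real_vector, 'b::real_vector) tensor \<Rightarrow> real"
  assumes "linear \<phi>" "linear \<psi>" "\<And>x z. \<phi> (tensor x z) = \<psi> (tensor x z)"
  shows "\<phi> = \<psi>"
proof
  fix u :: "('a, 'b) tensor"
  obtain xs where u: "u = (\<Sum>(x, z)\<leftarrow>xs. tensor x z)"
    using tensor_as_sum by blast
  have "\<phi> (\<Sum>(x, z)\<leftarrow>ys. tensor x z) = \<psi> (\<Sum>(x, z)\<leftarrow>ys. tensor x z)" for ys :: "('a \<times> 'b) list"
    using assms by (induction ys) (auto simp: linear_0 linear_add)
  then show "\<phi> u = \<psi> u"
    by (simp add: u)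
qed


section \<open>The norm on the tensor product and its dual\<close>

definition phi_pq ::
    "ennreal \<Rightarrow> ennreal \<Rightarrow> ('a::banach_lattice, 'b::banach_lattice) tensor \<Rightarrow> real"
  where "phi_pq p q u =
    Inf {norm (power_sum q n x) * norm (power_sum (conjugate_exponent p) n z) | n x z.
           n > 0 \<and> u = (\<Sum>i<n. tensor (x i) (z i))}"

definition r_pq ::
    "ennreal \<Rightarrow> ennreal \<Rightarrow> ('a::banach_lattice, 'b::banach_lattice) tensor \<Rightarrow> real"
  where "r_pq p q u = Inf {\<Sum>j<m. phi_pq p q (v j) | (m::nat) v. m > 0 \<and> u = (\<Sum>j<m. v j)}"

definition tensor_dual ::
    "ennreal \<Rightarrow> ennreal \<Rightarrow> (('a::banach_lattice, 'b::banach_lattice) tensor \<Rightarrow> real) set"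
  where "tensor_dual p q = {\<phi>. linear \<phi> \<and> (\<exists>C. \<forall>u. \<bar>\<phi> u\<bar> \<le> C * r_pq p q u)}"

definition tensor_dual_norm ::
    "ennreal \<Rightarrow> ennreal \<Rightarrow> (('a::banach_lattice, 'b::banach_lattice) tensor \<Rightarrow> real) \<Rightarrow> real"
  where "tensor_dual_norm p q \<phi> = Sup {\<bar>\<phi> u\<bar> | u. r_pq p q u \<le> 1}"


section \<open>Trace duality\<close>

definition trace_functional ::
    "('a::real_normed_vector \<Rightarrow> 'b::real_normed_vector) \<Rightarrow> ('a, 'b dual) tensor \<Rightarrow> real"
  where "trace_functional T u = tensor_eval u (\<lambda>x f. dual_apply f (T x))"

lemma bilinear_trace: "linear T \<Longrightarrow> bilinear (\<lambda>x f. dual_apply f (T x))"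
  by (simp add: bilinear_def linear_iff linear_add[OF linear_dual_apply]
        linear_cmul[OF linear_dual_apply])

text \<open>For linear \<open>T\<close>, this is the linear functional determined by its values on elementary tensors.\<close>

lemma trace_functional_iff:
  assumes "linear T"
  shows "\<phi> = trace_functional T \<longleftrightarrow>
    linear \<phi> \<and> (\<forall>x f. \<phi> (tensor x f) = dual_apply f (T x))"
proof -
  have "linear (trace_functional T)"
    unfolding trace_functional_def by (rule linear_tensor_eval)
  moreover have "trace_functional T (tensor x f) = dual_apply f (T x)" for x f
    unfolding trace_functional_def using bilinear_trace[OF assms] by (rule tensor_eval_tensor)
  ultimately show ?thesis
    using linear_tensor_eqI by metis
qed

text \<open>
  The operator \<open>T\<^sub>\<phi> : X \<rightarrow> Y**\<close> of a functional \<open>\<phi>\<close>, and the canonical embedding \<open>Y \<rightarrow> Y**\<close>; elements of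
  \<open>Y**\<close> are written as plain functions on \<open>Y*\<close>.
\<close>

definition trace_operator ::
    "(('a::real_normed_vector, 'b::real_normed_vector dual) tensor \<Rightarrow> real) \<Rightarrow> 'a \<Rightarrow> 'b dual \<Rightarrow> real"
  where "trace_operator \<phi> x f = \<phi> (tensor x f)"

definition canonical_embedding :: "'b::real_normed_vector \<Rightarrow> 'b dual \<Rightarrow> real"
  where "canonical_embedding y f = dual_apply f y"

end

theory Submission
  imports Defs "HOL-Library.Function_Algebras"
begin

text \<open>
  The two norms are linked by the duality of power sums: on the one hand
  \<open>\<Sum>i. f\<^sub>i(y\<^sub>i) \<le> \<parallel>(\<Sum>|y\<^sub>i|\<^sup>p)\<^sup>1\<^sup>/\<^sup>p\<parallel> \<parallel>(\<Sum>|f\<^sub>i|\<^sup>r)\<^sup>1\<^sup>/\<^sup>r\<parallel>\<close> when \<open>1/p + 1/r = 1\<close>, and on the other hand some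
  family with \<open>\<parallel>(\<Sum>|f\<^sub>i|\<^sup>r)\<^sup>1\<^sup>/\<^sup>r\<parallel> \<le> 1\<close> attains \<open>\<parallel>(\<Sum>|y\<^sub>i|\<^sup>p)\<^sup>1\<^sup>/\<^sup>p\<parallel>\<close>. Both rest on the description of
  \<open>(\<Sum>|x\<^sub>i|\<^sup>p)\<^sup>1\<^sup>/\<^sup>p\<close> as the least upper bound of the combinations \<open>\<Sum> a\<^sub>i x\<^sub>i\<close> with \<open>\<parallel>a\<parallel>\<^sub>r \<le> 1\<close>. The functional
  calculus is reduced to real functions by the real lattice homomorphisms on the ideal generated by
  \<open>\<Sum>|x\<^sub>i|\<close>, which separate points: they arise as minimal elements among the sublinear functionals that
  preserve suprema.
\<close>

section \<open>Dominated linear functionals\<close>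

text \<open>The isometry rests on an identity of sets: a constant K \<ge> 0 is admissible for the
  regularity of T exactly when the trace functional is bounded by K times \<open>r_pq\<close>.
  Passing from \<open>phi_pq\<close> to its subadditive envelope \<open>r_pq\<close> costs a linear
  functional nothing, because bounds on the summands add up. What remains is the duality of power
  sums. The obstacle there is that a Banach lattice can have no non-zero real lattice homomorphism
  at all (an atomless L^p with p < \<infinity>), so inequalities cannot be tested by homomorphisms
  of the whole lattice. On the ideal generated by e they can, since e is an order unit there. The
  price is that these homomorphisms need not be continuous for the norm; norm limits are therefore
  always accompanied by order estimates in multiples of e. For the family that attains the norm, the
  Hahn-Banach argument is dominated by a fixed positive functional g applied to the power sum,
  rather than by the norm of the power sum. Domination by g is an order statement, and it places the
  power sum of the resulting functionals below g in the dual lattice.\<close>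

definition sublinear_on :: "'a::real_vector set \<Rightarrow> ('a \<Rightarrow> real) \<Rightarrow> bool"
  where "sublinear_on V q \<longleftrightarrow>
    (\<forall>x\<in>V. \<forall>y\<in>V. q (x + y) \<le> q x + q y) \<and> (\<forall>c\<ge>0. \<forall>x\<in>V. q (c *\<^sub>R x) = c * q x)"

text \<open>Like \<open>sublinear_on\<close>, this is relative to a set, because the ideal generated
  by an element is a subspace that depends on that element and is not a type. Values off
  \<open>V\<close> are irrelevant.\<close>

definition linear_fun_on :: "'a::real_vector set \<Rightarrow> ('a \<Rightarrow> real) \<Rightarrow> bool"
  where "linear_fun_on V f \<longleftrightarrow>
    (\<forall>x\<in>V. \<forall>y\<in>V. f (x + y) = f x + f y) \<and> (\<forall>c. \<forall>x\<in>V. f (c *\<^sub>R x) = c * f x)"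

lemma sublinear_onD:
  assumes "sublinear_on V q"
  shows "x \<in> V \<Longrightarrow> y \<in> V \<Longrightarrow> q (x + y) \<le> q x + q y"
    and "0 \<le> c \<Longrightarrow> x \<in> V \<Longrightarrow> q (c *\<^sub>R x) = c * q x"
  using assms by (auto simp: sublinear_on_def)

lemma sublinear_on_lower:
  assumes "subspace V" "sublinear_on V q" "x \<in> V"
  shows "- q (- x) \<le> q x"
proof -
  have "q (x + - x) \<le> q x + q (- x)"
    using assms by (intro sublinear_onD) (auto intro: subspace_neg)
  moreover have "q (0 *\<^sub>R x) = 0 * q x"
    using assms by (intro sublinear_onD) auto
  ultimately show ?thesis
    by simp
qed

text \<open>Covers both the chains of Zorn's lemma and the one-parameter families behind
  \<open>directional_inf\<close>. The lower bounds make the real infima meaningful.\<close>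

definition pointwise_chain :: "'a set \<Rightarrow> ('a \<Rightarrow> real) set \<Rightarrow> bool"
  where "pointwise_chain V C \<longleftrightarrow>
    C \<noteq> {} \<and> (\<forall>x\<in>V. bdd_below ((\<lambda>q. q x) ` C)) \<and>
    (\<forall>q\<in>C. \<forall>r\<in>C. (\<forall>x\<in>V. q x \<le> r x) \<or> (\<forall>x\<in>V. r x \<le> q x))"

text \<open>Of two near-minimisers, one for each point, the smaller one serves both points because
  members of a chain are comparable. This is why sums and maxima pass to the infimum of a
  chain.\<close>

lemma pointwise_chain_INF_approx:
  assumes "pointwise_chain V C" "x \<in> V" "y \<in> V" "0 < e"
  obtains q where "q \<in> C" "q x < (INF q\<in>C. q x) + e" "q y < (INF q\<in>C. q y) + e"
proof -
  have ne: "C \<noteq> {}" and bdd: "\<And>z. z \<in> V \<Longrightarrow> bdd_below ((\<lambda>q. q z) ` C)"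
    and ch: "\<And>q r. q \<in> C \<Longrightarrow> r \<in> C \<Longrightarrow> (\<forall>x\<in>V. q x \<le> r x) \<or> (\<forall>x\<in>V. r x \<le> q x)"
    using assms(1) by (auto simp: pointwise_chain_def)
  have "\<exists>q\<in>C. q z < (INF q\<in>C. q z) + e" if "z \<in> V" for z
  proof -
    have "(INF q\<in>C. q z) < (INF q\<in>C. q z) + e"
      using assms by simp
    then show ?thesis
      using ne bdd[OF that] by (subst (asm) cINF_less_iff) auto
  qed
  then obtain q r where q: "q \<in> C" "q x < (INF q\<in>C. q x) + e"
    and r: "r \<in> C" "r y < (INF q\<in>C. q y) + e"
    using assms by metis
  show thesis
    using ch[OF q(1) r(1)] that[OF q(1)] that[OF r(1)] q(2) r(2) assms(2,3)
    by (meson order.strict_trans1)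
qed

lemma pointwise_chain_INF_le:
  assumes "pointwise_chain V C" "x \<in> V" "q \<in> C"
  shows "(INF q\<in>C. q x) \<le> q x"
  using assms by (intro cINF_lower) (auto simp: pointwise_chain_def)

lemma sublinear_on_INF:
  assumes V: "subspace V" and C: "pointwise_chain V C" and sub: "\<And>q. q \<in> C \<Longrightarrow> sublinear_on V q"
  shows "sublinear_on V (\<lambda>x. INF q\<in>C. q x)"
  unfolding sublinear_on_def
proof (intro conjI ballI allI impI)
  fix x y assume xy: "x \<in> V" "y \<in> V"
  show "(INF q\<in>C. q (x + y)) \<le> (INF q\<in>C. q x) + (INF q\<in>C. q y)"
  proof (rule field_le_epsilon)
    fix e :: real assume e: "0 < e"
    then obtain q where q: "q \<in> C" "q x < (INF q\<in>C. q x) + e/2" "q y < (INF q\<in>C. q y) + e/2"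
      using pointwise_chain_INF_approx[OF C xy, of "e/2"] by auto
    have "(INF q\<in>C. q (x + y)) \<le> q (x + y)"
      using V xy q by (intro pointwise_chain_INF_le[OF C]) (auto intro: subspace_add)
    also have "\<dots> \<le> q x + q y"
      using sub q xy by (auto intro: sublinear_onD)
    finally show "(INF q\<in>C. q (x + y)) \<le> (INF q\<in>C. q x) + (INF q\<in>C. q y) + e"
      using q by simp
  qed
next
  fix c :: real and x assume cx: "0 \<le> c" "x \<in> V"
  have ne: "C \<noteq> {}"
    using C by (simp add: pointwise_chain_def)
  have hom: "q (c *\<^sub>R x) = c * q x" if "q \<in> C" for q
    using sub[OF that] cx by (simp add: sublinear_onD)
  show "(INF q\<in>C. q (c *\<^sub>R x)) = c * (INF q\<in>C. q x)"
  proof (rule antisym)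
    show "c * (INF q\<in>C. q x) \<le> (INF q\<in>C. q (c *\<^sub>R x))"
      using ne cx by (intro cINF_greatest) (auto simp: hom intro!: mult_left_mono pointwise_chain_INF_le[OF C])
    show "(INF q\<in>C. q (c *\<^sub>R x)) \<le> c * (INF q\<in>C. q x)"
    proof (rule field_le_epsilon)
      fix e :: real assume e: "0 < e"
      \<comment> \<open>The denominator is \<open>c + 1\<close> because \<open>c\<close> may be
        zero; the error \<open>c / (c + 1) * e\<close> still stays below \<open>e\<close>.\<close>
      then have "0 < e / (c + 1)"
        using cx by simp
      then obtain q where q: "q \<in> C" "q x < (INF q\<in>C. q x) + e / (c + 1)"
        using pointwise_chain_INF_approx[OF C cx(2) cx(2)] by metis
      have "(INF q\<in>C. q (c *\<^sub>R x)) \<le> c * q x"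
        using V cx q hom by (metis pointwise_chain_INF_le[OF C] subspace_scale)
      also have "\<dots> \<le> c * ((INF q\<in>C. q x) + e / (c + 1))"
        using q cx by (intro mult_left_mono) auto
      also have "\<dots> = c * (INF q\<in>C. q x) + c / (c + 1) * e"
        by (simp add: algebra_simps)
      also have "c / (c + 1) * e \<le> 1 * e"
        using cx e by (intro mult_right_mono) auto
      finally show "(INF q\<in>C. q (c *\<^sub>R x)) \<le> c * (INF q\<in>C. q x) + e"
        by simp
    qed
  qed
qed

text \<open>
  The class of admissible sublinear functionals is a parameter, so that the same minimality argument
  yields both the Hahn--Banach theorem and the existence of real lattice homomorphisms.
\<close>

definition admissible_class :: "'a::real_vector set \<Rightarrow> (('a \<Rightarrow> real) \<Rightarrow> bool) \<Rightarrow> bool"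
  where "admissible_class V P \<longleftrightarrow>
    (\<forall>q r. (\<forall>x\<in>V. q x = r x) \<longrightarrow> P q \<longrightarrow> P r) \<and>
    (\<forall>C. pointwise_chain V C \<longrightarrow> (\<forall>q\<in>C. P q) \<longrightarrow> P (\<lambda>x. INF q\<in>C. q x)) \<and>
    (\<forall>q. \<forall>y\<in>V. \<forall>c. P q \<longrightarrow> P (\<lambda>x. q (x + y) - c))"

text \<open>The standard device for lowering a sublinear functional in the direction
  \<open>y\<close>: the parameter t = 0 shows that it lies below \<open>q\<close>, and t = 1 at the
  point - y gives a value of at most - q y. A functional that this device cannot lower is additive
  along \<open>y\<close>.\<close>

definition directional_inf :: "('a::real_vector \<Rightarrow> real) \<Rightarrow> 'a \<Rightarrow> 'a \<Rightarrow> real"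
  where "directional_inf q y x = (INF t\<in>{0..}. q (x + t *\<^sub>R y) - t * q y)"

context
  fixes V :: "'a::real_vector set" and q :: "'a \<Rightarrow> real" and y :: 'a
  assumes V: "subspace V" and q: "sublinear_on V q" and y: "y \<in> V"
begin

private definition "fam = (\<lambda>t x. q (x + t *\<^sub>R y) - t * q y) ` {0..}"

private lemma directional_inf_eq: "directional_inf q y x = (INF r\<in>fam. r x)"
  unfolding directional_inf_def fam_def by (simp add: image_image)

private lemma in_V: "x \<in> V \<Longrightarrow> x + t *\<^sub>R y \<in> V"
  using V y by (intro subspace_add subspace_scale)

text \<open>Raising the parameter from s to t adds (t - s) y, for which \<open>q\<close> charges at
  most (t - s) q y. The family is thus decreasing in the parameter, hence a chain, and closure under
  infima of chains applies to it.\<close>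

private lemma antimono:
  assumes "x \<in> V" "0 \<le> s" "s \<le> t"
  shows "q (x + t *\<^sub>R y) - t * q y \<le> q (x + s *\<^sub>R y) - s * q y"
proof -
  have "q ((x + s *\<^sub>R y) + (t - s) *\<^sub>R y) \<le> q (x + s *\<^sub>R y) + q ((t - s) *\<^sub>R y)"
    using assms in_V[of x] in_V[of 0] V by (intro sublinear_onD[OF q]) (auto simp: subspace_0)
  also have "q ((t - s) *\<^sub>R y) = (t - s) * q y"
    using assms y by (intro sublinear_onD[OF q]) auto
  also have "(x + s *\<^sub>R y) + (t - s) *\<^sub>R y = x + t *\<^sub>R y"
    by (simp add: algebra_simps)
  finally show ?thesis
    by (simp add: algebra_simps)
qed

private lemma chain: "pointwise_chain V fam"
  unfolding pointwise_chain_def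
proof (intro conjI ballI)
  show "fam \<noteq> {}"
    by (auto simp: fam_def)
  show "bdd_below ((\<lambda>r. r x) ` fam)" if x: "x \<in> V" for x
  proof (rule bdd_belowI2)
    fix r assume "r \<in> fam"
    then obtain t where t: "0 \<le> t" "r = (\<lambda>x. q (x + t *\<^sub>R y) - t * q y)"
      by (auto simp: fam_def)
    have "q ((x + t *\<^sub>R y) + - x) \<le> q (x + t *\<^sub>R y) + q (- x)"
      using x V by (intro sublinear_onD[OF q] in_V subspace_neg)
    then show "- q (- x) \<le> r x"
      using t y sublinear_onD(2)[OF q, of t y] by simp
  qed
  fix r s assume "r \<in> fam" "s \<in> fam"
  then obtain a b where "0 \<le> a" "r = (\<lambda>x. q (x + a *\<^sub>R y) - a * q y)"
    "0 \<le> b" "s = (\<lambda>x. q (x + b *\<^sub>R y) - b * q y)"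
    by (auto simp: fam_def)
  then show "(\<forall>x\<in>V. r x \<le> s x) \<or> (\<forall>x\<in>V. s x \<le> r x)"
    using antimono by (meson linear)
qed

lemma directional_inf_upper:
  assumes "x \<in> V" "0 \<le> t"
  shows "directional_inf q y x \<le> q (x + t *\<^sub>R y) - t * q y"
  unfolding directional_inf_eq
  by (rule order_trans[OF pointwise_chain_INF_le[OF chain assms(1)]]) (use assms in \<open>auto simp: fam_def\<close>)

text \<open>The members of the family are in general not homogeneous themselves, so
  \<open>sublinear_on_INF\<close> does not apply. Sublinearity comes from moving the parameter: s
  and t combine to s + t for a sum, and scaling by c turns t into t / c.\<close>

lemma sublinear_directional_inf: "sublinear_on V (directional_inf q y)"
  unfolding sublinear_on_def
proof (intro conjI ballI allI impI)
  have 1: "\<exists>t\<ge>0. q (x + t *\<^sub>R y) - t * q y < directional_inf q y x + e"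
    if "x \<in> V" "0 < e" for x e
    using pointwise_chain_INF_approx[OF chain that(1,1,2)] unfolding directional_inf_eq
    by (smt (verit) fam_def imageE atLeast_iff)
  fix u v assume uv: "u \<in> V" "v \<in> V"
  show "directional_inf q y (u + v) \<le> directional_inf q y u + directional_inf q y v"
  proof (rule field_le_epsilon)
    fix e :: real assume "0 < e"
    then obtain s t where s: "0 \<le> s" "q (u + s *\<^sub>R y) - s * q y < directional_inf q y u + e/2"
      and t: "0 \<le> t" "q (v + t *\<^sub>R y) - t * q y < directional_inf q y v + e/2"
      using 1[OF uv(1), of "e/2"] 1[OF uv(2), of "e/2"] by auto
    have "directional_inf q y (u + v) \<le> q ((u + v) + (s + t) *\<^sub>R y) - (s + t) * q y"
      using uv s t V by (intro directional_inf_upper subspace_add) auto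
    also have "(u + v) + (s + t) *\<^sub>R y = (u + s *\<^sub>R y) + (v + t *\<^sub>R y)"
      by (simp add: algebra_simps)
    also have "q \<dots> \<le> q (u + s *\<^sub>R y) + q (v + t *\<^sub>R y)"
      using uv by (intro sublinear_onD[OF q] in_V)
    finally show "directional_inf q y (u + v) \<le> directional_inf q y u + directional_inf q y v + e"
      using s t by (simp add: algebra_simps)
  qed
next
  have least: "m \<le> directional_inf q y x" if "\<And>t. 0 \<le> t \<Longrightarrow> m \<le> q (x + t *\<^sub>R y) - t * q y" for m x
    unfolding directional_inf_def using that by (intro cINF_greatest) auto
  have le: "c * directional_inf q y u \<le> directional_inf q y (c *\<^sub>R u)" if "0 < c" "u \<in> V" for c u
  proof (rule least)
    fix t :: real assume t: "0 \<le> t"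
    have "c * directional_inf q y u \<le> c * (q (u + (t / c) *\<^sub>R y) - (t / c) * q y)"
      using that t by (intro mult_left_mono directional_inf_upper) auto
    also have "\<dots> = q (c *\<^sub>R (u + (t / c) *\<^sub>R y)) - t * q y"
      using that by (simp add: sublinear_onD[OF q] in_V right_diff_distrib)
    finally show "c * directional_inf q y u \<le> q (c *\<^sub>R u + t *\<^sub>R y) - t * q y"
      using that by (simp add: algebra_simps)
  qed
  fix c :: real and u assume c: "0 \<le> c" and u: "u \<in> V"
  show "directional_inf q y (c *\<^sub>R u) = c * directional_inf q y u"
  proof (cases "c = 0")
    case True
    have "directional_inf q y 0 = 0"
    proof (rule antisym)
      show "directional_inf q y 0 \<le> 0"
        using directional_inf_upper[of 0 0] sublinear_onD(2)[OF q, of 0 y] y V by (simp add: subspace_0)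
      show "0 \<le> directional_inf q y 0"
        by (rule least) (use y in \<open>simp add: sublinear_onD[OF q]\<close>)
    qed
    then show ?thesis
      using True by simp
  next
    case False
    have "inverse c * directional_inf q y (c *\<^sub>R u) \<le> directional_inf q y (inverse c *\<^sub>R c *\<^sub>R u)"
      using False c u V by (intro le) (auto intro: subspace_scale)
    then have "directional_inf q y (c *\<^sub>R u) \<le> c * directional_inf q y u"
      using False c by (simp add: field_simps)
    then show ?thesis
      using le[of c u] False c u by simp
  qed
qed

lemma admissible_directional_inf:
  assumes P: "admissible_class V P" "P q"
  shows "P (directional_inf q y)"
proof -
  have "P r" if r: "r \<in> fam" for r
  proof -
    obtain t where "r = (\<lambda>x. q (x + t *\<^sub>R y) - t * q y)"
      using r by (auto simp: fam_def)
    moreover have "t *\<^sub>R y \<in> V"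
      using V y by (rule subspace_scale)
    ultimately show ?thesis
      using P by (simp add: admissible_class_def)
  qed
  then have "P (\<lambda>x. INF r\<in>fam. r x)"
    using P(1) chain unfolding admissible_class_def by blast
  then show ?thesis
    by (simp add: directional_inf_eq[abs_def])
qed

end

text \<open>A minimal admissible sublinear functional is linear: \<open>directional_inf f v\<close>
  lies below \<open>f\<close>, so it equals \<open>f\<close>, and its bound at t = 1 is
  superadditivity. The value at \<open>y\<close> is secured in advance by working below
  \<open>directional_inf p y\<close> instead of \<open>p\<close>. Its value at - y is at most - p y,
  and every linear minorant therefore has value at least p y at \<open>y\<close>.\<close>

theorem dominated_linear_exists:
  fixes V :: "'a::real_vector set"
  assumes V: "subspace V" and p: "sublinear_on V p" and P: "admissible_class V P" "P p"
    and y: "y \<in> V"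
  shows "\<exists>f. linear_fun_on V f \<and> P f \<and> (\<forall>x\<in>V. f x \<le> p x) \<and> f y = p y"
proof -
  define p' where "p' = directional_inf p y"
  have p': "sublinear_on V p'" "P p'"
    unfolding p'_def using assms by (auto intro: sublinear_directional_inf admissible_directional_inf)
  have p'_le: "p' x \<le> p x" if "x \<in> V" for x
    unfolding p'_def using directional_inf_upper[OF V p y that, of 0] by simp
  have p'_y: "p' (- y) \<le> - p y"
    unfolding p'_def using directional_inf_upper[OF V p y subspace_neg[OF V y], of 1]
      sublinear_onD(2)[OF p, of 0 y] y by simp
  \<comment> \<open>Members vanish off \<open>V\<close>, so that the order of functions compares
    them on \<open>V\<close> only.\<close>
  define A where "A = {q. sublinear_on V q \<and> P q \<and> (\<forall>x\<in>V. q x \<le> p' x) \<and> (\<forall>x. x \<notin> V \<longrightarrow> q x = 0)}"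
  \<comment> \<open>The reversed order: the maximal elements supplied by Zorn's lemma are minimal
    functionals.\<close>
  define R where "R = (\<lambda>q r :: 'a \<Rightarrow> real. r \<le> q)"
  define cut where "cut q = (\<lambda>x. if x \<in> V then q x else 0 :: real)" for q :: "'a \<Rightarrow> real"
  have cut_A: "cut q \<in> A" if "sublinear_on V q" "P q" "\<And>x. x \<in> V \<Longrightarrow> q x \<le> p' x" for q
  proof -
    have "P (cut q)"
    proof -
      have "\<forall>x\<in>V. q x = cut q x"
        by (simp add: cut_def)
      then show ?thesis
        using that(2) P(1) unfolding admissible_class_def by blast
    qed
    then show ?thesis
      using that V by (auto simp: A_def sublinear_on_def cut_def subspace_add subspace_scale)
  qed
  have "\<exists>m\<in>A. \<forall>a\<in>A. R m a \<longrightarrow> a = m"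
  proof (rule predicate_Zorn)
    show "partial_order_on A (relation_of R A)"
      by (rule partial_order_on_relation_ofI) (auto simp: R_def)
    fix C assume "C \<in> Chains (relation_of R A)"
    then have CA: "C \<subseteq> A" and ch: "\<And>q r. q \<in> C \<Longrightarrow> r \<in> C \<Longrightarrow> q \<le> r \<or> r \<le> q"
      by (auto simp: Chains_def relation_of_def R_def)
    show "\<exists>u\<in>A. \<forall>a\<in>C. R a u"
    proof (cases "C = {}")
      case True
      then show ?thesis
        using cut_A[OF p'] by auto
    next
      case False
      have C: "pointwise_chain V C"
        unfolding pointwise_chain_def
      proof (intro conjI ballI False)
        show "bdd_below ((\<lambda>q. q x) ` C)" if x: "x \<in> V" for x
        proof (rule bdd_belowI2)
          fix q assume "q \<in> C"
          then have "sublinear_on V q" "q (- x) \<le> p' (- x)"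
            using CA x V by (auto simp: A_def subspace_neg)
          then show "- p' (- x) \<le> q x"
            using sublinear_on_lower[OF V _ x, of q] by linarith
        qed
        show "(\<forall>x\<in>V. q x \<le> r x) \<or> (\<forall>x\<in>V. r x \<le> q x)" if "q \<in> C" "r \<in> C" for q r
          using ch[OF that] by (auto simp: le_fun_def)
      qed
      let ?u = "\<lambda>x. INF q\<in>C. q x"
      have low: "?u x \<le> q x" if "x \<in> V" "q \<in> C" for x q
        using pointwise_chain_INF_le[OF C that] .
      have "sublinear_on V ?u"
        using CA by (intro sublinear_on_INF[OF V C]) (auto simp: A_def)
      moreover have "P ?u"
        using P(1) C CA unfolding admissible_class_def A_def by blast
      moreover have "?u x \<le> p' x" if "x \<in> V" for x
        using False CA low[OF that] that by (fastforce simp: A_def)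
      ultimately have "cut ?u \<in> A"
        by (intro cut_A)
      moreover have "cut ?u \<le> q" if "q \<in> C" for q
        using low that CA by (auto simp: le_fun_def cut_def A_def)
      ultimately show ?thesis
        unfolding R_def by blast
    qed
  qed
  then obtain f where f: "f \<in> A" and min: "\<And>g. g \<in> A \<Longrightarrow> g \<le> f \<Longrightarrow> g = f"
    by (auto simp: R_def)
  have fs: "sublinear_on V f" and Pf: "P f" and f_le: "\<And>x. x \<in> V \<Longrightarrow> f x \<le> p' x"
    and f0: "\<And>x. x \<notin> V \<Longrightarrow> f x = 0"
    using f by (auto simp: A_def)
  have super: "f u + f v \<le> f (u + v)" if uv: "u \<in> V" "v \<in> V" for u v
  proof -
    have le: "directional_inf f v x \<le> f x" if "x \<in> V" for x
      using directional_inf_upper[OF V fs uv(2) that, of 0] by simp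
    have "cut (directional_inf f v) \<in> A"
      using sublinear_directional_inf[OF V fs uv(2)] admissible_directional_inf[OF V fs uv(2) P(1) Pf] le f_le
      by (intro cut_A) (auto intro: order_trans)
    moreover have "cut (directional_inf f v) \<le> f"
      using le f0 by (auto simp: cut_def le_fun_def)
    ultimately have "cut (directional_inf f v) = f"
      by (rule min)
    then have "f u = directional_inf f v u"
      using uv by (metis cut_def)
    then show ?thesis
      using directional_inf_upper[OF V fs uv(2) uv(1), of 1] by simp
  qed
  have add: "f (u + v) = f u + f v" if "u \<in> V" "v \<in> V" for u v
    using super[OF that] sublinear_onD(1)[OF fs that] by simp
  have zero: "f 0 = 0"
    using sublinear_onD(2)[OF fs, of 0 0] V by (simp add: subspace_0)
  have neg: "f (- u) = - f u" if "u \<in> V" for u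
    using add[of u "- u"] that V zero by (simp add: subspace_neg)
  have scale: "f (c *\<^sub>R u) = c * f u" if u: "u \<in> V" for c u
  proof (cases "0 \<le> c")
    case True
    then show ?thesis
      using fs u by (simp add: sublinear_onD)
  next
    case False
    have "f (c *\<^sub>R u) = f (- ((- c) *\<^sub>R u))"
      by simp
    also have "\<dots> = - f ((- c) *\<^sub>R u)"
      using u V by (intro neg subspace_scale)
    also have "\<dots> = c * f u"
      using False u fs by (subst sublinear_onD(2)) auto
    finally show ?thesis .
  qed
  have "linear_fun_on V f"
    using add scale by (auto simp: linear_fun_on_def)
  moreover have f_le_p: "f x \<le> p x" if "x \<in> V" for x
    using f_le[OF that] p'_le[OF that] by simp
  moreover have "p y \<le> f y"
    using f_le[OF subspace_neg[OF V y]] p'_y neg[OF y] by simp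
  with f_le_p[OF y] have "f y = p y"
    by simp
  ultimately show ?thesis
    using Pf by blast
qed

section \<open>Order, norm and limits in a Banach lattice\<close>

lemma norm_mono_nonneg: "0 \<le> x \<Longrightarrow> x \<le> y \<Longrightarrow> norm x \<le> norm y"
  for x y :: "'a::banach_lattice"
  by (rule norm_mono_abs) simp

lemma norm_le_of_abs_le: "\<bar>x\<bar> \<le> y \<Longrightarrow> norm x \<le> norm y"
  for x y :: "'a::banach_lattice"
  by (metis abs_ge_zero norm_abs_lattice norm_mono_nonneg)

text \<open>The Archimedean property: the norm of the positive part of \<open>x\<close> is at most
  \<epsilon> times the norm of \<open>e\<close> for every \<epsilon>, hence zero.\<close>

lemma nonpos_if_le_small:
  fixes x e :: "'a::banach_lattice"
  assumes "\<And>\<epsilon>. 0 < \<epsilon> \<Longrightarrow> x \<le> \<epsilon> *\<^sub>R e"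
  shows "x \<le> 0"
proof -
  have "norm (pprt x) \<le> 0"
  proof (rule field_le_epsilon)
    fix d :: real assume d: "0 < d"
    define \<epsilon> where "\<epsilon> = d / (norm e + 1)"
    have \<epsilon>: "0 < \<epsilon>"
      unfolding \<epsilon>_def using d by (intro divide_pos_pos) (simp_all add: add_nonneg_pos)
    have "pprt x \<le> \<bar>\<epsilon> *\<^sub>R e\<bar>"
      unfolding pprt_def using assms[OF \<epsilon>] by (intro sup_least) (auto intro: order_trans abs_ge_self)
    then have "norm (pprt x) \<le> norm (\<epsilon> *\<^sub>R e)"
      using norm_mono_nonneg[of "pprt x" "\<bar>\<epsilon> *\<^sub>R e\<bar>"] by simp
    also have "\<dots> = d * (norm e / (norm e + 1))"
      using d by (simp add: \<epsilon>_def)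
    also have "\<dots> \<le> d * 1"
      using d add_nonneg_pos[OF norm_ge_zero zero_less_one, of e] by (intro mult_left_mono) simp_all
    finally show "norm (pprt x) \<le> 0 + d"
      by simp
  qed
  then show ?thesis
    by (simp add: le_zero_iff_zero_pprt)
qed

lemma le_if_le_add_small:
  fixes x y e :: "'a::banach_lattice"
  assumes "\<And>\<epsilon>. 0 < \<epsilon> \<Longrightarrow> x \<le> y + \<epsilon> *\<^sub>R e"
  shows "x \<le> y"
  using nonpos_if_le_small[of "x - y" e] assms by (simp add: algebra_simps)

text \<open>The positive cone is closed. From - l \<le> y k - l, the positive part of - l has norm
  at most that of y k - l, which tends to zero.\<close>

lemma nonneg_limit:
  fixes y :: "nat \<Rightarrow> 'a::banach_lattice"
  assumes lim: "y \<longlonglongrightarrow> l" and pos: "\<And>k. m \<le> k \<Longrightarrow> 0 \<le> y k"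
  shows "0 \<le> l"
proof -
  have "norm (pprt (- l)) \<le> 0"
  proof (rule LIMSEQ_le_const)
    have "(\<lambda>k. norm (y k - l)) \<longlonglongrightarrow> norm (l - l)"
      using lim by (intro tendsto_intros)
    then show "(\<lambda>k. norm (y k - l)) \<longlonglongrightarrow> 0"
      by simp
    have "norm (pprt (- l)) \<le> norm (y k - l)" if "m \<le> k" for k
    proof -
      have "- l \<le> y k - l"
        using pos[OF that] by simp
      then have "pprt (- l) \<le> pprt (y k - l)"
        by simp
      then have "norm (pprt (- l)) \<le> norm (pprt (y k - l))"
        by (intro norm_mono_nonneg) simp_all
      then show ?thesis
        using norm_pprt_le[of "y k - l"] by simp
    qed
    then show "\<exists>N. \<forall>k\<ge>N. norm (pprt (- l)) \<le> norm (y k - l)"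
      by blast
  qed
  then show ?thesis
    by (simp flip: le_zero_iff_zero_pprt)
qed

lemma abs_diff_le_limit:
  fixes y :: "nat \<Rightarrow> 'a::banach_lattice"
  assumes lim: "y \<longlonglongrightarrow> l" and le: "\<And>k. m \<le> k \<Longrightarrow> \<bar>y k - z\<bar> \<le> b"
  shows "\<bar>l - z\<bar> \<le> b"
proof (rule abs_leI)
  have "0 \<le> b - (l - z)"
  proof (rule nonneg_limit)
    show "(\<lambda>k. b - (y k - z)) \<longlonglongrightarrow> b - (l - z)"
      using lim by (intro tendsto_intros)
    show "0 \<le> b - (y k - z)" if "m \<le> k" for k
      using abs_le_D1[OF le[OF that]] by simp
  qed
  then show "l - z \<le> b"
    by simp
  have "0 \<le> b + (l - z)"
  proof (rule nonneg_limit)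
    show "(\<lambda>k. b + (y k - z)) \<longlonglongrightarrow> b + (l - z)"
      using lim by (intro tendsto_intros)
    show "0 \<le> b + (y k - z)" if "m \<le> k" for k
      using abs_le_D2[OF le[OF that]] by (simp add: algebra_simps)
  qed
  then show "- (l - z) \<le> b"
    by (simp add: algebra_simps)
qed

text \<open>The axioms only make scaling by a non-negative number monotone. This yields one
  inequality for c > 0, and the reverse one results from applying it to the inverse of c.\<close>

lemma abs_scaleR_lattice: "\<bar>c *\<^sub>R x\<bar> = \<bar>c\<bar> *\<^sub>R \<bar>x\<bar>"
  for x :: "'a::banach_lattice"
proof -
  have pos: "\<bar>c *\<^sub>R x\<bar> = c *\<^sub>R \<bar>x\<bar>" if "0 < c" for c :: real and x :: 'a
  proof -
    have le: "\<bar>c *\<^sub>R x\<bar> \<le> c *\<^sub>R \<bar>x\<bar>" if "0 < c" for c :: real and x :: 'a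
    proof (rule abs_leI)
      show "c *\<^sub>R x \<le> c *\<^sub>R \<bar>x\<bar>"
        using that by (intro scaleR_left_mono abs_ge_self) simp
      have "c *\<^sub>R (- x) \<le> c *\<^sub>R \<bar>x\<bar>"
        using that by (intro scaleR_left_mono abs_ge_minus_self) simp
      then show "- (c *\<^sub>R x) \<le> c *\<^sub>R \<bar>x\<bar>"
        by simp
    qed
    have "c *\<^sub>R \<bar>inverse c *\<^sub>R (c *\<^sub>R x)\<bar> \<le> c *\<^sub>R (inverse c *\<^sub>R \<bar>c *\<^sub>R x\<bar>)"
      using that by (intro scaleR_left_mono le) simp_all
    then show ?thesis
      using le[OF that, of x] that by simp
  qed
  show ?thesis
  proof (cases c "0::real" rule: linorder_cases)
    case less
    have "\<bar>c *\<^sub>R x\<bar> = \<bar>(- c) *\<^sub>R (- x)\<bar>"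
      by simp
    also have "\<dots> = (- c) *\<^sub>R \<bar>- x\<bar>"
      using less by (intro pos) simp
    finally show ?thesis
      using less by simp
  qed (use pos in auto)
qed

lemma dual_apply_linear:
  "dual_apply f (x + y) = dual_apply f x + dual_apply f y"
  "dual_apply f (x - y) = dual_apply f x - dual_apply f y"
  "dual_apply f (- x) = - dual_apply f x"
  "dual_apply f (c *\<^sub>R x) = c * dual_apply f x"
  "dual_apply f 0 = 0"
  "dual_apply f (\<Sum>i\<in>I. g i) = (\<Sum>i\<in>I. dual_apply f (g i))"
  using linear_dual_apply[of f]
  by (simp_all add: linear_add linear_diff linear_cmul linear_0 linear_neg linear_sum)

lemma dual_apply_sum_left: "dual_apply (\<Sum>i\<in>I. g i) x = (\<Sum>i\<in>I. dual_apply (g i) x)"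
  by (induction I rule: infinite_finite_induct) auto


section \<open>Lattice-linear functions\<close>

lemma krivine_functionsD:
  assumes "h \<in> krivine_functions n"
  shows "(\<And>i. i < n \<Longrightarrow> a i = b i) \<Longrightarrow> h a = h b"
    and "continuous_on UNIV h"
    and "0 \<le> t \<Longrightarrow> h (\<lambda>i. t * a i) = t * h a"
  using assms unfolding krivine_functions_def by blast+

lemma krivine_functions_coord: "i < n \<Longrightarrow> (\<lambda>a. a i) \<in> krivine_functions n"
  by (simp add: krivine_functions_def)

lemma krivine_functions_add:
  "g \<in> krivine_functions n \<Longrightarrow> h \<in> krivine_functions n \<Longrightarrow> (\<lambda>a. g a + h a) \<in> krivine_functions n"
  unfolding krivine_functions_def mem_Collect_eq
  by (intro conjI continuous_on_add) (auto simp: distrib_left intro!: arg_cong2[where f = "(+)"])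

lemma krivine_functions_scale:
  "h \<in> krivine_functions n \<Longrightarrow> (\<lambda>a. c * h a) \<in> krivine_functions n"
  unfolding krivine_functions_def mem_Collect_eq
  by (intro conjI continuous_on_mult_left) auto

lemma krivine_functions_max:
  "g \<in> krivine_functions n \<Longrightarrow> h \<in> krivine_functions n \<Longrightarrow>
    (\<lambda>a. max (g a) (h a)) \<in> krivine_functions n"
  unfolding krivine_functions_def mem_Collect_eq
  by (intro conjI continuous_on_max) (auto simp: max_mult_distrib_left intro!: arg_cong2[where f = max])

lemma krivine_functions_min:
  "g \<in> krivine_functions n \<Longrightarrow> h \<in> krivine_functions n \<Longrightarrow>
    (\<lambda>a. min (g a) (h a)) \<in> krivine_functions n"
  unfolding krivine_functions_def mem_Collect_eq
  by (intro conjI continuous_on_min) (auto simp: min_mult_distrib_left intro!: arg_cong2[where f = min])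

lemma krivine_functions_zero: "(\<lambda>a. 0) \<in> krivine_functions n"
  by (simp add: krivine_functions_def)

lemma krivine_functions_diff:
  "g \<in> krivine_functions n \<Longrightarrow> h \<in> krivine_functions n \<Longrightarrow> (\<lambda>a. g a - h a) \<in> krivine_functions n"
  using krivine_functions_add[OF _ krivine_functions_scale, of g n h "-1"] by simp

lemma krivine_functions_sum:
  "(\<And>j. j \<in> J \<Longrightarrow> g j \<in> krivine_functions n) \<Longrightarrow> (\<lambda>a. \<Sum>j\<in>J. g j a) \<in> krivine_functions n"
  by (induction J rule: infinite_finite_induct)
    (auto intro: krivine_functions_zero krivine_functions_add)

text \<open>The vector sublattice generated by the coordinates. What a lattice homomorphism does on
  it is determined by induction from its values on the coordinates, and density carries this over to
  all of \<open>krivine_functions n\<close>.\<close>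

inductive_set lattice_linear :: "nat \<Rightarrow> ((nat \<Rightarrow> real) \<Rightarrow> real) set" for n
  where
    coord: "i < n \<Longrightarrow> (\<lambda>a. a i) \<in> lattice_linear n"
  | scale: "g \<in> lattice_linear n \<Longrightarrow> (\<lambda>a. c * g a) \<in> lattice_linear n"
  | add: "g \<in> lattice_linear n \<Longrightarrow> h \<in> lattice_linear n \<Longrightarrow> (\<lambda>a. g a + h a) \<in> lattice_linear n"
  | max: "g \<in> lattice_linear n \<Longrightarrow> h \<in> lattice_linear n \<Longrightarrow>
      (\<lambda>a. max (g a) (h a)) \<in> lattice_linear n"
  | min: "g \<in> lattice_linear n \<Longrightarrow> h \<in> lattice_linear n \<Longrightarrow>
      (\<lambda>a. min (g a) (h a)) \<in> lattice_linear n"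

lemma lattice_linear_krivine: "g \<in> lattice_linear n \<Longrightarrow> g \<in> krivine_functions n"
  by (induction rule: lattice_linear.induct)
    (auto intro: krivine_functions_coord krivine_functions_scale krivine_functions_add
      krivine_functions_max krivine_functions_min)

lemma lattice_linear_zero: "0 < n \<Longrightarrow> (\<lambda>a. 0) \<in> lattice_linear n"
  using lattice_linear.scale[OF lattice_linear.coord, of 0 n 0] by simp

lemma lattice_linear_diff:
  "g \<in> lattice_linear n \<Longrightarrow> h \<in> lattice_linear n \<Longrightarrow> (\<lambda>a. g a - h a) \<in> lattice_linear n"
  using lattice_linear.add[OF _ lattice_linear.scale, of g n h "-1"] by simp

lemma lattice_linear_abs: "g \<in> lattice_linear n \<Longrightarrow> (\<lambda>a. \<bar>g a\<bar>) \<in> lattice_linear n"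
proof -
  assume "g \<in> lattice_linear n"
  then have "(\<lambda>a. max (g a) (- 1 * g a)) \<in> lattice_linear n"
    by (intro lattice_linear.max lattice_linear.scale)
  moreover have "(\<lambda>a. max (g a) (- 1 * g a)) = (\<lambda>a. \<bar>g a\<bar>)"
    by auto
  ultimately show ?thesis
    by simp
qed

lemma lattice_linear_sum:
  "0 < n \<Longrightarrow> (\<And>j. j \<in> J \<Longrightarrow> g j \<in> lattice_linear n) \<Longrightarrow> (\<lambda>a. \<Sum>j\<in>J. g j a) \<in> lattice_linear n"
  by (induction J rule: infinite_finite_induct)
    (auto intro: lattice_linear_zero lattice_linear.add)

text \<open>The order unit of \<open>krivine_functions n\<close>: by compactness of the sphere and
  homogeneity every such function is bounded by a multiple of it. All approximations are measured
  against it.\<close>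

definition l1_norm :: "nat \<Rightarrow> (nat \<Rightarrow> real) \<Rightarrow> real"
  where "l1_norm n a = (\<Sum>i<n. \<bar>a i\<bar>)"

lemma l1_norm_nonneg: "0 \<le> l1_norm n a"
  by (simp add: l1_norm_def sum_nonneg)

lemma lattice_linear_l1_norm: "0 < n \<Longrightarrow> l1_norm n \<in> lattice_linear n"
proof -
  assume n: "0 < n"
  have "(\<lambda>a. \<bar>a i\<bar>) \<in> lattice_linear n" if "i \<in> {..<n}" for i
    using lattice_linear_abs[OF lattice_linear.coord[of i n]] that by simp
  with n have "(\<lambda>a. \<Sum>i\<in>{..<n}. \<bar>a i\<bar>) \<in> lattice_linear n"
    by (rule lattice_linear_sum[where g = "\<lambda>i a. \<bar>a i\<bar>"])
  then show ?thesis
    by (simp add: l1_norm_def[abs_def])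
qed

lemma continuous_on_coord: "continuous_on S (\<lambda>a :: nat \<Rightarrow> real. a i)"
  by (rule continuous_on_subset[OF continuous_on_product_coordinates]) simp

text \<open>A compact cross-section of the rays. Points are infinite sequences, so the coordinates
  from \<open>n\<close> on are fixed at zero to obtain compactness in the product topology.\<close>

definition l1_sphere :: "nat \<Rightarrow> (nat \<Rightarrow> real) set"
  where "l1_sphere n = {a. (\<forall>i\<ge>n. a i = 0) \<and> l1_norm n a = 1}"

lemma compact_l1_sphere: "compact (l1_sphere n)"
proof -
  let ?B = "PiE UNIV (\<lambda>i::nat. if i < n then {-1..1::real} else {0})"
  have "compact ?B"
  proof -
    have "compactin (product_topology (\<lambda>i. euclidean) UNIV) ?B"
      by (subst compactin_PiE) auto
    then show ?thesis
      by (simp add: euclidean_product_topology)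
  qed
  moreover have "closed {a :: nat \<Rightarrow> real. l1_norm n a = 1}"
    unfolding l1_norm_def by (intro closed_Collect_eq continuous_intros continuous_on_coord)
  moreover have "l1_sphere n = {a. l1_norm n a = 1} \<inter> ?B"
  proof -
    have "\<bar>a i\<bar> \<le> 1" if "l1_norm n a = 1" "i < n" for a i
      using that member_le_sum[of i "{..<n}" "\<lambda>i. \<bar>a i\<bar>"] by (simp add: l1_norm_def)
    then have "a \<in> l1_sphere n \<longleftrightarrow> l1_norm n a = 1 \<and> (\<forall>i. a i \<in> (if i < n then {-1..1} else {0}))" for a
      unfolding l1_sphere_def by (auto simp: abs_le_iff not_less minus_le_iff)
    then show ?thesis
      by (simp add: set_eq_iff PiE_UNIV_domain Pi_iff)
  qed
  ultimately show ?thesis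
    by (simp add: closed_Int_compact)
qed

text \<open>The distance to \<open>c\<close> attains a positive minimum on the compact set of sphere
  points outside \<open>U\<close>. Neighbourhoods given by this distance are wanted because the
  distance can be written with linear and lattice operations, as bump functions require.\<close>

lemma l1_sphere_neighbourhood:
  assumes "open U" "c \<in> U" "c \<in> l1_sphere n"
  shows "\<exists>\<delta>>0. \<forall>a\<in>l1_sphere n. (\<Sum>i<n. \<bar>a i - c i\<bar>) < \<delta> \<longrightarrow> a \<in> U"
proof (cases "l1_sphere n - U = {}")
  case True
  then show ?thesis
    by (intro exI[of _ 1]) auto
next
  case False
  have "compact (l1_sphere n - U)"
    by (intro compact_diff compact_l1_sphere assms)
  moreover have "continuous_on (l1_sphere n - U) (\<lambda>a. \<Sum>i<n. \<bar>a i - c i\<bar>)"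
    by (intro continuous_intros continuous_on_coord)
  ultimately obtain b where b: "b \<in> l1_sphere n - U"
    and min: "\<And>a. a \<in> l1_sphere n - U \<Longrightarrow> (\<Sum>i<n. \<bar>b i - c i\<bar>) \<le> (\<Sum>i<n. \<bar>a i - c i\<bar>)"
    using continuous_attains_inf[OF _ False] by blast
  have "(\<Sum>i<n. \<bar>b i - c i\<bar>) \<noteq> 0"
  proof
    assume "(\<Sum>i<n. \<bar>b i - c i\<bar>) = 0"
    then have "b i = c i" for i
      using b assms(3) by (cases "i < n") (auto simp: sum_nonneg_eq_0_iff l1_sphere_def)
    then have "b = c"
      by auto
    then show False
      using b assms(2) by auto
  qed
  then have "0 < (\<Sum>i<n. \<bar>b i - c i\<bar>)"
    using sum_nonneg[of "{..<n}" "\<lambda>i. \<bar>b i - c i\<bar>"] by linarith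
  then show ?thesis
    using min by (meson DiffI not_less)
qed

lemma krivine_functions_bound:
  assumes f: "f \<in> krivine_functions n" and bound: "\<And>a. a \<in> l1_sphere n \<Longrightarrow> \<bar>f a\<bar> \<le> M"
  shows "\<bar>f a\<bar> \<le> M * l1_norm n a"
proof (cases "l1_norm n a = 0")
  case True
  then have "a i = 0 * a i" if "i < n" for i
    using that by (simp add: l1_norm_def sum_nonneg_eq_0_iff)
  then have "f a = f (\<lambda>i. 0 * a i)"
    by (rule krivine_functionsD(1)[OF f])
  also have "\<dots> = 0"
    by (subst krivine_functionsD(3)[OF f]) auto
  finally show ?thesis
    using True by simp
next
  case False
  define N where "N = l1_norm n a"
  have N: "0 < N"
    using False l1_norm_nonneg[of n a] by (simp add: N_def)
  define b where "b = (\<lambda>i. if i < n then a i / N else 0)"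
  have "l1_norm n b = (\<Sum>i<n. \<bar>a i\<bar> / N)"
    unfolding l1_norm_def b_def using N by (intro sum.cong) auto
  also have "\<dots> = 1"
    using N by (simp add: N_def l1_norm_def flip: sum_divide_distrib)
  finally have "b \<in> l1_sphere n"
    by (auto simp: l1_sphere_def b_def)
  then have "\<bar>f b\<bar> \<le> M"
    by (rule bound)
  moreover have "f a = f (\<lambda>i. N * b i)"
    using N by (intro krivine_functionsD(1)[OF f]) (auto simp: b_def)
  then have "f a = N * f b"
    using N by (simp add: krivine_functionsD(3)[OF f])
  ultimately show ?thesis
    using N by (simp add: abs_mult mult.commute flip: N_def)
qed

text \<open>
  The \<open>\<psi> j\<close> form a partition of the homogeneous function \<^term>\<open>l1_norm n\<close>, with \<open>\<psi> j\<close> supported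
  near the ray through \<open>c j\<close>. They are obtained from bumps \<open>\<phi> j\<close> by truncating the partial sums of
  the bumps at \<^term>\<open>l1_norm n\<close> and taking differences, which never leaves the lattice-linear functions.
\<close>

lemma lattice_linear_partition:
  assumes n: "0 < n" and H: "finite H" "H \<subseteq> krivine_functions n" and \<epsilon>: "0 < \<epsilon>"
  shows "\<exists>(m :: nat) c \<psi>. (\<forall>j<m. \<psi> j \<in> lattice_linear n) \<and> (\<forall>j<m. \<forall>a. 0 \<le> \<psi> j a) \<and>
    (\<forall>h\<in>H. \<forall>a. \<bar>h a - (\<Sum>j<m. h (c j) * \<psi> j a)\<bar> \<le> \<epsilon> * l1_norm n a)"
proof -
  let ?K = "l1_sphere n" and ?N = "l1_norm n"
  define U where "U c = {a. \<forall>h\<in>H. \<bar>h a - h c\<bar> < \<epsilon>}" for c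
  have "open (U c)" for c
  proof -
    have "open {a. \<bar>h a - h c\<bar> < \<epsilon>}" if "h \<in> H" for h
      using that H krivine_functionsD(2) by (intro open_Collect_less continuous_intros) auto
    moreover have "U c = (\<Inter>h\<in>H. {a. \<bar>h a - h c\<bar> < \<epsilon>})"
      by (auto simp: U_def)
    ultimately show ?thesis
      using H(1) by auto
  qed
  then have "\<exists>\<delta>>0. \<forall>a\<in>?K. (\<Sum>i<n. \<bar>a i - c i\<bar>) < \<delta> \<longrightarrow> a \<in> U c" if "c \<in> ?K" for c
    using that \<epsilon> by (intro l1_sphere_neighbourhood) (auto simp: U_def)
  then obtain \<delta> where \<delta>: "\<And>c. c \<in> ?K \<Longrightarrow> 0 < \<delta> c"
    and near: "\<And>c a. c \<in> ?K \<Longrightarrow> a \<in> ?K \<Longrightarrow> (\<Sum>i<n. \<bar>a i - c i\<bar>) < \<delta> c \<Longrightarrow> a \<in> U c"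
    by metis
  \<comment> \<open>Multiplying both \<open>\<delta> c\<close> and the centre by \<open>?N a\<close>
    makes the distance test homogeneous. The factor 2 / \<delta> gives the value 2 at the centre, so
    the set where the bump exceeds 1 is an open neighbourhood of the centre; at each of its points
    on the sphere this bump alone exceeds the truncation level \<open>?N a = 1\<close>.\<close>
  define \<phi> where "\<phi> c a = max 0 ((2 / \<delta> c) * (\<delta> c * ?N a - (\<Sum>i<n. \<bar>a i - c i * ?N a\<bar>)))" for c a
  have \<phi>_lat: "\<phi> c \<in> lattice_linear n" for c
  proof -
    have N: "(\<lambda>a. t * ?N a) \<in> lattice_linear n" for t
      using n by (rule lattice_linear.scale[OF lattice_linear_l1_norm])
    have "(\<lambda>a. \<bar>a i - c i * ?N a\<bar>) \<in> lattice_linear n" if "i < n" for i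
      using that N by (rule lattice_linear_abs[OF lattice_linear_diff[OF lattice_linear.coord]])
    then have "(\<lambda>a. \<Sum>i<n. \<bar>a i - c i * ?N a\<bar>) \<in> lattice_linear n"
      using n by (intro lattice_linear_sum) auto
    then show ?thesis
      unfolding \<phi>_def[abs_def]
      by (rule lattice_linear.max[OF lattice_linear_zero[OF n]
            lattice_linear.scale[OF lattice_linear_diff[OF N]]])
  qed
  have \<phi>_cont: "continuous_on UNIV (\<phi> c)" for c
    using \<phi>_lat lattice_linear_krivine krivine_functionsD(2) by blast
  have \<phi>_pos: "0 \<le> \<phi> c a" for c a
    by (simp add: \<phi>_def)
  have \<phi>_supp: "a \<in> U c" if "c \<in> ?K" "a \<in> ?K" "0 < \<phi> c a" for a c
  proof (rule near[OF that(1,2)])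
    have N: "?N a = 1"
      using that by (simp add: l1_sphere_def)
    show "(\<Sum>i<n. \<bar>a i - c i\<bar>) < \<delta> c"
    proof -
      have "0 < (2 / \<delta> c) * (\<delta> c - (\<Sum>i<n. \<bar>a i - c i\<bar>))"
        using that(3) N by (simp only: \<phi>_def less_max_iff_disj) simp
      then show ?thesis
        using zero_less_mult_pos[of "2 / \<delta> c" "\<delta> c - (\<Sum>i<n. \<bar>a i - c i\<bar>)"] \<delta>[OF that(1)] by simp
    qed
  qed
  have \<phi>_centre: "\<phi> c c = 2" if "c \<in> ?K" for c
    using that \<delta>[OF that] by (simp add: \<phi>_def l1_sphere_def)
  have "?K \<subseteq> (\<Union>c\<in>?K. {a. 1 < \<phi> c a})"
    using \<phi>_centre by force
  moreover have "open {a. 1 < \<phi> c a}" for c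
    by (intro open_Collect_less continuous_intros \<phi>_cont)
  ultimately obtain C where C: "C \<subseteq> ?K" "finite C" and cover: "?K \<subseteq> (\<Union>c\<in>C. {a. 1 < \<phi> c a})"
    using compactE_image[OF compact_l1_sphere] by metis
  obtain c and m :: nat where c: "C = c ` {i. i < m}"
    using finite_imp_nat_seg_image_inj_on[OF C(2)] by blast
  have cK: "c j \<in> ?K" if "j < m" for j
    using that C c by auto
  define \<sigma> where "\<sigma> j a = min (?N a) (\<Sum>k<j. \<phi> (c k) a)" for j a
  define \<psi> where "\<psi> j a = \<sigma> (Suc j) a - \<sigma> j a" for j a
  have \<psi>_lat: "\<psi> j \<in> lattice_linear n" for j
  proof -
    have "(\<lambda>a. \<sigma> k a) \<in> lattice_linear n" for k
      unfolding \<sigma>_def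
      by (rule lattice_linear.min[OF lattice_linear_l1_norm[OF n] lattice_linear_sum[OF n]])
        (simp add: \<phi>_lat)
    then show ?thesis
      unfolding \<psi>_def[abs_def] by (intro lattice_linear_diff)
  qed
  have \<psi>_pos: "0 \<le> \<psi> j a" and \<psi>_le: "\<psi> j a \<le> \<phi> (c j) a" for j a
    using \<phi>_pos[of "c j" a] by (auto simp: \<psi>_def \<sigma>_def min_def)
  have \<psi>_sum: "(\<Sum>j<m. \<psi> j a) = 1" if a: "a \<in> ?K" for a
  proof -
    obtain k where k: "k < m" "1 < \<phi> (c k) a"
      using cover a c by blast
    have "\<phi> (c k) a \<le> (\<Sum>k<m. \<phi> (c k) a)"
      using k \<phi>_pos by (intro member_le_sum) auto
    then have "\<sigma> m a = 1"
      using a k by (simp add: \<sigma>_def l1_sphere_def)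
    moreover have "\<sigma> 0 a = 0"
      by (simp add: \<sigma>_def l1_norm_nonneg)
    ultimately show ?thesis
      unfolding \<psi>_def by (subst sum_lessThan_telescope) simp
  qed
  show ?thesis
  proof (intro exI[of _ m] exI[of _ c] exI[of _ \<psi>] conjI allI impI ballI)
    show "\<bar>h a - (\<Sum>j<m. h (c j) * \<psi> j a)\<bar> \<le> \<epsilon> * ?N a" if h: "h \<in> H" for h a
    proof (rule krivine_functions_bound)
      show "(\<lambda>a. h a - (\<Sum>j<m. h (c j) * \<psi> j a)) \<in> krivine_functions n"
      proof (rule krivine_functions_diff)
        show "h \<in> krivine_functions n"
          using h H by blast
        show "(\<lambda>a. \<Sum>j<m. h (c j) * \<psi> j a) \<in> krivine_functions n"
          by (rule krivine_functions_sum[where g = "\<lambda>j a. h (c j) * \<psi> j a"])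
            (rule krivine_functions_scale[OF lattice_linear_krivine[OF \<psi>_lat]])
      qed
      fix a assume a: "a \<in> ?K"
      have "\<bar>(h a - h (c j)) * \<psi> j a\<bar> \<le> \<epsilon> * \<psi> j a" if j: "j < m" for j
      proof (cases "\<psi> j a = 0")
        case False
        then have "a \<in> U (c j)"
          using \<psi>_pos[of j a] \<psi>_le[of j a] by (intro \<phi>_supp[OF cK[OF j] a]) simp
        then have "\<bar>h a - h (c j)\<bar> \<le> \<epsilon>"
          using h by (force simp: U_def)
        then show ?thesis
          using \<psi>_pos[of j a] by (simp add: abs_mult mult_right_mono)
      qed simp
      then have "(\<Sum>j<m. \<bar>(h a - h (c j)) * \<psi> j a\<bar>) \<le> (\<Sum>j<m. \<epsilon> * \<psi> j a)"
        by (intro sum_mono) auto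
      also have "\<dots> = \<epsilon>"
        using \<psi>_sum[OF a] by (simp flip: sum_distrib_left)
      finally have "\<bar>\<Sum>j<m. (h a - h (c j)) * \<psi> j a\<bar> \<le> \<epsilon>"
        by (rule order_trans[OF sum_abs])
      moreover have "(\<Sum>j<m. (h a - h (c j)) * \<psi> j a) = h a - (\<Sum>j<m. h (c j) * \<psi> j a)"
        using \<psi>_sum[OF a] by (simp add: left_diff_distrib sum_subtractf flip: sum_distrib_left)
      ultimately show "\<bar>h a - (\<Sum>j<m. h (c j) * \<psi> j a)\<bar> \<le> \<epsilon>"
        by simp
    qed
  qed (use \<psi>_lat \<psi>_pos in auto)
qed

text \<open>The Riemann sum of \<open>h\<close> along the partition is itself lattice-linear. This
  is the Stone-Weierstrass theorem for this sublattice, with uniform distance on the sphere.\<close>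

corollary lattice_linear_dense:
  assumes "0 < n" "h \<in> krivine_functions n" "0 < \<epsilon>"
  obtains g where "g \<in> lattice_linear n" "\<And>a. \<bar>h a - g a\<bar> \<le> \<epsilon> * l1_norm n a"
proof -
  have H: "finite {h}" "{h} \<subseteq> krivine_functions n"
    using assms(2) by auto
  obtain m :: nat and c \<psi> where \<psi>: "\<forall>j<m. \<psi> j \<in> lattice_linear n"
    and "\<forall>h'\<in>{h}. \<forall>a. \<bar>h' a - (\<Sum>j<m. h' (c j) * \<psi> j a)\<bar> \<le> \<epsilon> * l1_norm n a"
    using lattice_linear_partition[OF assms(1) H assms(3)] by (elim exE conjE)
  then have approx: "\<bar>h a - (\<Sum>j<m. h (c j) * \<psi> j a)\<bar> \<le> \<epsilon> * l1_norm n a" for a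
    by simp
  have "(\<lambda>a. \<Sum>j<m. h (c j) * \<psi> j a) \<in> lattice_linear n"
  proof (rule lattice_linear_sum[where g = "\<lambda>j a. h (c j) * \<psi> j a", OF assms(1)])
    show "(\<lambda>a. h (c j) * \<psi> j a) \<in> lattice_linear n" if "j \<in> {..<m}" for j
      using that \<psi> by (intro lattice_linear.scale) simp
  qed
  then show thesis
    using approx by (rule that)
qed


section \<open>Real lattice homomorphisms on a principal ideal\<close>

lemma abs_sup_le: "\<bar>sup x y\<bar> \<le> \<bar>x\<bar> + \<bar>y\<bar>"
  for x y :: "'a::banach_lattice"
proof (rule abs_leI)
  have "x \<le> \<bar>x\<bar> + \<bar>y\<bar>"
    using add_mono[OF abs_ge_self[of x] abs_ge_zero[of y]] by simp
  moreover have "y \<le> \<bar>x\<bar> + \<bar>y\<bar>"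
    using add_mono[OF abs_ge_zero[of x] abs_ge_self[of y]] by simp
  ultimately show "sup x y \<le> \<bar>x\<bar> + \<bar>y\<bar>"
    by simp
  have "- sup x y \<le> - x"
    by simp
  also have "- x \<le> \<bar>x\<bar>"
    by (rule abs_ge_minus_self)
  also have "\<bar>x\<bar> \<le> \<bar>x\<bar> + \<bar>y\<bar>"
    by simp
  finally show "- sup x y \<le> \<bar>x\<bar> + \<bar>y\<bar>" .
qed

definition order_ideal :: "'a::banach_lattice \<Rightarrow> 'a set"
  where "order_ideal e = {y. \<exists>c\<ge>0. \<bar>y\<bar> \<le> c *\<^sub>R e}"

text \<open>Only suprema are prescribed; infima and absolute values are then respected by linearity.
  There is no normalisation at \<open>e\<close>, so zero belongs to the set.\<close>

definition real_homs :: "'a::banach_lattice \<Rightarrow> ('a \<Rightarrow> real) set"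
  where "real_homs e = {\<omega>. linear_fun_on (order_ideal e) \<omega> \<and>
    (\<forall>y\<in>order_ideal e. \<forall>z\<in>order_ideal e. \<omega> (sup y z) = max (\<omega> y) (\<omega> z))}"

lemma order_idealI: "0 \<le> c \<Longrightarrow> \<bar>y\<bar> \<le> c *\<^sub>R e \<Longrightarrow> y \<in> order_ideal e"
  by (auto simp: order_ideal_def)

lemma order_idealE:
  assumes "y \<in> order_ideal e"
  obtains c where "0 \<le> c" "\<bar>y\<bar> \<le> c *\<^sub>R e"
  using assms by (auto simp: order_ideal_def)

lemma order_ideal_add:
  assumes "y \<in> order_ideal e" "z \<in> order_ideal e"
  shows "y + z \<in> order_ideal e" "sup y z \<in> order_ideal e"
proof -
  obtain c d where c: "0 \<le> c" "\<bar>y\<bar> \<le> c *\<^sub>R e" and d: "0 \<le> d" "\<bar>z\<bar> \<le> d *\<^sub>R e"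
    using assms by (auto elim!: order_idealE)
  have "\<bar>y\<bar> + \<bar>z\<bar> \<le> (c + d) *\<^sub>R e"
    using c d by (simp add: scaleR_left_distrib add_mono)
  then show "y + z \<in> order_ideal e" "sup y z \<in> order_ideal e"
    using order_trans[OF abs_triangle_ineq[of y z]] order_trans[OF abs_sup_le[of y z]] c d
    by (auto intro!: order_idealI[of "c + d"])
qed

lemma order_ideal_scale:
  assumes "y \<in> order_ideal e"
  shows "a *\<^sub>R y \<in> order_ideal e"
proof -
  obtain c where c: "0 \<le> c" "\<bar>y\<bar> \<le> c *\<^sub>R e"
    using assms by (auto elim!: order_idealE)
  have "\<bar>a *\<^sub>R y\<bar> = \<bar>a\<bar> *\<^sub>R \<bar>y\<bar>"
    by (rule abs_scaleR_lattice)
  also have "\<dots> \<le> \<bar>a\<bar> *\<^sub>R (c *\<^sub>R e)"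
    using c by (intro scaleR_left_mono) auto
  finally show ?thesis
    using c by (intro order_idealI[of "\<bar>a\<bar> * c"]) auto
qed

lemma subspace_order_ideal: "subspace (order_ideal e)"
proof (rule subspaceI)
  show "0 \<in> order_ideal e"
    by (rule order_idealI[of 0]) simp_all
qed (simp_all add: order_ideal_add order_ideal_scale)

lemma order_ideal_minus: "y \<in> order_ideal e \<Longrightarrow> - y \<in> order_ideal e"
  using order_ideal_scale[of y e "-1"] by simp

lemma order_ideal_inf:
  "y \<in> order_ideal e \<Longrightarrow> z \<in> order_ideal e \<Longrightarrow> inf y z \<in> order_ideal e"
  unfolding inf_eq_neg_sup by (intro order_ideal_minus order_ideal_add)

text \<open>For infima of chains, one member nearly attains the infima at \<open>y\<close> and at
  \<open>z\<close> simultaneously. For translates, adding \<open>w\<close> commutes with suprema,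
  and subtracting a constant commutes with \<open>max\<close>.\<close>

lemma admissible_sup_preserving:
  "admissible_class (order_ideal e)
    (\<lambda>q. \<forall>y\<in>order_ideal e. \<forall>z\<in>order_ideal e. q (sup y z) = max (q y) (q z))"
    (is "admissible_class ?I ?P")
  unfolding admissible_class_def
proof (intro conjI allI ballI impI)
  fix q r :: "'a \<Rightarrow> real" and y z
  assume "\<forall>x\<in>?I. q x = r x" "?P q" "y \<in> ?I" "z \<in> ?I"
  then show "r (sup y z) = max (r y) (r z)"
    using order_ideal_add(2) by metis
next
  fix C :: "('a \<Rightarrow> real) set" and y z
  assume C: "pointwise_chain ?I C" and P: "\<forall>q\<in>C. ?P q" and y: "y \<in> ?I" and z: "z \<in> ?I"
  have ne: "C \<noteq> {}"
    using C by (simp add: pointwise_chain_def)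
  have yz: "sup y z \<in> ?I"
    using y z by (rule order_ideal_add)
  show "(INF q\<in>C. q (sup y z)) = max (INF q\<in>C. q y) (INF q\<in>C. q z)"
  proof (rule antisym)
    show "max (INF q\<in>C. q y) (INF q\<in>C. q z) \<le> (INF q\<in>C. q (sup y z))"
    proof (rule cINF_greatest[OF ne])
      fix q assume q: "q \<in> C"
      then have "q (sup y z) = max (q y) (q z)"
        using P y z by blast
      then show "max (INF q\<in>C. q y) (INF q\<in>C. q z) \<le> q (sup y z)"
        using pointwise_chain_INF_le[OF C y q] pointwise_chain_INF_le[OF C z q] by linarith
    qed
    show "(INF q\<in>C. q (sup y z)) \<le> max (INF q\<in>C. q y) (INF q\<in>C. q z)"
    proof (rule field_le_epsilon)
      fix d :: real assume "0 < d"
      then obtain q where q: "q \<in> C" "q y < (INF q\<in>C. q y) + d" "q z < (INF q\<in>C. q z) + d"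
        using pointwise_chain_INF_approx[OF C y z] by blast
      have "(INF q\<in>C. q (sup y z)) \<le> q (sup y z)"
        using pointwise_chain_INF_le[OF C yz q(1)] .
      also have "\<dots> = max (q y) (q z)"
        using P y z q(1) by blast
      finally show "(INF q\<in>C. q (sup y z)) \<le> max (INF q\<in>C. q y) (INF q\<in>C. q z) + d"
        using q by linarith
    qed
  qed
next
  fix q :: "'a \<Rightarrow> real" and w and c :: real and y z
  assume w: "w \<in> ?I" and P: "?P q" and y: "y \<in> ?I" and z: "z \<in> ?I"
  have "q (sup (y + w) (z + w)) = max (q (y + w)) (q (z + w))"
    using P w y z order_ideal_add(1) by blast
  then show "q (sup y z + w) - c = max (q (y + w) - c) (q (z + w) - c)"
    by (simp add: add_sup_distrib_right)
qed

text \<open>The order-unit seminorm of the positive part of \<open>y\<close>; the restriction to c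
  \<ge> 0 is what discards the negative part. It vanishes at an element of the ideal exactly when
  the element is \<le> 0.\<close>

definition order_gauge :: "'a::banach_lattice \<Rightarrow> 'a \<Rightarrow> real"
  where "order_gauge e y = Inf {c. 0 \<le> c \<and> y \<le> c *\<^sub>R e}"

context
  fixes e :: "'a::banach_lattice"
  assumes e: "0 \<le> e"
begin

lemma order_gauge_least: "0 \<le> c \<Longrightarrow> y \<le> c *\<^sub>R e \<Longrightarrow> order_gauge e y \<le> c"
  unfolding order_gauge_def by (rule cInf_lower) auto

lemma order_gauge_attained:
  assumes "y \<in> order_ideal e"
  shows "0 \<le> order_gauge e y" "y \<le> order_gauge e y *\<^sub>R e"
proof -
  let ?S = "{c. 0 \<le> c \<and> y \<le> c *\<^sub>R e}"
  obtain c where c: "0 \<le> c" "\<bar>y\<bar> \<le> c *\<^sub>R e"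
    using assms by (rule order_idealE)
  then have ne: "?S \<noteq> {}"
    using abs_le_D1 by blast
  then show "0 \<le> order_gauge e y"
    unfolding order_gauge_def by (rule cInf_greatest) auto
  show "y \<le> order_gauge e y *\<^sub>R e"
  proof (rule le_if_le_add_small)
    fix \<epsilon> :: real assume "0 < \<epsilon>"
    then have "Inf ?S < order_gauge e y + \<epsilon>"
      by (simp add: order_gauge_def)
    then obtain d where d: "d \<in> ?S" "d < order_gauge e y + \<epsilon>"
      using cInf_lessD[OF ne] by blast
    then have "y \<le> d *\<^sub>R e"
      by simp
    also have "\<dots> \<le> (order_gauge e y + \<epsilon>) *\<^sub>R e"
      using d e by (intro scaleR_right_mono) auto
    finally show "y \<le> order_gauge e y *\<^sub>R e + \<epsilon> *\<^sub>R e"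
      by (simp add: scaleR_left_distrib)
  qed
qed

lemma sublinear_order_gauge: "sublinear_on (order_ideal e) (order_gauge e)"
  unfolding sublinear_on_def
proof (intro conjI ballI allI impI)
  fix y z assume yz: "y \<in> order_ideal e" "z \<in> order_ideal e"
  show "order_gauge e (y + z) \<le> order_gauge e y + order_gauge e z"
    using add_mono[OF order_gauge_attained(2)[OF yz(1)] order_gauge_attained(2)[OF yz(2)]]
      order_gauge_attained(1)[OF yz(1)] order_gauge_attained(1)[OF yz(2)]
    by (intro order_gauge_least) (simp_all add: scaleR_left_distrib)
next
  have le: "order_gauge e (c *\<^sub>R y) \<le> c * order_gauge e y" if "0 \<le> c" "y \<in> order_ideal e" for c y
  proof (rule order_gauge_least)
    show "c *\<^sub>R y \<le> (c * order_gauge e y) *\<^sub>R e"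
      using scaleR_left_mono[OF order_gauge_attained(2)[OF that(2)] that(1)] by simp
  qed (use order_gauge_attained that in auto)
  fix c :: real and y assume c: "0 \<le> c" and y: "y \<in> order_ideal e"
  show "order_gauge e (c *\<^sub>R y) = c * order_gauge e y"
  proof (cases "c = 0")
    case True
    then show ?thesis
      using le[OF c y] order_gauge_attained(1)[OF order_ideal_scale[OF y], of c] by simp
  next
    case False
    have "order_gauge e (inverse c *\<^sub>R (c *\<^sub>R y)) \<le> inverse c * order_gauge e (c *\<^sub>R y)"
      using c y by (intro le order_ideal_scale) auto
    then have "c * order_gauge e y \<le> order_gauge e (c *\<^sub>R y)"
      using False c by (simp add: field_simps)
    then show ?thesis
      using le[OF c y] by simp
  qed
qed

lemma order_gauge_sup:
  assumes "y \<in> order_ideal e" "z \<in> order_ideal e"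
  shows "order_gauge e (sup y z) = max (order_gauge e y) (order_gauge e z)"
proof (rule antisym)
  let ?m = "max (order_gauge e y) (order_gauge e z)"
  have "order_gauge e y *\<^sub>R e \<le> ?m *\<^sub>R e" "order_gauge e z *\<^sub>R e \<le> ?m *\<^sub>R e"
    by (rule scaleR_right_mono[OF _ e]; simp)+
  then have "sup y z \<le> ?m *\<^sub>R e"
    using order_trans[OF order_gauge_attained(2)[OF assms(1)]]
      order_trans[OF order_gauge_attained(2)[OF assms(2)]] by (intro sup_least)
  then show "order_gauge e (sup y z) \<le> ?m"
    using order_gauge_attained(1)[OF assms(1)] by (intro order_gauge_least) auto
  have s: "0 \<le> order_gauge e (sup y z)" "sup y z \<le> order_gauge e (sup y z) *\<^sub>R e"
    using order_gauge_attained[OF order_ideal_add(2)[OF assms]] .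
  then have "y \<le> order_gauge e (sup y z) *\<^sub>R e" "z \<le> order_gauge e (sup y z) *\<^sub>R e"
    by simp_all
  then show "?m \<le> order_gauge e (sup y z)"
    using s(1) by (simp add: order_gauge_least)
qed

text \<open>The gauge is sublinear and already preserves suprema, so it can be lowered to a linear
  functional that does so too and keeps the value of the gauge at \<open>y\<close>. If all
  homomorphisms are \<le> 0 at \<open>y\<close>, the gauge vanishes there.\<close>

theorem real_homs_separate:
  assumes y: "y \<in> order_ideal e" and le: "\<And>\<omega>. \<omega> \<in> real_homs e \<Longrightarrow> \<omega> y \<le> 0"
  shows "y \<le> 0"
proof -
  have P: "\<forall>u\<in>order_ideal e. \<forall>v\<in>order_ideal e. order_gauge e (sup u v) = max (order_gauge e u) (order_gauge e v)"
    using order_gauge_sup by simp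
  obtain \<omega> where \<omega>: "linear_fun_on (order_ideal e) \<omega>"
    "\<forall>u\<in>order_ideal e. \<forall>v\<in>order_ideal e. \<omega> (sup u v) = max (\<omega> u) (\<omega> v)"
    "\<omega> y = order_gauge e y"
    using dominated_linear_exists[OF subspace_order_ideal sublinear_order_gauge
        admissible_sup_preserving P y] by (elim exE conjE)
  then have "order_gauge e y \<le> 0"
    using le[of \<omega>] by (simp add: real_homs_def)
  then have "order_gauge e y = 0"
    using order_gauge_attained(1)[OF y] by simp
  then show ?thesis
    using order_gauge_attained(2)[OF y] by simp
qed

end


section \<open>Krivine's functional calculus\<close>

lemma real_homs_unary:
  assumes "\<omega> \<in> real_homs e" "y \<in> order_ideal e"
  shows "\<omega> (c *\<^sub>R y) = c * \<omega> y" "\<omega> (- y) = - \<omega> y" "\<omega> \<bar>y\<bar> = \<bar>\<omega> y\<bar>"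
proof -
  have lin: "\<omega> (c *\<^sub>R y) = c * \<omega> y" for c
    using assms by (simp add: real_homs_def linear_fun_on_def)
  then show "\<omega> (c *\<^sub>R y) = c * \<omega> y" .
  show neg: "\<omega> (- y) = - \<omega> y"
    using lin[of "-1"] by simp
  have "\<omega> (sup y (- y)) = max (\<omega> y) (\<omega> (- y))"
    using assms order_ideal_minus[OF assms(2)] by (simp add: real_homs_def)
  then show "\<omega> \<bar>y\<bar> = \<bar>\<omega> y\<bar>"
    unfolding abs_lattice[of y] neg by (simp add: abs_real_def max_def)
qed

lemma real_homs_binary:
  assumes "\<omega> \<in> real_homs e" "y \<in> order_ideal e" "z \<in> order_ideal e"
  shows "\<omega> (y + z) = \<omega> y + \<omega> z" "\<omega> (y - z) = \<omega> y - \<omega> z"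
    "\<omega> (sup y z) = max (\<omega> y) (\<omega> z)" "\<omega> (inf y z) = min (\<omega> y) (\<omega> z)"
proof -
  have lin: "\<omega> (u + v) = \<omega> u + \<omega> v" "\<omega> (sup u v) = max (\<omega> u) (\<omega> v)"
    if "u \<in> order_ideal e" "v \<in> order_ideal e" for u v
    using assms(1) that by (simp_all add: real_homs_def linear_fun_on_def)
  note neg = real_homs_unary(2)[OF assms(1)]
  note I = order_ideal_minus[OF assms(2)] order_ideal_minus[OF assms(3)]
  show "\<omega> (y + z) = \<omega> y + \<omega> z" "\<omega> (sup y z) = max (\<omega> y) (\<omega> z)"
    using lin assms by blast+
  show "\<omega> (y - z) = \<omega> y - \<omega> z"
    using lin(1)[OF assms(2) I(2)] neg[OF assms(3)] by simp
  have "\<omega> (inf y z) = - \<omega> (sup (- y) (- z))"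
    unfolding inf_eq_neg_sup by (rule neg[OF order_ideal_add(2)[OF I]])
  then show "\<omega> (inf y z) = min (\<omega> y) (\<omega> z)"
    using lin(2)[OF I] neg[OF assms(2)] neg[OF assms(3)] by (simp add: min_def max_def)
qed

lemmas real_homs_simps = real_homs_unary real_homs_binary

lemma order_ideal_diff: "y \<in> order_ideal e \<Longrightarrow> z \<in> order_ideal e \<Longrightarrow> y - z \<in> order_ideal e"
  using order_ideal_add(1)[OF _ order_ideal_minus] by simp

lemma real_homs_le:
  assumes "0 \<le> e" "y \<in> order_ideal e" "z \<in> order_ideal e" "\<And>\<omega>. \<omega> \<in> real_homs e \<Longrightarrow> \<omega> y \<le> \<omega> z"
  shows "y \<le> z"
proof -
  have "y - z \<le> 0"
    using assms by (intro real_homs_separate[OF assms(1)] order_ideal_diff) (simp_all add: real_homs_simps)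
  then show ?thesis
    by simp
qed

lemma real_homs_eqI:
  assumes "0 \<le> e" "y \<in> order_ideal e" "z \<in> order_ideal e" "\<And>\<omega>. \<omega> \<in> real_homs e \<Longrightarrow> \<omega> y = \<omega> z"
  shows "y = z"
  by (intro antisym real_homs_le[OF assms(1)] assms(2,3)) (simp_all add: assms(4))

lemma real_homs_abs_diff_le:
  assumes e: "0 \<le> e" and y: "y \<in> order_ideal e" and z: "z \<in> order_ideal e"
    and le: "\<And>\<omega>. \<omega> \<in> real_homs e \<Longrightarrow> \<bar>\<omega> y - \<omega> z\<bar> \<le> c * \<omega> e"
  shows "\<bar>y - z\<bar> \<le> c *\<^sub>R e"
proof (rule abs_leI)
  have I: "e \<in> order_ideal e"
    using e by (intro order_idealI[of 1]) simp_all
  have "\<omega> (y - z) \<le> \<omega> (c *\<^sub>R e)" "\<omega> (z - y) \<le> \<omega> (c *\<^sub>R e)" if "\<omega> \<in> real_homs e" for \<omega>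
    using le[OF that] y z I by (simp_all add: real_homs_simps[OF that] abs_le_iff)
  then show "y - z \<le> c *\<^sub>R e" "- (y - z) \<le> c *\<^sub>R e"
    using y z I real_homs_le[OF e] by (simp_all add: order_ideal_diff order_ideal_scale)
qed

section \<open>Elements represented by a homogeneous function\<close>

definition abs_sum :: "nat \<Rightarrow> (nat \<Rightarrow> 'a::banach_lattice) \<Rightarrow> 'a"
  where "abs_sum n x = (\<Sum>i<n. \<bar>x i\<bar>)"

lemma abs_sum_nonneg: "0 \<le> abs_sum n x"
  by (simp add: abs_sum_def sum_nonneg)

lemma abs_sum_upper: "i < n \<Longrightarrow> \<bar>x i\<bar> \<le> abs_sum n x"
  unfolding abs_sum_def using sum_mono2[of "{..<n}" "{i}" "\<lambda>i. \<bar>x i\<bar>"] by simp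

definition represents :: "nat \<Rightarrow> (nat \<Rightarrow> 'a::banach_lattice) \<Rightarrow> ((nat \<Rightarrow> real) \<Rightarrow> real) \<Rightarrow> 'a \<Rightarrow> bool"
  where "represents n x h y \<longleftrightarrow> y \<in> order_ideal (abs_sum n x) \<and>
    (\<forall>\<omega>\<in>real_homs (abs_sum n x). \<omega> y = h (\<lambda>i. \<omega> (x i)))"

lemma representsD:
  "represents n x h y \<Longrightarrow> y \<in> order_ideal (abs_sum n x)"
  "represents n x h y \<Longrightarrow> \<omega> \<in> real_homs (abs_sum n x) \<Longrightarrow> \<omega> y = h (\<lambda>i. \<omega> (x i))"
  by (simp_all add: represents_def)

lemma represents_coord: "i < n \<Longrightarrow> represents n x (\<lambda>a. a i) (x i)"
  unfolding represents_def using abs_sum_upper[of i n x] by (auto intro!: order_idealI[of 1])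

lemma represents_add:
  "represents n x g y \<Longrightarrow> represents n x h z \<Longrightarrow> represents n x (\<lambda>a. g a + h a) (y + z)"
  by (simp add: represents_def real_homs_simps order_ideal_add)

lemma represents_scale: "represents n x g y \<Longrightarrow> represents n x (\<lambda>a. c * g a) (c *\<^sub>R y)"
  by (simp add: represents_def real_homs_simps order_ideal_scale)

lemma represents_max:
  "represents n x g y \<Longrightarrow> represents n x h z \<Longrightarrow> represents n x (\<lambda>a. max (g a) (h a)) (sup y z)"
  by (simp add: represents_def real_homs_simps order_ideal_add)

lemma represents_min:
  "represents n x g y \<Longrightarrow> represents n x h z \<Longrightarrow> represents n x (\<lambda>a. min (g a) (h a)) (inf y z)"
  by (simp add: represents_def real_homs_simps order_ideal_inf)

lemma represents_lattice_linear: "g \<in> lattice_linear n \<Longrightarrow> \<exists>y. represents n x g y"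
proof (induction rule: lattice_linear.induct)
  case (coord i)
  then show ?case using represents_coord by blast
next
  case (scale g c)
  then show ?case using represents_scale by blast
next
  case (add g h)
  then show ?case using represents_add by blast
next
  case (max g h)
  then show ?case using represents_max by blast
next
  case (min g h)
  then show ?case using represents_min by blast
qed

lemma represents_unique: "represents n x h y \<Longrightarrow> represents n x h z \<Longrightarrow> y = z"
  by (rule real_homs_eqI[OF abs_sum_nonneg[of n x]]) (simp_all only: representsD)

lemma real_homs_abs_sum:
  assumes \<omega>: "\<omega> \<in> real_homs (abs_sum n x)"
  shows "\<omega> (abs_sum n x) = l1_norm n (\<lambda>i. \<omega> (x i))"
proof -
  let ?I = "order_ideal (abs_sum n x)"
  have xI: "\<bar>x i\<bar> \<in> ?I" and \<omega>x: "\<omega> \<bar>x i\<bar> = \<bar>\<omega> (x i)\<bar>" if "i < n" for i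
    using abs_sum_upper[OF that, of x] real_homs_unary(3)[OF \<omega>, of "x i"]
      order_idealI[of 1 "x i" "abs_sum n x"] order_idealI[of 1 "\<bar>x i\<bar>" "abs_sum n x"] by simp_all
  have 0: "0 \<in> ?I"
    by (rule subspace_0[OF subspace_order_ideal])
  have "\<omega> (\<Sum>i<k. \<bar>x i\<bar>) = (\<Sum>i<k. \<bar>\<omega> (x i)\<bar>) \<and> (\<Sum>i<k. \<bar>x i\<bar>) \<in> ?I" if "k \<le> n" for k
    using that
  proof (induction k)
    case 0
    then show ?case
      using \<open>0 \<in> ?I\<close> real_homs_unary(1)[OF \<omega> \<open>0 \<in> ?I\<close>, of 0] by simp
  next
    case (Suc k)
    then show ?case
      using xI[of k] \<omega>x[of k] by (simp add: real_homs_simps[OF \<omega>] order_ideal_add)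
  qed
  then show ?thesis
    by (simp add: abs_sum_def l1_norm_def)
qed

lemma represents_abs_diff_le:
  assumes "represents n x g y" "represents n x h z" "\<And>a. \<bar>g a - h a\<bar> \<le> c * l1_norm n a"
  shows "\<bar>y - z\<bar> \<le> c *\<^sub>R abs_sum n x"
proof (rule real_homs_abs_diff_le[OF abs_sum_nonneg representsD(1)[OF assms(1)] representsD(1)[OF assms(2)]])
  show "\<bar>\<omega> y - \<omega> z\<bar> \<le> c * \<omega> (abs_sum n x)" if "\<omega> \<in> real_homs (abs_sum n x)" for \<omega>
    unfolding representsD(2)[OF assms(1) that] representsD(2)[OF assms(2) that] real_homs_abs_sum[OF that]
    by (rule assms(3))
qed

text \<open>Lattice-linear functions approximating \<open>h\<close> at a geometric rate have
  representatives whose differences are dominated by multiples of \<open>abs_sum n x\<close>. They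
  form a Cauchy sequence, and its limit represents \<open>h\<close>.\<close>

lemma represents_exists:
  assumes n: "0 < n" and h: "h \<in> krivine_functions n"
  shows "\<exists>y. represents n x h y"
proof -
  let ?e = "abs_sum n x"
  have "\<exists>g\<in>lattice_linear n. \<forall>a. \<bar>h a - g a\<bar> \<le> (1/2)^k * l1_norm n a" for k :: nat
    using lattice_linear_dense[OF n h, of "(1/2)^k"] by (metis zero_less_power half_gt_zero_iff zero_less_one)
  then obtain g where gL: "\<And>k. g k \<in> lattice_linear n"
    and gh: "\<And>k a. \<bar>h a - g k a\<bar> \<le> (1/2)^k * l1_norm n a"
    by metis
  have "\<forall>k. \<exists>y. represents n x (g k) y"
    by (intro allI represents_lattice_linear gL)
  then obtain y where y: "\<And>k. represents n x (g k) (y k)"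
    by metis
  have diff: "\<bar>y k - y l\<bar> \<le> (2 * (1/2)^l) *\<^sub>R ?e" if "l \<le> k" for k l
  proof (rule represents_abs_diff_le[OF y y])
    fix a
    have "(1/2::real)^k \<le> (1/2)^l"
      using that by (intro power_decreasing) simp_all
    then have "(1/2)^k * l1_norm n a \<le> (1/2)^l * l1_norm n a"
      by (intro mult_right_mono l1_norm_nonneg)
    then show "\<bar>g k a - g l a\<bar> \<le> 2 * (1/2)^l * l1_norm n a"
      using gh[of a k] gh[of a l] by simp
  qed
  have "Cauchy y"
  proof (rule metric_CauchyI)
    fix \<epsilon> :: real assume "0 < \<epsilon>"
    have "(\<lambda>l. 2 * (1/2)^l * norm ?e) \<longlonglongrightarrow> 2 * 0 * norm ?e"
      by (intro tendsto_intros LIMSEQ_power_zero) simp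
    then have "(\<lambda>l. 2 * (1/2)^l * norm ?e) \<longlonglongrightarrow> 0"
      by simp
    then obtain M where M: "2 * (1/2)^M * norm ?e < \<epsilon> / 2"
      using order_tendstoD(2)[of _ 0 sequentially "\<epsilon>/2"] \<open>0 < \<epsilon>\<close>
      by (metis (no_types, lifting) eventually_sequentially half_gt_zero order_refl)
    have near: "dist (y k) (y M) < \<epsilon> / 2" if "M \<le> k" for k
      using norm_le_of_abs_le[OF diff[OF that]] M by (simp add: dist_norm)
    have "dist (y k) (y l) < \<epsilon>" if "M \<le> k" "M \<le> l" for k l
      using near[OF that(1)] near[OF that(2)] by (rule dist_triangle_half_l)
    then show "\<exists>M. \<forall>k\<ge>M. \<forall>l\<ge>M. dist (y k) (y l) < \<epsilon>"
      by blast
  qed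
  then obtain u where u: "y \<longlonglongrightarrow> u"
    using Cauchy_convergent convergent_def by blast
  \<comment> \<open>The order bounds survive the norm limit. They are what relates \<open>u\<close>
    to \<open>y l\<close> under a homomorphism \<omega>, since \<omega> need not be continuous for
    the norm.\<close>
  have uy: "\<bar>u - y l\<bar> \<le> (2 * (1/2)^l) *\<^sub>R ?e" for l
    using u diff by (rule abs_diff_le_limit)
  have I: "u - y 0 \<in> order_ideal ?e" "y k \<in> order_ideal ?e" for k
    using order_idealI[OF _ uy[of 0]] representsD(1)[OF y] by simp_all
  have uI: "u \<in> order_ideal ?e"
    using order_ideal_add(1)[OF I(1) I(2)[of 0]] by simp
  have eI: "?e \<in> order_ideal ?e"
    by (rule order_idealI[of 1]) (simp_all add: abs_sum_nonneg)
  have "\<omega> u = h (\<lambda>i. \<omega> (x i))" if \<omega>: "\<omega> \<in> real_homs ?e" for \<omega>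
  proof (rule LIMSEQ_unique)
    let ?b = "\<lambda>i. \<omega> (x i)" and ?N = "\<omega> ?e"
    have mono: "\<omega> v \<le> \<omega> w" if "v \<le> w" "v \<in> order_ideal ?e" "w \<in> order_ideal ?e" for v w
      using real_homs_binary(3)[OF \<omega> that(2,3)] sup_absorb2[OF that(1)] by simp
    have dI: "u - y k \<in> order_ideal ?e" for k
      using uI I by (intro order_ideal_diff)
    have aI: "\<bar>u - y k\<bar> \<in> order_ideal ?e" for k
      using uy[of k] by (intro order_idealI[of "2 * (1/2)^k"]) simp_all
    have "\<bar>\<omega> u - \<omega> (y k)\<bar> \<le> 2 * (1/2)^k * ?N" for k
      using mono[OF uy[of k] aI order_ideal_scale[OF eI]] dI[of k] uI I(2)[of k] eI
      by (simp add: real_homs_simps[OF \<omega>])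
    moreover have "\<bar>h ?b - \<omega> (y k)\<bar> \<le> (1/2)^k * ?N" for k
      using gh[of ?b k] representsD(2)[OF y \<omega>, of k] by (simp add: real_homs_abs_sum[OF \<omega>])
    ultimately have *: "norm (\<omega> (y k) - \<omega> u) \<le> 2 * (1/2)^k * ?N" "norm (\<omega> (y k) - h ?b) \<le> 2 * (1/2)^k * ?N" for k
    proof -
      have "0 \<le> (1/2)^k * ?N"
        unfolding real_homs_abs_sum[OF \<omega>] by (simp add: l1_norm_nonneg)
      then show "norm (\<omega> (y k) - \<omega> u) \<le> 2 * (1/2)^k * ?N" "norm (\<omega> (y k) - h ?b) \<le> 2 * (1/2)^k * ?N"
        using \<open>\<And>k. \<bar>\<omega> u - \<omega> (y k)\<bar> \<le> 2 * (1/2)^k * ?N\<close>[of k]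
          \<open>\<And>k. \<bar>h ?b - \<omega> (y k)\<bar> \<le> (1/2)^k * ?N\<close>[of k] by (simp_all add: abs_minus_commute)
    qed
    have "(\<lambda>k. 2 * (1/2)^k * ?N) \<longlonglongrightarrow> 2 * 0 * ?N"
      by (intro tendsto_intros LIMSEQ_power_zero) simp
    then have zero: "(\<lambda>k. 2 * (1/2)^k * ?N) \<longlonglongrightarrow> 0"
      by simp
    have "(\<lambda>k. \<omega> (y k) - \<omega> u) \<longlonglongrightarrow> 0" "(\<lambda>k. \<omega> (y k) - h ?b) \<longlonglongrightarrow> 0"
      using * by (auto intro!: Lim_null_comparison[OF _ zero])
    then show "(\<lambda>k. \<omega> (y k)) \<longlonglongrightarrow> \<omega> u" "(\<lambda>k. \<omega> (y k)) \<longlonglongrightarrow> h ?b"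
      by (simp_all add: LIM_zero_iff)
  qed
  then show ?thesis
    using uI unfolding represents_def by blast
qed

text \<open>Any choice of represented elements will do: their uniqueness turns the closure rules for
  \<open>represents\<close> into the homomorphism laws.\<close>

lemma krivine_hom_exists:
  assumes "0 < n"
  shows "\<exists>\<tau>. krivine_hom n x \<tau>"
proof -
  define \<tau> where "\<tau> h = (SOME y. represents n x h y)" for h
  have \<tau>: "represents n x h (\<tau> h)" if "h \<in> krivine_functions n" for h
    unfolding \<tau>_def using represents_exists[OF assms that] by (rule someI_ex)
  have eq: "\<tau> h = y" if "h \<in> krivine_functions n" "represents n x h y" for h y
    using represents_unique \<tau>[OF that(1)] that(2) .
  have "krivine_hom n x \<tau>"
    unfolding krivine_hom_def
    by (intro conjI allI impI ballI eq krivine_functions_coord represents_coord krivine_functions_add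
      represents_add krivine_functions_max represents_max krivine_functions_min represents_min
      krivine_functions_scale represents_scale \<tau>)
  then show ?thesis
    by blast
qed

lemma abs_diff_leD: "\<bar>y - z\<bar> \<le> b \<Longrightarrow> y \<le> z + b"
  for y z b :: "'a::banach_lattice"
  using abs_le_D1[of "y - z" b] by (simp add: algebra_simps)

lemma represents_sum:
  "finite J \<Longrightarrow> (\<And>j. j \<in> J \<Longrightarrow> represents n x (g j) (y j)) \<Longrightarrow>
    represents n x (\<lambda>a. \<Sum>j\<in>J. g j a) (\<Sum>j\<in>J. y j)"
proof (induction J rule: finite_induct)
  case empty
  have "0 \<in> order_ideal (abs_sum n x)"
    by (rule subspace_0[OF subspace_order_ideal])
  moreover from this have "\<omega> 0 = 0" if "\<omega> \<in> real_homs (abs_sum n x)" for \<omega>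
    using real_homs_unary(1)[OF that, of 0 0] by simp
  ultimately show ?case
    by (simp add: represents_def)
next
  case (insert j J)
  then show ?case
    by (simp add: represents_add)
qed

lemma represents_abs:
  "represents n x g y \<Longrightarrow> represents n x (\<lambda>a. \<bar>g a\<bar>) \<bar>y\<bar>"
proof -
  assume y: "represents n x g y"
  have "\<bar>y\<bar> \<in> order_ideal (abs_sum n x)"
    using representsD(1)[OF y] by (simp add: order_ideal_def)
  then show ?thesis
    using y by (simp add: represents_def real_homs_simps)
qed

lemma represents_mono:
  assumes "represents n x g y" "represents n x h z" "\<And>a. g a \<le> h a"
  shows "y \<le> z"
proof (rule real_homs_le[OF abs_sum_nonneg representsD(1)[OF assms(1)] representsD(1)[OF assms(2)]])
  show "\<omega> y \<le> \<omega> z" if "\<omega> \<in> real_homs (abs_sum n x)" for \<omega>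
    unfolding representsD(2)[OF assms(1) that] representsD(2)[OF assms(2) that] by (rule assms(3))
qed

lemma represents_l1_norm: "represents n x (l1_norm n) (abs_sum n x)"
  unfolding represents_def
  by (auto simp: real_homs_abs_sum abs_sum_nonneg intro!: order_idealI[of 1])

text \<open>No continuity of \<tau> is assumed. Preservation of maxima makes \<tau> monotone, so an
  approximation within c times \<open>l1_norm n\<close> becomes one within c times
  \<open>abs_sum n x\<close>. On lattice-linear functions \<tau> is determined by induction, and the
  Archimedean property removes the error in general.\<close>

lemma krivine_hom_represents:
  assumes n: "0 < n" and \<tau>: "krivine_hom n x \<tau>" and h: "h \<in> krivine_functions n"
  shows "represents n x h (\<tau> h)"
proof -
  let ?e = "abs_sum n x"
  have scale: "\<tau> (\<lambda>a. c * h a) = c *\<^sub>R \<tau> h" if "h \<in> krivine_functions n" for c h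
    using \<tau> that by (simp add: krivine_hom_def)
  have binary: "\<tau> (\<lambda>a. g a + h a) = \<tau> g + \<tau> h" "\<tau> (\<lambda>a. max (g a) (h a)) = sup (\<tau> g) (\<tau> h)"
    "\<tau> (\<lambda>a. min (g a) (h a)) = inf (\<tau> g) (\<tau> h)"
    if "g \<in> krivine_functions n" "h \<in> krivine_functions n" for g h
    using \<tau> that by (simp_all add: krivine_hom_def)
  have lin: "represents n x g (\<tau> g)" if "g \<in> lattice_linear n" for g
    using that
  proof (induction rule: lattice_linear.induct)
    case (coord i)
    then show ?case
      using \<tau> by (simp add: krivine_hom_def represents_coord)
  qed (simp_all add: scale binary lattice_linear_krivine represents_scale represents_add
      represents_max represents_min)
  have mono: "\<tau> g \<le> \<tau> h" if "g \<in> krivine_functions n" "h \<in> krivine_functions n" "\<And>a. g a \<le> h a" for g h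
  proof -
    have "(\<lambda>a. max (g a) (h a)) = h"
      using that(3) by (simp add: max_def fun_eq_iff)
    then have "\<tau> h = sup (\<tau> g) (\<tau> h)"
      using binary(2)[OF that(1,2)] by simp
    then show ?thesis
      by (metis sup_ge1)
  qed
  have N: "l1_norm n \<in> krivine_functions n" "\<tau> (l1_norm n) = ?e"
    using lattice_linear_krivine[OF lattice_linear_l1_norm[OF n]]
      represents_unique[OF lin[OF lattice_linear_l1_norm[OF n]] represents_l1_norm] by simp_all
  have close: "\<tau> g \<le> \<tau> h + c *\<^sub>R ?e"
    if "g \<in> krivine_functions n" "h \<in> krivine_functions n" "\<And>a. \<bar>g a - h a\<bar> \<le> c * l1_norm n a" for g h c
  proof -
    have kN: "(\<lambda>a. c * l1_norm n a) \<in> krivine_functions n"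
      by (rule krivine_functions_scale[OF N(1)])
    have "\<tau> g \<le> \<tau> (\<lambda>a. h a + c * l1_norm n a)"
    proof (rule mono[OF that(1) krivine_functions_add[OF that(2) kN]])
      show "g a \<le> h a + c * l1_norm n a" for a
        using that(3)[of a] by linarith
    qed
    then show ?thesis
      unfolding binary(1)[OF that(2) kN] scale[OF N(1)] N(2) .
  qed
  obtain y where y: "represents n x h y"
    using represents_exists[OF n h] by blast
  have near: "\<tau> h \<le> y + (2 * c) *\<^sub>R ?e \<and> y \<le> \<tau> h + (2 * c) *\<^sub>R ?e" if c: "0 < c" for c
  proof -
    obtain g where g: "g \<in> lattice_linear n" and hg: "\<And>a. \<bar>h a - g a\<bar> \<le> c * l1_norm n a"
      using lattice_linear_dense[OF n h c] by blast
    then have gh: "\<bar>g a - h a\<bar> \<le> c * l1_norm n a" for a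
      by (simp add: abs_minus_commute)
    have two: "(2 * c) *\<^sub>R ?e = c *\<^sub>R ?e + c *\<^sub>R ?e"
      by (simp flip: scaleR_left_distrib)
    have "\<tau> h \<le> \<tau> g + c *\<^sub>R ?e"
      by (rule close[OF h lattice_linear_krivine[OF g] hg])
    also have "\<tau> g \<le> y + c *\<^sub>R ?e"
      by (rule abs_diff_leD[OF represents_abs_diff_le[OF lin[OF g] y gh]])
    finally have 1: "\<tau> h \<le> y + (2 * c) *\<^sub>R ?e"
      by (simp add: two add.assoc)
    have "y \<le> \<tau> g + c *\<^sub>R ?e"
      by (rule abs_diff_leD[OF represents_abs_diff_le[OF y lin[OF g] hg]])
    also have "\<tau> g \<le> \<tau> h + c *\<^sub>R ?e"
      by (rule close[OF lattice_linear_krivine[OF g] h gh])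
    finally have "y \<le> \<tau> h + (2 * c) *\<^sub>R ?e"
      by (simp add: two add.assoc)
    with 1 show ?thesis
      by simp
  qed
  have "\<tau> h = y"
  proof (rule antisym; rule le_if_le_add_small[where e = ?e])
    fix \<epsilon> :: real assume "0 < \<epsilon>"
    then show "\<tau> h \<le> y + \<epsilon> *\<^sub>R ?e" "y \<le> \<tau> h + \<epsilon> *\<^sub>R ?e"
      using near[of "\<epsilon> / 2"] by simp_all
  qed
  then show ?thesis
    using y by simp
qed

text \<open>All homomorphisms eligible in the definite description agree at \<open>h\<close>,
  because each value represents \<open>h\<close>. From here on the functional calculus is accessible
  through \<open>represents\<close> alone.\<close>

theorem represents_krivine:
  assumes "0 < n" "h \<in> krivine_functions n"
  shows "represents n x h (krivine n x h)"
proof -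
  obtain \<tau> where \<tau>: "krivine_hom n x \<tau>"
    using krivine_hom_exists[OF assms(1)] by blast
  have r: "represents n x h (\<tau> h)"
    by (rule krivine_hom_represents[OF assms(1) \<tau> assms(2)])
  have "krivine n x h = \<tau> h"
    unfolding krivine_def
  proof (rule the_equality)
    fix y assume "\<exists>\<tau>. krivine_hom n x \<tau> \<and> \<tau> h = y"
    then show "y = \<tau> h"
      using represents_unique[OF _ r] krivine_hom_represents[OF assms(1) _ assms(2)] by blast
  qed (use \<tau> in blast)
  then show ?thesis
    using r by simp
qed

section \<open>The finite-dimensional l^p norms as homogeneous functions\<close>

definition lp_norm :: "ennreal \<Rightarrow> nat \<Rightarrow> (nat \<Rightarrow> real) \<Rightarrow> real"
  where "lp_norm p n a =
    (if p = \<infinity> then Max ((\<lambda>i. \<bar>a i\<bar>) ` {..<n})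
     else (\<Sum>i<n. \<bar>a i\<bar> powr enn2real p) powr (1 / enn2real p))"

lemma exponent_cases:
  assumes "(1::ennreal) \<le> p"
  obtains "p = \<infinity>" | P where "p = ennreal P" "1 \<le> P"
proof (cases p)
  case (real P)
  then have "1 \<le> P"
    using assms by (metis ennreal_1 ennreal_le_iff)
  then show thesis
    using real that by blast
qed (use that in auto)

lemma lp_norm_real: "1 \<le> P \<Longrightarrow> lp_norm (ennreal P) n a = (\<Sum>i<n. \<bar>a i\<bar> powr P) powr (1 / P)"
  by (simp add: lp_norm_def)

lemma Max_abs_lessThan_Suc:
  "0 < k \<Longrightarrow> Max ((\<lambda>i. \<bar>a i\<bar>) ` {..<Suc k}) = max \<bar>a k :: real\<bar> (Max ((\<lambda>i. \<bar>a i\<bar>) ` {..<k}))"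
  unfolding lessThan_Suc image_insert by (subst Max_insert) auto

lemma Sup_fin_lessThan_Suc:
  "0 < k \<Longrightarrow> \<Squnion>\<^sub>f\<^sub>i\<^sub>n ((\<lambda>i. f i) ` {..<Suc k}) = sup (f k) (\<Squnion>\<^sub>f\<^sub>i\<^sub>n ((\<lambda>i. f i) ` {..<k}))"
  unfolding lessThan_Suc image_insert by (subst Sup_fin.insert) auto

lemma krivine_functions_abs: "g \<in> krivine_functions n \<Longrightarrow> (\<lambda>a. \<bar>g a\<bar>) \<in> krivine_functions n"
  unfolding krivine_functions_def mem_Collect_eq
  by (intro conjI continuous_on_rabs) (auto simp: abs_mult intro!: arg_cong[where f = abs])

lemma krivine_functions_Max_abs:
  "0 < k \<Longrightarrow> k \<le> n \<Longrightarrow> (\<lambda>a. Max ((\<lambda>i. \<bar>a i\<bar>) ` {..<k})) \<in> krivine_functions n"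
proof (induction k rule: nat_induct_non_zero)
  case 1
  have "{..<1::nat} = {0}"
    by auto
  then show ?case
    using 1 krivine_functions_abs[OF krivine_functions_coord[of 0 n]] by simp
next
  case (Suc k)
  then show ?case
    unfolding Max_abs_lessThan_Suc[OF Suc.hyps]
    by (intro krivine_functions_max krivine_functions_abs krivine_functions_coord) simp_all
qed

lemma krivine_functions_lp_norm:
  assumes n: "0 < n" and p: "1 \<le> p"
  shows "lp_norm p n \<in> krivine_functions n"
  using p
proof (cases rule: exponent_cases)
  case 1
  then show ?thesis
    using krivine_functions_Max_abs[OF n order_refl] by (simp add: lp_norm_def[abs_def])
next
  case (2 P)
  show ?thesis
    unfolding krivine_functions_def mem_Collect_eq
  proof (intro conjI allI impI)
    fix a b :: "nat \<Rightarrow> real" assume "\<forall>i<n. a i = b i"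
    then show "lp_norm p n a = lp_norm p n b"
      unfolding 2(1) lp_norm_real[OF 2(2)] by (metis (mono_tags, lifting) lessThan_iff sum.cong)
  next
    have "continuous_on UNIV (\<lambda>a :: nat \<Rightarrow> real. (\<Sum>i<n. \<bar>a i\<bar> powr P) powr (1 / P))"
      using 2(2)
      by (intro continuous_on_powr' continuous_on_sum continuous_on_rabs continuous_on_coord
          continuous_on_const ballI conjI impI sum_nonneg) simp_all
    then show "continuous_on UNIV (lp_norm p n)"
      unfolding 2(1) by (simp add: lp_norm_real[OF 2(2), abs_def])
  next
    fix t :: real and a :: "nat \<Rightarrow> real" assume t: "0 \<le> t"
    have "(\<Sum>i<n. \<bar>t * a i\<bar> powr P) = t powr P * (\<Sum>i<n. \<bar>a i\<bar> powr P)"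
      using t by (simp add: abs_mult powr_mult sum_distrib_left)
    then show "lp_norm p n (\<lambda>i. t * a i) = t * lp_norm p n a"
      unfolding 2(1) lp_norm_real[OF 2(2)] using t 2(2) by (simp add: powr_mult powr_powr sum_nonneg)
  qed
qed

lemma represents_Sup_fin:
  "0 < k \<Longrightarrow> k \<le> n \<Longrightarrow>
    represents n x (\<lambda>a. Max ((\<lambda>i. \<bar>a i\<bar>) ` {..<k})) (\<Squnion>\<^sub>f\<^sub>i\<^sub>n ((\<lambda>i. \<bar>x i\<bar>) ` {..<k}))"
proof (induction k rule: nat_induct_non_zero)
  case 1
  have "{..<1::nat} = {0}"
    by auto
  then show ?case
    using 1 represents_abs[OF represents_coord[of 0 n x]] by simp
next
  case (Suc k)
  then show ?case
    unfolding Max_abs_lessThan_Suc[OF Suc.hyps] Sup_fin_lessThan_Suc[OF Suc.hyps]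
    by (intro represents_max represents_abs represents_coord) simp_all
qed

text \<open>For an infinite exponent the power sum is a lattice supremum defined outside the
  functional calculus; representing it by the maximum norm lets both cases be treated alike
  afterwards.\<close>

theorem represents_power_sum:
  assumes "0 < n" "1 \<le> p"
  shows "represents n x (lp_norm p n) (power_sum p n x)"
proof (cases "p = \<infinity>")
  case True
  then show ?thesis
    using represents_Sup_fin[OF assms(1) order_refl, of x] by (simp add: lp_norm_def[abs_def] power_sum_def)
next
  case False
  then show ?thesis
    using represents_krivine[OF assms(1) krivine_functions_lp_norm[OF assms], of x]
    by (simp add: lp_norm_def[abs_def] power_sum_def)
qed


section \<open>Duality of the finite-dimensional norms\<close>

text \<open>In \<open>ennreal\<close> the inverse of 0 is infinite, so the equation itself excludes
  the exponent 0.\<close>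

lemma conjugate_exponent_cases:
  fixes p r :: ennreal
  assumes "inverse p + inverse r = 1"
  obtains "p = \<infinity>" "r = 1" | "p = 1" "r = \<infinity>"
    | P R where "p = ennreal P" "r = ennreal R" "1 < P" "1 < R" "1 / P + 1 / R = 1"
proof -
  have inv: "x = \<infinity> \<and> inverse x = 0 \<or> (\<exists>X>0. x = ennreal X \<and> inverse x = ennreal (1 / X)) \<or> inverse x = \<infinity>"
    for x :: ennreal
  proof (cases x)
    case (real X)
    then show ?thesis
    proof (cases "X = 0")
      case False
      then have "0 < X"
        using real by simp
      then show ?thesis
        using real by (intro disjI2 disjI1 exI[of _ X]) (simp add: inverse_ennreal inverse_eq_divide)
    qed (use real in simp)
  qed simp
  have one: "X = 1" if "0 < X" "ennreal (1 / X) = 1" for X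
    using that by (metis divide_eq_1_iff ennreal_eq_1 order_less_irrefl)
  consider "p = \<infinity>" "inverse p = 0" | P where "0 < P" "p = ennreal P" "inverse p = ennreal (1 / P)"
    using inv[of p] assms by (cases "inverse p = \<infinity>") auto
  then show thesis
  proof cases
    case 1
    then have "inverse r = 1"
      using assms by simp
    then have "r = 1"
      using inv[of r] one[of "enn2real r"] by auto
    then show thesis
      using 1 that by blast
  next
    case (2 P)
    consider "r = \<infinity>" "inverse r = 0" | R where "0 < R" "r = ennreal R" "inverse r = ennreal (1 / R)"
      using inv[of r] assms by (cases "inverse r = \<infinity>") auto
    then show thesis
    proof cases
      case 1
      then have "P = 1"
        using assms 2 by (intro one) simp_all
      then show thesis
        using 1 2 that by simp
    next
      case (2 R)
      have "ennreal (1 / P + 1 / R) = 1"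
        using assms 2 \<open>0 < P\<close> \<open>inverse p = ennreal (1 / P)\<close> by (simp add: ennreal_plus)
      then have *: "1 / P + 1 / R = 1"
        by (simp add: ennreal_eq_1)
      moreover have "0 < 1 / P" "0 < 1 / R"
        using 2 \<open>0 < P\<close> by simp_all
      ultimately have "1 / P < 1" "1 / R < 1"
        by linarith+
      then have "1 < P" "1 < R"
        using 2 \<open>0 < P\<close> by (simp_all add: divide_less_eq)
      then show thesis
        using * 2 \<open>p = ennreal P\<close> that by blast
    qed
  qed
qed

lemma conjugate_exponent_ge_1:
  fixes p r :: ennreal
  assumes "inverse p + inverse r = 1"
  shows "1 \<le> p" "1 \<le> r"
  using assms by (cases rule: conjugate_exponent_cases; simp flip: ennreal_1)+

lemma lp_norm_1: "lp_norm 1 n a = l1_norm n a"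
  by (simp add: lp_norm_def l1_norm_def sum_nonneg)

lemma lp_norm_inf_upper: "i < n \<Longrightarrow> \<bar>a i\<bar> \<le> lp_norm \<infinity> n a"
  by (simp add: lp_norm_def)

lemma lp_norm_inf_least: "0 < n \<Longrightarrow> (\<And>i. i < n \<Longrightarrow> \<bar>a i\<bar> \<le> c) \<Longrightarrow> lp_norm \<infinity> n a \<le> c"
  unfolding lp_norm_def by (simp add: lessThan_empty_iff)

lemma Hoelder_sum_1_inf: "(\<Sum>i<n. a i * b i) \<le> l1_norm n a * lp_norm \<infinity> n b"
proof -
  have "(\<Sum>i<n. a i * b i) \<le> (\<Sum>i<n. \<bar>a i\<bar> * lp_norm \<infinity> n b)"
  proof (rule sum_mono)
    fix i assume "i \<in> {..<n}"
    then have "\<bar>a i\<bar> * \<bar>b i\<bar> \<le> \<bar>a i\<bar> * lp_norm \<infinity> n b"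
      by (intro mult_left_mono lp_norm_inf_upper) simp_all
    then show "a i * b i \<le> \<bar>a i\<bar> * lp_norm \<infinity> n b"
      using abs_ge_self[of "a i * b i"] by (simp add: abs_mult)
  qed
  then show ?thesis
    by (simp add: l1_norm_def sum_distrib_right)
qed

lemma sum_powr_eq_0D:
  fixes n :: nat
  assumes "1 \<le> P" "(\<Sum>i<n. \<bar>a i\<bar> powr P) = 0" "i < n"
  shows "a i = (0::real)"
  using assms by (simp add: sum_nonneg_eq_0_iff)

lemma lp_norm_powr:
  assumes "1 \<le> P"
  shows "lp_norm (ennreal P) n a powr P = (\<Sum>i<n. \<bar>a i\<bar> powr P)"
  using assms by (simp add: lp_norm_real powr_powr sum_nonneg)

text \<open>Young's inequality for the normalised vectors, summed over the coordinates. If one of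
  the norms vanishes, so does every product.\<close>

lemma Hoelder_sum_real:
  assumes "1 < P" "1 < R" and PR: "1 / P + 1 / R = 1"
  shows "(\<Sum>i<n. a i * b i) \<le> lp_norm (ennreal P) n a * lp_norm (ennreal R) n b"
proof -
  define A where "A = lp_norm (ennreal P) n a"
  define B where "B = lp_norm (ennreal R) n b"
  have A: "A powr P = (\<Sum>i<n. \<bar>a i\<bar> powr P)" and B: "B powr R = (\<Sum>i<n. \<bar>b i\<bar> powr R)"
    using assms by (simp_all add: A_def B_def lp_norm_powr)
  have nonneg: "0 \<le> A" "0 \<le> B"
    using assms by (simp_all add: A_def B_def lp_norm_real)
  show ?thesis
  proof (cases "A = 0 \<or> B = 0")
    case True
    then have "a i * b i = 0" if "i < n" for i
      using that A B sum_powr_eq_0D[of P a n i] sum_powr_eq_0D[of R b n i] assms by auto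
    then have "(\<Sum>i<n. a i * b i) = 0"
      by (intro sum.neutral) blast
    then show ?thesis
      using nonneg by (simp add: A_def[symmetric] B_def[symmetric])
  next
    case False
    then have pos: "0 < A" "0 < B"
      using nonneg by auto
    have "(\<Sum>i<n. a i * b i) / (A * B) = (\<Sum>i<n. (a i / A) * (b i / B))"
      by (simp add: sum_divide_distrib)
    also have "\<dots> \<le> (\<Sum>i<n. (1 / P) * (\<bar>a i\<bar> powr P / A powr P) + (1 / R) * (\<bar>b i\<bar> powr R / B powr R))"
    proof (rule sum_mono)
      fix i
      have "(a i / A) * (b i / B) \<le> \<bar>a i / A\<bar> * \<bar>b i / B\<bar>"
        using abs_ge_self[of "(a i / A) * (b i / B)"] by (simp only: abs_mult)
      also have "\<dots> \<le> \<bar>a i / A\<bar> powr P / P + \<bar>b i / B\<bar> powr R / R"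
        using assms by (intro Youngs_inequality) simp_all
      also have "\<dots> = (1 / P) * (\<bar>a i\<bar> powr P / A powr P) + (1 / R) * (\<bar>b i\<bar> powr R / B powr R)"
        using pos by (simp add: abs_divide powr_divide mult.commute)
      finally show "(a i / A) * (b i / B) \<le> (1 / P) * (\<bar>a i\<bar> powr P / A powr P) + (1 / R) * (\<bar>b i\<bar> powr R / B powr R)" .
    qed
    also have "\<dots> = (1 / P) * ((\<Sum>i<n. \<bar>a i\<bar> powr P) / A powr P) + (1 / R) * ((\<Sum>i<n. \<bar>b i\<bar> powr R) / B powr R)"
      by (simp add: sum.distrib sum_divide_distrib sum_distrib_left)
    also have "\<dots> = 1"
      using PR pos by (simp flip: A B)
    finally show ?thesis
      using pos by (simp add: divide_le_eq flip: A_def B_def)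
  qed
qed

lemma Hoelder_sum:
  assumes "inverse p + inverse r = 1"
  shows "(\<Sum>i<n. a i * b i) \<le> lp_norm p n a * lp_norm r n b"
  using assms
proof (cases rule: conjugate_exponent_cases)
  case 1
  then show ?thesis
    using Hoelder_sum_1_inf[where a = b and b = a and n = n] by (simp add: lp_norm_1 mult.commute)
next
  case 2
  then show ?thesis
    using Hoelder_sum_1_inf[where a = a and b = b and n = n] by (simp add: lp_norm_1)
next
  case (3 P R)
  then show ?thesis
    using Hoelder_sum_real by simp
qed

text \<open>The extremal vectors of Hoelder's inequality: a sign at one largest coordinate, the
  vector of all signs, or normalised powers |s i|^(P - 1) carrying the signs of
  \<open>s\<close>.\<close>

lemma Hoelder_sum_attained:
  assumes n: "0 < n" and "inverse p + inverse r = 1"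
  shows "\<exists>a. lp_norm r n a \<le> 1 \<and> (\<Sum>i<n. a i * s i) = lp_norm p n s"
  using assms(2)
proof (cases rule: conjugate_exponent_cases)
  case 1
  have "lp_norm \<infinity> n s \<in> (\<lambda>i. \<bar>s i\<bar>) ` {..<n}"
    unfolding lp_norm_def using n by (simp add: Max_in lessThan_empty_iff)
  then obtain k where k: "k < n" "lp_norm \<infinity> n s = \<bar>s k\<bar>"
    by auto
  define a where "a i = (if i = k then sgn (s k) else 0)" for i
  have "\<bar>a i\<bar> = (if i = k then \<bar>sgn (s k)\<bar> else 0)" "a i * s i = (if i = k then sgn (s k) * s k else 0)" for i
    by (simp_all add: a_def)
  then have "l1_norm n a = \<bar>sgn (s k)\<bar>" "(\<Sum>i<n. a i * s i) = \<bar>s k\<bar>"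
    using k by (simp_all add: l1_norm_def abs_sgn mult.commute)
  then show ?thesis
    using 1 k by (intro exI[of _ a]) (simp add: lp_norm_1 abs_sgn_eq)
next
  case 2
  have "lp_norm \<infinity> n (\<lambda>i. sgn (s i)) \<le> 1"
    by (rule lp_norm_inf_least[OF n]) (simp add: abs_sgn_eq)
  moreover have "(\<Sum>i<n. sgn (s i) * s i) = l1_norm n s"
    unfolding l1_norm_def by (intro sum.cong) (simp_all add: abs_sgn mult.commute)
  ultimately show ?thesis
    using 2 by (intro exI[of _ "\<lambda>i. sgn (s i)"]) (simp add: lp_norm_1)
next
  case (3 P R)
  have PR: "(P - 1) * R = P"
    using 3 by (simp add: field_simps)
  define S where "S = (\<Sum>i<n. \<bar>s i\<bar> powr P)"
  show ?thesis
  proof (cases "S = 0")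
    case True
    then show ?thesis
      using 3 by (intro exI[of _ "\<lambda>i. 0"]) (simp add: lp_norm_real S_def)
  next
    case False
    then have S: "0 < S"
      using sum_nonneg[of "{..<n}" "\<lambda>i. \<bar>s i\<bar> powr P"] by (simp add: S_def less_le)
    \<comment> \<open>Without the denominator the R-th powers would sum to \<open>S\<close>, because
      (P - 1) R = P; dividing by S^(1/R) gives a vector of norm one.\<close>
    define a where "a i = sgn (s i) * \<bar>s i\<bar> powr (P - 1) / S powr (1 / R)" for i
    have "\<bar>a i\<bar> powr R = \<bar>s i\<bar> powr P / S" for i
    proof -
      have "\<bar>a i\<bar> = \<bar>s i\<bar> powr (P - 1) / S powr (1 / R)"
        using 3 by (simp add: a_def abs_mult abs_divide abs_sgn_eq)
      then show ?thesis
        using 3 S PR by (simp add: powr_divide powr_powr)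
    qed
    then have a_norm: "(\<Sum>i<n. \<bar>a i\<bar> powr R) = 1"
      using S by (simp add: S_def flip: sum_divide_distrib)
    have "a i * s i = \<bar>s i\<bar> powr P / S powr (1 / R)" for i
    proof -
      have "sgn (s i) * s i = \<bar>s i\<bar>"
        by (simp add: abs_sgn mult.commute)
      then have "a i * s i = \<bar>s i\<bar> * \<bar>s i\<bar> powr (P - 1) / S powr (1 / R)"
        unfolding a_def by (metis mult.assoc mult.commute times_divide_eq_left)
      then show ?thesis
        by (simp add: powr_mult_base)
    qed
    then have "(\<Sum>i<n. a i * s i) = S / S powr (1 / R)"
      by (simp add: S_def flip: sum_divide_distrib)
    also have "\<dots> = S powr (1 - 1 / R)"
      using S by (simp add: powr_diff)
    also have "1 - 1 / R = 1 / P"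
      using 3 by simp
    finally show ?thesis
      using 3 a_norm by (intro exI[of _ a]) (simp add: lp_norm_real S_def)
  qed
qed


section \<open>Power sums in a Banach lattice and its dual\<close>

lemma power_sum_upper:
  assumes n: "0 < n" and pr: "inverse p + inverse r = 1"
  shows "(\<Sum>i<n. a i *\<^sub>R x i) \<le> lp_norm r n a *\<^sub>R power_sum p n x"
proof (rule represents_mono)
  show "represents n x (\<lambda>b. \<Sum>i<n. a i * b i) (\<Sum>i<n. a i *\<^sub>R x i)"
    by (rule represents_sum) (simp_all add: represents_scale[OF represents_coord])
  show "represents n x (\<lambda>b. lp_norm r n a * lp_norm p n b) (lp_norm r n a *\<^sub>R power_sum p n x)"
    by (rule represents_scale[OF represents_power_sum[OF n conjugate_exponent_ge_1(1)[OF pr]]])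
  show "(\<Sum>i<n. a i * b i) \<le> lp_norm r n a * lp_norm p n b" for b
    using Hoelder_sum[of r p a b n] pr by (simp add: add.commute)
qed

lemma lp_norm_nonneg: "0 < n \<Longrightarrow> 0 \<le> lp_norm p n a"
  using order_trans[OF abs_ge_zero lp_norm_inf_upper[of 0 n a]]
  by (cases "p = \<infinity>") (simp_all add: lp_norm_def)

lemma represents_zero: "represents n x (\<lambda>a. 0) 0"
  using represents_sum[of "{}" n x "\<lambda>_ _. 0" "\<lambda>_. 0"] by simp

lemma power_sum_nonneg:
  assumes "0 < n" "1 \<le> p"
  shows "0 \<le> power_sum p n x"
  using represents_mono[OF represents_zero represents_power_sum[OF assms]] lp_norm_nonneg[OF assms(1)]
  by blast

lemma lp_norm_zero: "lp_norm r n (\<lambda>i. 0) = (if r = \<infinity> then Max ((\<lambda>i. 0) ` {..<n}) else 0)"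
  by (simp add: lp_norm_def)

text \<open>Under each real homomorphism the power sum becomes an l^p norm, attained by some vector
  \<open>a\<close> of the dual ball. This vector depends on the homomorphism, but the hypothesis is
  available for every \<open>a\<close>, so separation by homomorphisms suffices.\<close>

lemma power_sum_least:
  assumes n: "0 < n" and pr: "inverse p + inverse r = 1"
    and upper: "\<And>a. lp_norm r n a \<le> 1 \<Longrightarrow> (\<Sum>i<n. a i *\<^sub>R x i) \<le> u"
  shows "power_sum p n x \<le> u"
proof -
  let ?s = "power_sum p n x" and ?I = "order_ideal (abs_sum n x)"
  have s: "represents n x (lp_norm p n) ?s"
    by (rule represents_power_sum[OF n conjugate_exponent_ge_1(1)[OF pr]])
  \<comment> \<open>The bound \<open>u\<close> need not lie in the ideal, where alone homomorphisms
    are defined. The combinations stay below \<open>v\<close> as well, and \<open>v\<close> lies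
    between 0 and \<open>?s\<close>, hence in the ideal.\<close>
  define v where "v = inf u ?s"
  have upper_v: "(\<Sum>i<n. a i *\<^sub>R x i) \<le> v" if a: "lp_norm r n a \<le> 1" for a
  proof -
    have s0: "0 \<le> ?s"
      by (rule power_sum_nonneg[OF n conjugate_exponent_ge_1(1)[OF pr]])
    have "(\<Sum>i<n. a i *\<^sub>R x i) \<le> lp_norm r n a *\<^sub>R ?s"
      by (rule power_sum_upper[OF n pr])
    also have "\<dots> \<le> 1 *\<^sub>R ?s"
      by (rule scaleR_right_mono[OF a s0])
    finally show ?thesis
      using upper[OF a] by (simp add: v_def)
  qed
  have "0 \<le> v"
    using upper_v[of "\<lambda>i. 0"] n by (cases "r = \<infinity>") (simp_all add: lp_norm_zero image_constant_conv lessThan_empty_iff)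
  moreover have "v \<le> ?s"
    by (simp add: v_def)
  ultimately have vI: "v \<in> ?I"
    using order_idealE[OF representsD(1)[OF s]] order_idealI
    by (metis abs_of_nonneg order_trans)
  have "?s \<le> v"
  proof (rule real_homs_le[OF abs_sum_nonneg representsD(1)[OF s] vI])
    fix \<omega> assume \<omega>: "\<omega> \<in> real_homs (abs_sum n x)"
    obtain a where a: "lp_norm r n a \<le> 1" "(\<Sum>i<n. a i * \<omega> (x i)) = lp_norm p n (\<lambda>i. \<omega> (x i))"
      using Hoelder_sum_attained[OF n pr] by metis
    have lin: "represents n x (\<lambda>b. \<Sum>i<n. a i * b i) (\<Sum>i<n. a i *\<^sub>R x i)"
      by (rule represents_sum) (simp_all add: represents_scale[OF represents_coord])
    have "\<omega> ?s = \<omega> (\<Sum>i<n. a i *\<^sub>R x i)"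
      by (simp add: representsD(2)[OF s \<omega>] representsD(2)[OF lin \<omega>] a(2))
    also have "\<dots> \<le> \<omega> v"
      using real_homs_binary(3)[OF \<omega> representsD(1)[OF lin] vI] sup_absorb2[OF upper_v[OF a(1)]] by simp
    finally show "\<omega> ?s \<le> \<omega> v" .
  qed
  then show ?thesis
    by (simp add: v_def)
qed


lemma power_sum_upper_ball:
  assumes "0 < n" "inverse p + inverse r = 1" "lp_norm r n a \<le> 1"
  shows "(\<Sum>i<n. a i *\<^sub>R x i) \<le> power_sum p n x"
proof -
  have "(\<Sum>i<n. a i *\<^sub>R x i) \<le> lp_norm r n a *\<^sub>R power_sum p n x"
    by (rule power_sum_upper[OF assms(1,2)])
  also have "\<dots> \<le> 1 *\<^sub>R power_sum p n x"
    by (rule scaleR_right_mono[OF assms(3) power_sum_nonneg[OF assms(1) conjugate_exponent_ge_1(1)[OF assms(2)]]])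
  finally show ?thesis
    by simp
qed

lemma power_sum_cong:
  assumes n: "0 < n" and pr: "inverse p + inverse r = 1" and eq: "\<And>i. i < n \<Longrightarrow> x i = y i"
  shows "power_sum p n x = power_sum p n y"
proof -
  have le: "power_sum p n x \<le> power_sum p n y" if "\<And>i. i < n \<Longrightarrow> x i = y i" for x y :: "nat \<Rightarrow> 'a"
  proof (rule power_sum_least[OF n pr])
    fix a assume a: "lp_norm r n a \<le> 1"
    have "(\<Sum>i<n. a i *\<^sub>R x i) = (\<Sum>i<n. a i *\<^sub>R y i)"
      using that by (intro sum.cong) simp_all
    then show "(\<Sum>i<n. a i *\<^sub>R x i) \<le> power_sum p n y"
      using power_sum_upper_ball[OF n pr a] by simp
  qed
  show ?thesis
    by (rule antisym; rule le) (simp_all add: eq)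
qed

lemma power_sum_add_le:
  assumes n: "0 < n" and pr: "inverse p + inverse r = 1"
  shows "power_sum p n (\<lambda>i. x i + y i) \<le> power_sum p n x + power_sum p n y"
proof (rule power_sum_least[OF n pr])
  fix a assume a: "lp_norm r n a \<le> 1"
  show "(\<Sum>i<n. a i *\<^sub>R (x i + y i)) \<le> power_sum p n x + power_sum p n y"
    using add_mono[OF power_sum_upper_ball[OF n pr a, of x] power_sum_upper_ball[OF n pr a, of y]]
    by (simp add: scaleR_right_distrib sum.distrib)
qed

lemma lp_norm_minus: "lp_norm p n (\<lambda>i. - a i) = lp_norm p n a"
  by (simp add: lp_norm_def)

lemma power_sum_scaleR:
  assumes n: "0 < n" and pr: "inverse p + inverse r = 1"
  shows "power_sum p n (\<lambda>i. c *\<^sub>R x i) = \<bar>c\<bar> *\<^sub>R power_sum p n x"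
proof -
  have le: "power_sum p n (\<lambda>i. c *\<^sub>R x i) \<le> \<bar>c\<bar> *\<^sub>R power_sum p n x" for c and x :: "nat \<Rightarrow> 'a"
  proof (rule power_sum_least[OF n pr])
    fix a assume a: "lp_norm r n a \<le> 1"
    define b where "b = (if 0 \<le> c then a else (\<lambda>i. - a i))"
    have "lp_norm r n b \<le> 1"
      using a by (simp add: b_def lp_norm_minus)
    then have "\<bar>c\<bar> *\<^sub>R (\<Sum>i<n. b i *\<^sub>R x i) \<le> \<bar>c\<bar> *\<^sub>R power_sum p n x"
      by (intro scaleR_left_mono power_sum_upper_ball[OF n pr]) simp_all
    moreover have "a i * c = \<bar>c\<bar> * b i" for i
      by (simp add: b_def)
    then have "(\<Sum>i<n. a i *\<^sub>R c *\<^sub>R x i) = \<bar>c\<bar> *\<^sub>R (\<Sum>i<n. b i *\<^sub>R x i)"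
      by (simp add: scaleR_sum_right)
    ultimately show "(\<Sum>i<n. a i *\<^sub>R c *\<^sub>R x i) \<le> \<bar>c\<bar> *\<^sub>R power_sum p n x"
      by simp
  qed
  show ?thesis
  proof (cases "c = 0")
    case True
    then show ?thesis
      using le[of 0 x] power_sum_nonneg[OF n conjugate_exponent_ge_1(1)[OF pr], of "\<lambda>i. c *\<^sub>R x i"] by simp
  next
    case False
    have "\<bar>c\<bar> *\<^sub>R power_sum p n (\<lambda>i. inverse c *\<^sub>R (c *\<^sub>R x i))
        \<le> \<bar>c\<bar> *\<^sub>R (\<bar>inverse c\<bar> *\<^sub>R power_sum p n (\<lambda>i. c *\<^sub>R x i))"
      by (intro scaleR_left_mono le) simp
    then show ?thesis
      using le[of c x] False by (simp add: abs_mult[symmetric])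
  qed
qed

text \<open>For a family along one direction every combination is a multiple t v, and |t| is
  controlled by Hoelder's inequality. Such families are the test families that give continuity and
  the bound of the functionals in \<open>power_sum_norming_family\<close>.\<close>

lemma power_sum_ray_le:
  assumes n: "0 < n" and pr: "inverse p + inverse r = 1"
  shows "power_sum p n (\<lambda>i. c i *\<^sub>R v) \<le> lp_norm p n c *\<^sub>R \<bar>v\<bar>"
proof (rule power_sum_least[OF n pr])
  fix a assume a: "lp_norm r n a \<le> 1"
  define t where "t = (\<Sum>i<n. c i * a i)"
  have bound: "(\<Sum>i<n. c i * b i) \<le> lp_norm p n c" if "lp_norm r n b \<le> 1" for b
  proof -
    have "(\<Sum>i<n. c i * b i) \<le> lp_norm p n c * lp_norm r n b"
      by (rule Hoelder_sum[OF pr])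
    also have "\<dots> \<le> lp_norm p n c * 1"
      using that by (intro mult_left_mono lp_norm_nonneg n)
    finally show ?thesis
      by simp
  qed
  have "t \<le> lp_norm p n c" "- t \<le> lp_norm p n c"
    using bound[of a] bound[of "\<lambda>i. - a i"] a by (simp_all add: lp_norm_minus t_def sum_negf)
  then have t: "\<bar>t\<bar> \<le> lp_norm p n c"
    by simp
  have "(\<Sum>i<n. a i *\<^sub>R c i *\<^sub>R v) = t *\<^sub>R v"
    by (simp add: t_def scaleR_sum_left mult.commute)
  also have "\<dots> \<le> \<bar>t\<bar> *\<^sub>R \<bar>v\<bar>"
    using abs_ge_self[of "t *\<^sub>R v"] by (simp add: abs_scaleR_lattice)
  also have "\<dots> \<le> lp_norm p n c *\<^sub>R \<bar>v\<bar>"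
    by (rule scaleR_right_mono[OF t abs_ge_zero])
  finally show "(\<Sum>i<n. a i *\<^sub>R c i *\<^sub>R v) \<le> lp_norm p n c *\<^sub>R \<bar>v\<bar>" .
qed

lemma power_sum_1:
  assumes "1 \<le> p"
  shows "power_sum p 1 x = \<bar>x 0\<bar>"
proof (rule represents_unique)
  have "lp_norm p 1 = (\<lambda>a. \<bar>a 0\<bar>)"
  proof
    fix a :: "nat \<Rightarrow> real"
    have "{..<1::nat} = {0}"
      by auto
    then show "lp_norm p 1 a = \<bar>a 0\<bar>"
      by (cases rule: exponent_cases[OF assms]) (simp_all add: lp_norm_def powr_powr)
  qed
  then show "represents 1 x (lp_norm p 1) \<bar>x 0\<bar>"
    using represents_abs[OF represents_coord[of 0 1 x]] by simp
qed (rule represents_power_sum[OF zero_less_one assms])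

section \<open>Pairing a family of elements with a family of functionals\<close>

lemma dual_le_apply: "f \<le> g \<Longrightarrow> 0 \<le> x \<Longrightarrow> dual_apply f x \<le> dual_apply g x"
  by (simp add: less_eq_dual_def)

lemma dual_apply_abs_diff_le:
  fixes x y b :: "'a::banach_lattice"
  assumes "\<bar>x - y\<bar> \<le> b"
  shows "dual_apply f x \<le> dual_apply f y + norm f * norm b"
proof -
  have "dual_apply f x - dual_apply f y \<le> norm f * norm (x - y)"
    using dual_apply_bound[of f "x - y"] by (simp add: dual_apply_linear)
  also have "\<dots> \<le> norm f * norm b"
    using norm_le_of_abs_le[OF assms] by (intro mult_left_mono) simp_all
  finally show ?thesis
    by simp
qed

text \<open>
  Both sides are approximated by Riemann sums: along a fine partition \<open>\<psi> j\<close> represented by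
  lattice elements \<open>v j \<ge> 0\<close>, one has \<open>x i \<approx> (\<Sum>j. c j i *\<^sub>R v j)\<close> and
  \<open>power_sum p n x \<approx> (\<Sum>j. lp_norm p n (c j) *\<^sub>R v j)\<close>, so the inequality reduces to
  \<open>power_sum_upper\<close> in the dual, applied to each \<open>v j\<close>.
\<close>

theorem dual_pairing_le_power_sum:
  fixes f :: "nat \<Rightarrow> 'a::banach_lattice dual"
  assumes n: "0 < n" and pr: "inverse p + inverse r = 1"
  shows "(\<Sum>i<n. dual_apply (f i) (x i)) \<le> dual_apply (power_sum r n f) (power_sum p n x)"
proof (rule field_le_epsilon)
  fix \<epsilon> :: real assume \<epsilon>: "0 < \<epsilon>"
  let ?e = "abs_sum n x" and ?g = "power_sum r n f" and ?s = "power_sum p n x"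
  have p: "1 \<le> p" and rp: "inverse r + inverse p = 1"
    using conjugate_exponent_ge_1[OF pr] pr by (simp_all add: add.commute)
  \<comment> \<open>Collects the errors of the two replacements: each \<open>x i\<close> by its
    Riemann sum, which costs the norm of \<open>f i\<close>, and the Riemann sum of the power sum by
    \<open>?s\<close>, which costs the norm of \<open>?g\<close>.\<close>
  define M where "M = ((\<Sum>i<n. norm (f i)) + norm ?g) * norm ?e"
  have M: "0 \<le> M"
    unfolding M_def by (intro mult_nonneg_nonneg add_nonneg_nonneg sum_nonneg norm_ge_zero)
  define \<delta> where "\<delta> = \<epsilon> / (M + 1)"
  have \<delta>: "0 < \<delta>" "\<delta> * M \<le> \<epsilon>"
    using \<epsilon> M by (simp_all add: \<delta>_def divide_simps)
  \<comment> \<open>A single partition has to serve all coordinates and the norm, so that the same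
    elements \<open>v j\<close> occur in all the Riemann sums.\<close>
  define H where "H = insert (lp_norm p n) ((\<lambda>i a. a i) ` {..<n})"
  have H: "finite H" "H \<subseteq> krivine_functions n"
    using krivine_functions_lp_norm[OF n p] krivine_functions_coord by (auto simp: H_def)
  obtain m :: nat and c \<psi> where \<psi>: "\<forall>j<m. \<psi> j \<in> lattice_linear n" "\<forall>j<m. \<forall>a. 0 \<le> \<psi> j a"
    and approx: "\<forall>h\<in>H. \<forall>a. \<bar>h a - (\<Sum>j<m. h (c j) * \<psi> j a)\<bar> \<le> \<delta> * l1_norm n a"
    using lattice_linear_partition[OF n H \<delta>(1)] by (elim exE conjE)
  have "\<forall>j<m. \<exists>v. represents n x (\<psi> j) v"
    using \<psi>(1) by (intro allI impI represents_lattice_linear) simp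
  then obtain v where v: "\<And>j. j < m \<Longrightarrow> represents n x (\<psi> j) (v j)"
    by metis
  have v_pos: "0 \<le> v j" if "j < m" for j
    using represents_mono[OF represents_zero v[OF that]] \<psi>(2) that by simp
  have comb: "represents n x (\<lambda>a. \<Sum>j<m. t j * \<psi> j a) (\<Sum>j<m. t j *\<^sub>R v j)" for t
    by (rule represents_sum) (simp_all add: represents_scale[OF v])
  have x_near: "\<bar>x i - (\<Sum>j<m. c j i *\<^sub>R v j)\<bar> \<le> \<delta> *\<^sub>R ?e" if "i < n" for i
  proof (rule represents_abs_diff_le[OF represents_coord[OF that] comb])
    have "(\<lambda>a. a i) \<in> H"
      using that by (simp add: H_def)
    from approx[rule_format, OF this] show "\<bar>a i - (\<Sum>j<m. c j i * \<psi> j a)\<bar> \<le> \<delta> * l1_norm n a" for a .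
  qed
  have s_near: "\<bar>(\<Sum>j<m. lp_norm p n (c j) *\<^sub>R v j) - ?s\<bar> \<le> \<delta> *\<^sub>R ?e"
  proof (rule represents_abs_diff_le[OF comb represents_power_sum[OF n p]])
    have "lp_norm p n \<in> H"
      by (simp add: H_def)
    from approx[rule_format, OF this]
    show "\<bar>(\<Sum>j<m. lp_norm p n (c j) * \<psi> j a) - lp_norm p n a\<bar> \<le> \<delta> * l1_norm n a" for a
      by (simp add: abs_minus_commute)
  qed
  have "(\<Sum>i<n. dual_apply (f i) (x i))
      \<le> (\<Sum>i<n. dual_apply (f i) (\<Sum>j<m. c j i *\<^sub>R v j) + norm (f i) * norm (\<delta> *\<^sub>R ?e))"
    using x_near by (intro sum_mono dual_apply_abs_diff_le) simp
  also have "\<dots> = (\<Sum>i<n. dual_apply (f i) (\<Sum>j<m. c j i *\<^sub>R v j)) + \<delta> * (\<Sum>i<n. norm (f i)) * norm ?e"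
    using \<delta> by (simp add: sum.distrib sum_distrib_left sum_distrib_right mult_ac)
  also have "(\<Sum>i<n. dual_apply (f i) (\<Sum>j<m. c j i *\<^sub>R v j)) = (\<Sum>i<n. \<Sum>j<m. c j i * dual_apply (f i) (v j))"
    by (simp add: dual_apply_linear)
  also have "\<dots> = (\<Sum>j<m. \<Sum>i<n. c j i * dual_apply (f i) (v j))"
    by (rule sum.swap)
  also have "\<dots> = (\<Sum>j<m. dual_apply (\<Sum>i<n. c j i *\<^sub>R f i) (v j))"
    by (simp add: dual_apply_sum_left)
  also have "\<dots> \<le> (\<Sum>j<m. dual_apply (lp_norm p n (c j) *\<^sub>R ?g) (v j))"
    using v_pos by (intro sum_mono dual_le_apply power_sum_upper[OF n rp]) simp
  also have "\<dots> = dual_apply ?g (\<Sum>j<m. lp_norm p n (c j) *\<^sub>R v j)"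
    by (simp add: dual_apply_linear)
  also have "\<dots> \<le> dual_apply ?g ?s + norm ?g * norm (\<delta> *\<^sub>R ?e)"
    by (rule dual_apply_abs_diff_le[OF s_near])
  finally have "(\<Sum>i<n. dual_apply (f i) (x i)) \<le> dual_apply ?g ?s + \<delta> * M"
    using \<delta> by (simp add: M_def algebra_simps)
  then show "(\<Sum>i<n. dual_apply (f i) (x i)) \<le> dual_apply ?g ?s + \<epsilon>"
    using \<delta>(2) by simp
qed


section \<open>Norming families of functionals\<close>

text \<open>A linear functional dominated by this one is contractive, and also positive, since the
  dominating value vanishes at - y for y \<ge> 0.\<close>

lemma sublinear_norm_pprt: "sublinear_on UNIV (\<lambda>y :: 'a::banach_lattice. norm (pprt y))"
  unfolding sublinear_on_def
proof (intro conjI ballI allI impI)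
  fix x y :: 'a
  have "pprt (x + y) \<le> pprt x + pprt y"
    unfolding pprt_def[of "x + y"]
    by (intro sup_least add_mono add_nonneg_nonneg zero_le_pprt) (simp_all add: pprt_def)
  then have "norm (pprt (x + y)) \<le> norm (pprt x + pprt y)"
    by (intro norm_mono_nonneg zero_le_pprt)
  then show "norm (pprt (x + y)) \<le> norm (pprt x) + norm (pprt y)"
    using norm_triangle_ineq order_trans by blast
next
  fix c :: real and y :: 'a assume c: "0 \<le> c"
  have le: "norm (pprt (c *\<^sub>R y)) \<le> c * norm (pprt y)" if c: "0 \<le> c" for c :: real and y :: 'a
  proof -
    have "c *\<^sub>R y \<le> c *\<^sub>R pprt y"
      using c by (intro scaleR_left_mono) (simp_all add: pprt_def)
    then have "pprt (c *\<^sub>R y) \<le> c *\<^sub>R pprt y"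
      unfolding pprt_def[of "c *\<^sub>R y"] using c by (intro sup_least) (simp_all add: scaleR_nonneg_nonneg)
    then have "norm (pprt (c *\<^sub>R y)) \<le> norm (c *\<^sub>R pprt y)"
      by (intro norm_mono_nonneg zero_le_pprt)
    then show ?thesis
      using c by simp
  qed
  show "norm (pprt (c *\<^sub>R y)) = c * norm (pprt y)"
  proof (cases "c = 0")
    case False
    have "norm (pprt (inverse c *\<^sub>R c *\<^sub>R y)) \<le> inverse c * norm (pprt (c *\<^sub>R y))"
      using c by (intro le) simp
    then have "c * norm (pprt y) \<le> norm (pprt (c *\<^sub>R y))"
      using c False by (simp add: field_simps)
    then show ?thesis
      using le[OF c, of y] by simp
  qed simp
qed

text \<open>The trivial class turns \<open>dominated_linear_exists\<close> into the Hahn-Banach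
  theorem.\<close>

lemma admissible_True: "admissible_class V (\<lambda>q. True)"
  by (simp add: admissible_class_def)

lemma dual_of_linear_bounded:
  fixes g :: "'a::real_normed_vector \<Rightarrow> real"
  assumes "\<And>x y. g (x + y) = g x + g y" "\<And>c x. g (c *\<^sub>R x) = c * g x"
    and "\<And>x. g x \<le> K * norm x"
  shows "\<exists>f. dual_apply f = g"
proof (rule dual_of_bounded_linear, rule bounded_linear_intro)
  show "norm (g x) \<le> norm x * K" for x
    using assms(3)[of x] assms(3)[of "- x"] assms(2)[of "-1" x] by (simp add: mult.commute)
qed (simp_all add: assms)

lemma positive_norming_functional:
  fixes s :: "'a::banach_lattice"
  assumes "0 \<le> s"
  obtains g where "0 \<le> g" "norm g \<le> 1" "dual_apply g s = norm s"
proof -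
  have "\<exists>h. linear_fun_on UNIV h \<and> True \<and> (\<forall>y\<in>UNIV. h y \<le> norm (pprt y)) \<and> h s = norm (pprt s)"
    by (rule dominated_linear_exists[OF subspace_UNIV sublinear_norm_pprt admissible_True]) simp_all
  then obtain h where add: "\<And>x y. h (x + y) = h x + h y" and hom: "\<And>c x. h (c *\<^sub>R x) = c * h x"
    and le: "\<And>y. h y \<le> norm (pprt y)" and hs: "h s = norm (pprt s)"
    by (auto simp: linear_fun_on_def)
  have le1: "h y \<le> 1 * norm y" for y
    using le[of y] norm_pprt_le[of y] by simp
  obtain g where g: "dual_apply g = h"
    using dual_of_linear_bounded[of h 1] add hom le1 by blast
  have "0 \<le> h y" if "0 \<le> y" for y
    using le[of "- y"] hom[of "-1" y] that by simp
  then have "0 \<le> g"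
    by (simp add: less_eq_dual_def g)
  moreover have "norm g \<le> 1"
  proof (rule dual_norm_le)
    show "\<bar>dual_apply g y\<bar> \<le> 1 * norm y" for y
      using le1[of y] le1[of "- y"] hom[of "-1" y] by (simp add: g)
  qed simp
  moreover have "dual_apply g s = norm s"
    using hs assms by (simp add: g)
  ultimately show thesis
    by (rule that)
qed

text \<open>A bounded functional attaining the norm of the positive part at \<open>y\<close> shows y
  \<le> 0, and the same holds for - y. This makes the embedding of Y into its bidual
  injective.\<close>

lemma dual_eq_0_separates:
  fixes y :: "'a::banach_lattice"
  assumes "\<And>f. dual_apply f y = 0"
  shows "y = 0"
proof -
  have "y \<le> 0" if "\<And>f. dual_apply f y = 0" for y :: 'a
  proof -
    have "\<exists>h. linear_fun_on UNIV h \<and> True \<and> (\<forall>y\<in>UNIV. h y \<le> norm (pprt y)) \<and> h y = norm (pprt y)"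
      by (rule dominated_linear_exists[OF subspace_UNIV sublinear_norm_pprt admissible_True]) simp_all
    then obtain h where add: "\<And>x y. h (x + y) = h x + h y" and hom: "\<And>c x. h (c *\<^sub>R x) = c * h x"
      and le: "\<And>y. h y \<le> norm (pprt y)" and hy: "h y = norm (pprt y)"
      by (auto simp: linear_fun_on_def)
    have "h y \<le> 1 * norm y" for y
      using le[of y] norm_pprt_le[of y] by simp
    then obtain g where "dual_apply g = h"
      using dual_of_linear_bounded[of h 1] add hom by blast
    then have "norm (pprt y) = 0"
      using hy that by metis
    then show ?thesis
      by (simp add: le_zero_iff_zero_pprt)
  qed
  from this[of y] this[of "- y"] assms show ?thesis
    by (simp add: dual_apply_linear)
qed

text \<open>The Hahn-Banach argument for norming families is applied to a whole family at once, so
  the sequences of elements must form a vector space.\<close>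

instantiation "fun" :: (type, real_vector) real_vector
begin

definition scaleR_fun :: "real \<Rightarrow> ('a \<Rightarrow> 'b) \<Rightarrow> 'a \<Rightarrow> 'b"
  where "scaleR_fun c f = (\<lambda>x. c *\<^sub>R f x)"

instance
  by standard (simp_all add: scaleR_fun_def fun_eq_iff scaleR_add_left scaleR_add_right)

end

lemma fun_sum_apply: "(\<Sum>i\<in>I. F i) x = (\<Sum>i\<in>I. F i x)"
  for F :: "'i \<Rightarrow> 'b \<Rightarrow> 'c::real_vector"
  by (induction I rule: infinite_finite_induct) simp_all

text \<open>With g \<ge> 0 of norm at most 1 attaining the norm of the power sum of
  \<open>x\<close>, take a linear \<open>h\<close> on families dominated by
  \<open>Q w = dual_apply g (power_sum p n w)\<close> and equal to it at \<open>x\<close>. Its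
  components are the functionals \<open>f i\<close>. Evaluating \<open>h\<close> at the families a i
  y with y \<ge> 0 and \<open>a\<close> in the l^p ball shows that every combination of the
  \<open>f i\<close> with coefficients \<open>a\<close> lies below \<open>g\<close>; hence so does
  their power sum, the least upper bound.\<close>

theorem power_sum_norming_family:
  fixes x :: "nat \<Rightarrow> 'a::banach_lattice"
  assumes n: "0 < n" and pr: "inverse p + inverse r = 1"
  shows "\<exists>f. norm (power_sum r n f) \<le> 1 \<and> (\<Sum>i<n. dual_apply (f i) (x i)) = norm (power_sum p n x)"
proof -
  have p: "1 \<le> p" and r: "1 \<le> r" and rp: "inverse r + inverse p = 1"
    using conjugate_exponent_ge_1[OF pr] pr by (simp_all add: add.commute)
  obtain g where g: "0 \<le> g" "norm g \<le> 1" "dual_apply g (power_sum p n x) = norm (power_sum p n x)"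
    using positive_norming_functional[OF power_sum_nonneg[OF n p]] by blast
  have g_mono: "dual_apply g u \<le> dual_apply g v" if "u \<le> v" for u v
  proof -
    have "dual_apply 0 (v - u) \<le> dual_apply g (v - u)"
      using that by (intro dual_le_apply[OF g(1)]) simp
    then show ?thesis
      by (simp add: dual_apply_linear)
  qed
  define Q where "Q w = dual_apply g (power_sum p n w)" for w
  have "sublinear_on UNIV Q"
    unfolding sublinear_on_def
  proof (intro conjI ballI allI impI)
    fix u v :: "nat \<Rightarrow> 'a"
    have "Q (u + v) \<le> dual_apply g (power_sum p n u + power_sum p n v)"
      unfolding Q_def plus_fun_def by (intro g_mono power_sum_add_le[OF n pr])
    then show "Q (u + v) \<le> Q u + Q v"
      by (simp add: Q_def dual_apply_linear)
  next
    show "Q (c *\<^sub>R u) = c * Q u" if "0 \<le> c" for c u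
      using that by (simp add: Q_def scaleR_fun_def power_sum_scaleR[OF n pr] dual_apply_linear)
  qed
  \<comment> \<open>Families are infinite sequences, while \<open>Q\<close> sees only their first
    \<open>n\<close> entries. A truncated family is a finite sum of families with one entry, so the
    value of \<open>h\<close> there is the sum of its components.\<close>
  define trunc where "trunc w = (\<lambda>j. if j < n then w j else 0 :: 'a)" for w
  have Q_trunc: "Q (trunc w) = Q w" for w
    unfolding Q_def by (rule arg_cong[OF power_sum_cong[OF n pr]]) (simp add: trunc_def)
  have "\<exists>h. linear_fun_on UNIV h \<and> True \<and> (\<forall>w\<in>UNIV. h w \<le> Q w) \<and> h (trunc x) = Q (trunc x)"
    by (rule dominated_linear_exists[OF subspace_UNIV \<open>sublinear_on UNIV Q\<close> admissible_True]) simp_all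
  then obtain h where add: "\<And>u v. h (u + v) = h u + h v" and hom: "\<And>c u. h (c *\<^sub>R u) = c * h u"
    and le: "\<And>w. h w \<le> Q w" and hx: "h (trunc x) = Q x"
    by (auto simp: linear_fun_on_def Q_trunc)
  define single where "single i y = (\<lambda>j. if j = i then y else 0 :: 'a)" for i :: nat and y
  have ray: "h (\<lambda>j. t j *\<^sub>R y) \<le> lp_norm p n t * dual_apply g \<bar>y\<bar>" for t and y :: 'a
  proof -
    have "h (\<lambda>j. t j *\<^sub>R y) \<le> dual_apply g (lp_norm p n t *\<^sub>R \<bar>y\<bar>)"
      using le[of "\<lambda>j. t j *\<^sub>R y"] g_mono[OF power_sum_ray_le[OF n pr, of t y]] by (simp add: Q_def)
    then show ?thesis
      by (simp add: dual_apply_linear)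
  qed
  have "\<exists>f. dual_apply f = (\<lambda>y. h (single i y))" for i
  proof (rule dual_of_linear_bounded)
    let ?t = "\<lambda>j. if j = i then 1 else 0 :: real"
    have "single i (u + v) = single i u + single i v" for u v
      by (auto simp: single_def fun_eq_iff)
    then show "h (single i (u + v)) = h (single i u) + h (single i v)" for u v
      by (simp add: add)
    have "single i (c *\<^sub>R u) = c *\<^sub>R single i u" for c u
      by (auto simp: single_def fun_eq_iff scaleR_fun_def)
    then show "h (single i (c *\<^sub>R u)) = c * h (single i u)" for c u
      by (simp add: hom)
    show "h (single i y) \<le> lp_norm p n ?t * norm y" for y
    proof -
      have "single i y = (\<lambda>j. ?t j *\<^sub>R y)"
        by (auto simp: single_def fun_eq_iff)
      then have "h (single i y) \<le> lp_norm p n ?t * dual_apply g \<bar>y\<bar>"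
        using ray[of ?t y] by simp
      also have "dual_apply g \<bar>y\<bar> \<le> norm g * norm y"
        using dual_apply_bound[of g "\<bar>y\<bar>"] by simp
      then have "lp_norm p n ?t * dual_apply g \<bar>y\<bar> \<le> lp_norm p n ?t * (norm g * norm y)"
        by (intro mult_left_mono lp_norm_nonneg[OF n])
      also have "norm g * norm y \<le> 1 * norm y"
        using g(2) by (intro mult_right_mono) simp_all
      then have "lp_norm p n ?t * (norm g * norm y) \<le> lp_norm p n ?t * (1 * norm y)"
        by (intro mult_left_mono lp_norm_nonneg[OF n])
      finally show ?thesis
        by simp
    qed
  qed
  then obtain f where f: "\<And>i. dual_apply (f i) = (\<lambda>y. h (single i y))"
    by metis
  have "linear h"
    by (intro linearI) (simp_all only: add hom real_scaleR_def)
  have f_sum: "(\<Sum>i<n. dual_apply (f i) (w i)) = h (trunc w)" for w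
  proof -
    have "trunc w = (\<Sum>i<n. single i (w i))"
      by (auto simp: fun_eq_iff fun_sum_apply single_def trunc_def)
    then show ?thesis
      by (simp only: f linear_sum[OF \<open>linear h\<close>])
  qed
  have "power_sum r n f \<le> g"
  proof (rule power_sum_least[OF n rp])
    fix a assume a: "lp_norm p n a \<le> 1"
    show "(\<Sum>i<n. a i *\<^sub>R f i) \<le> g"
      unfolding less_eq_dual_def
    proof (intro allI impI)
      fix y :: 'a assume y: "0 \<le> y"
      have g_y: "0 \<le> dual_apply g y"
        using dual_le_apply[OF g(1) y] by simp
      have "dual_apply (\<Sum>i<n. a i *\<^sub>R f i) y = h (trunc (\<lambda>i. a i *\<^sub>R y))"
        by (simp add: dual_apply_sum_left dual_apply_linear flip: f_sum)
      also have "\<dots> \<le> Q (\<lambda>i. a i *\<^sub>R y)"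
        using le[of "trunc (\<lambda>i. a i *\<^sub>R y)"] by (simp add: Q_trunc)
      also have "\<dots> \<le> dual_apply g (lp_norm p n a *\<^sub>R \<bar>y\<bar>)"
        unfolding Q_def by (intro g_mono power_sum_ray_le[OF n pr])
      also have "\<dots> = lp_norm p n a * dual_apply g y"
        using y by (simp add: dual_apply_linear)
      also have "\<dots> \<le> 1 * dual_apply g y"
        using a g_y by (intro mult_right_mono)
      finally show "dual_apply (\<Sum>i<n. a i *\<^sub>R f i) y \<le> dual_apply g y"
        by simp
    qed
  qed
  then have "norm (power_sum r n f) \<le> norm g"
    by (intro norm_mono_nonneg power_sum_nonneg[OF n r])
  then have "norm (power_sum r n f) \<le> 1"
    using g(2) by simp
  moreover have "(\<Sum>i<n. dual_apply (f i) (x i)) = norm (power_sum p n x)"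
    by (simp add: f_sum hx Q_def g(3))
  ultimately show ?thesis
    by blast
qed


section \<open>Trace duality\<close>

lemma le_mult_cInf:
  fixes S :: "real set"
  assumes "S \<noteq> {}" "0 \<le> K" "\<And>s. s \<in> S \<Longrightarrow> a \<le> K * s"
  shows "a \<le> K * Inf S"
proof (cases "K = 0")
  case True
  then show ?thesis
    using assms by auto
next
  case False
  then have K: "0 < K"
    using assms(2) by simp
  have "a / K \<le> Inf S"
    using assms(1,3) K by (intro cInf_greatest) (simp_all add: divide_le_eq mult.commute)
  then show ?thesis
    using K by (simp add: divide_le_eq mult.commute)
qed

lemma tensor_zero_left: "tensor 0 z = 0"
  using tensor_bilinear(3)[of 0 0 z] by simp

lemma tensor_as_indexed_sum: "\<exists>(n::nat) x z. 0 < n \<and> u = (\<Sum>i<n. tensor (x i) (z i))"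
proof -
  obtain xs where u: "u = (\<Sum>(x, z)\<leftarrow>xs. tensor x z)"
    using tensor_as_sum by blast
  \<comment> \<open>The null pair keeps the list non-empty, as the representations in
    \<open>phi_pq\<close> have at least one term.\<close>
  define ys where "ys = xs @ [(0, 0)]"
  have "u = (\<Sum>(x, z)\<leftarrow>ys. tensor x z)"
    by (simp add: u ys_def tensor_zero_left)
  also have "\<dots> = (\<Sum>i<length ys. tensor (fst (ys ! i)) (snd (ys ! i)))"
    by (simp add: sum_list_sum_nth case_prod_beta atLeast0LessThan)
  finally show ?thesis
    by (intro exI[of _ "length ys"] exI[of _ "\<lambda>i. fst (ys ! i)"] exI[of _ "\<lambda>i. snd (ys ! i)"])
      (simp add: ys_def)
qed

lemma phi_pq_le:
  fixes n :: nat
  assumes "0 < n" "u = (\<Sum>i<n. tensor (x i) (z i))"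
  shows "phi_pq p q u \<le> norm (power_sum q n x) * norm (power_sum (conjugate_exponent p) n z)"
  unfolding phi_pq_def by (rule cInf_lower) (use assms in \<open>auto intro!: bdd_belowI[of _ 0]\<close>)

text \<open>The existence of a representation matters here: a real infimum over the empty set would
  satisfy no such rule. The factor \<open>K\<close> is carried along so that K = 0 is
  included.\<close>

lemma phi_pq_greatest:
  assumes "0 \<le> K"
    and "\<And>n x z. 0 < n \<Longrightarrow> u = (\<Sum>i<n. tensor (x i) (z i)) \<Longrightarrow>
      a \<le> K * (norm (power_sum q n x) * norm (power_sum (conjugate_exponent p) n z))"
  shows "a \<le> K * phi_pq p q u"
  unfolding phi_pq_def
proof (rule le_mult_cInf[OF _ assms(1)])
  obtain n :: nat and x z where "0 < n" "u = (\<Sum>i<n. tensor (x i) (z i))"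
    using tensor_as_indexed_sum[of u] by (elim exE conjE)
  then show "{norm (power_sum q n x) * norm (power_sum (conjugate_exponent p) n z) | n x z.
      n > 0 \<and> u = (\<Sum>i<n. tensor (x i) (z i))} \<noteq> {}"
    by blast
qed (use assms(2) in blast)

lemma phi_pq_nonneg: "0 \<le> phi_pq p q u"
  using phi_pq_greatest[of 1 u 0 q p] by simp

lemma r_pq_le:
  fixes m :: nat
  assumes "0 < m" "u = (\<Sum>j<m. v j)"
  shows "r_pq p q u \<le> (\<Sum>j<m. phi_pq p q (v j))"
  unfolding r_pq_def
proof (rule cInf_lower)
  show "(\<Sum>j<m. phi_pq p q (v j)) \<in> {\<Sum>j<m. phi_pq p q (v j) | (m::nat) v. m > 0 \<and> u = (\<Sum>j<m. v j)}"
    using assms by blast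
qed (auto intro!: bdd_belowI[of _ 0] sum_nonneg phi_pq_nonneg)

lemma r_pq_greatest:
  assumes "0 \<le> K"
    and "\<And>m v. 0 < m \<Longrightarrow> u = (\<Sum>j<(m::nat). v j) \<Longrightarrow> a \<le> K * (\<Sum>j<m. phi_pq p q (v j))"
  shows "a \<le> K * r_pq p q u"
  unfolding r_pq_def
proof (rule le_mult_cInf[OF _ assms(1)])
  have "0 < (1::nat) \<and> u = (\<Sum>j<(1::nat). (\<lambda>_. u) j)"
    by simp
  then show "{\<Sum>j<m. phi_pq p q (v j) | (m::nat) v. m > 0 \<and> u = (\<Sum>j<m. v j)} \<noteq> {}"
    by blast
qed (use assms(2) in blast)

lemma r_pq_le_phi_pq: "r_pq p q u \<le> phi_pq p q u"
  using r_pq_le[of "Suc 0" u "\<lambda>_. u" p q] by simp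

lemma r_pq_nonneg: "0 \<le> r_pq p q u"
  using r_pq_greatest[of 1 u 0 p q] by (simp add: sum_nonneg phi_pq_nonneg)

lemma trace_functional_linear: "linear (trace_functional T)"
  unfolding trace_functional_def by (rule linear_tensor_eval)

lemma trace_functional_tensor:
  "linear T \<Longrightarrow> trace_functional T (tensor x f) = dual_apply f (T x)"
  using trace_functional_iff[of T "trace_functional T"] by simp

section \<open>Regularity of an operator and boundedness of its trace functional\<close>

context
  fixes p q :: ennreal
  assumes p: "1 \<le> p" and q: "1 \<le> q"
begin

lemma phi_pq_scaleR_le:
  fixes u :: "('a::banach_lattice, 'b::banach_lattice) tensor"
  assumes c: "0 \<le> c"
  shows "phi_pq p q (c *\<^sub>R u) \<le> c * phi_pq p q u"
proof (rule phi_pq_greatest[OF c])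
  fix n and x :: "nat \<Rightarrow> 'a" and z :: "nat \<Rightarrow> 'b"
  assume n: "0 < n" and u: "u = (\<Sum>i<n. tensor (x i) (z i))"
  have "c *\<^sub>R u = (\<Sum>i<n. tensor (c *\<^sub>R x i) (z i))"
    by (simp add: u scaleR_sum_right tensor_bilinear)
  then have "phi_pq p q (c *\<^sub>R u)
      \<le> norm (power_sum q n (\<lambda>i. c *\<^sub>R x i)) * norm (power_sum (conjugate_exponent p) n z)"
    by (rule phi_pq_le[OF n])
  then show "phi_pq p q (c *\<^sub>R u)
      \<le> c * (norm (power_sum q n x) * norm (power_sum (conjugate_exponent p) n z))"
    using c by (simp add: power_sum_scaleR[OF n conjugate_exponent[OF q]] mult.assoc)
qed

lemma r_pq_scaleR_le:
  fixes u :: "('a::banach_lattice, 'b::banach_lattice) tensor"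
  assumes c: "0 \<le> c"
  shows "r_pq p q (c *\<^sub>R u) \<le> c * r_pq p q u"
proof (rule r_pq_greatest[OF c])
  fix m :: nat and v :: "nat \<Rightarrow> ('a, 'b) tensor"
  assume m: "0 < m" and u: "u = (\<Sum>j<m. v j)"
  have "r_pq p q (c *\<^sub>R u) \<le> (\<Sum>j<m. phi_pq p q (c *\<^sub>R v j))"
    by (rule r_pq_le[OF m]) (simp add: u scaleR_sum_right)
  also have "\<dots> \<le> (\<Sum>j<m. c * phi_pq p q (v j))"
    by (intro sum_mono phi_pq_scaleR_le c)
  finally show "r_pq p q (c *\<^sub>R u) \<le> c * (\<Sum>j<m. phi_pq p q (v j))"
    by (simp add: sum_distrib_left)
qed

context
  fixes T :: "'a::banach_lattice \<Rightarrow> 'b::banach_lattice"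
  assumes T: "linear T"
begin

text \<open>The constant is the same on both sides, so membership and equality of norms both follow.
  A regular operator is handled by pairing the elements \<open>T (x i)\<close> with the functionals
  of a representation, which bounds the trace functional by \<open>phi_pq\<close>, and by summing
  over decompositions. Conversely, a norming family for the elements \<open>T (x i)\<close> provides
  a tensor at which the trace functional takes the value to be estimated.\<close>

lemma trace_functional_bound_iff:
  assumes K: "0 \<le> K"
  shows "regular_bound p q T K \<longleftrightarrow> (\<forall>u. \<bar>trace_functional T u\<bar> \<le> K * r_pq p q u)"
proof
  note pr = conjugate_exponent[OF p]
  let ?r = "conjugate_exponent p"
  assume reg: "regular_bound p q T K"
  have phi: "\<bar>trace_functional T u\<bar> \<le> K * phi_pq p q u" for u
  proof (rule phi_pq_greatest[OF K])
    fix n and x :: "nat \<Rightarrow> 'a" and z :: "nat \<Rightarrow> 'b dual"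
    assume n: "0 < n" and u: "u = (\<Sum>i<n. tensor (x i) (z i))"
    have bound: "(\<Sum>i<n. dual_apply (z i) (y i)) \<le> norm (power_sum ?r n z) * norm (power_sum p n y)" for y
      using dual_pairing_le_power_sum[OF n pr, where f = z and x = y]
        dual_apply_bound[of "power_sum ?r n z" "power_sum p n y"] by linarith
    have eq: "trace_functional T u = (\<Sum>i<n. dual_apply (z i) (T (x i)))"
      by (simp add: u linear_sum[OF trace_functional_linear] trace_functional_tensor[OF T])
    \<comment> \<open>The negated family has the same power sum, so the one-sided pairing bound
      controls the absolute value.\<close>
    have "- trace_functional T u \<le> norm (power_sum ?r n z) * norm (power_sum p n (\<lambda>i. T (x i)))"
      using bound[of "\<lambda>i. (-1) *\<^sub>R T (x i)"]
      by (simp only: power_sum_scaleR[OF n pr]) (simp add: eq dual_apply_linear sum_negf)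
    then have "\<bar>trace_functional T u\<bar> \<le> norm (power_sum ?r n z) * norm (power_sum p n (\<lambda>i. T (x i)))"
      using bound[of "\<lambda>i. T (x i)"] eq by (simp add: abs_le_iff)
    also have "\<dots> \<le> norm (power_sum ?r n z) * (K * norm (power_sum q n x))"
      using reg n by (intro mult_left_mono) (simp_all add: regular_bound_def)
    finally show "\<bar>trace_functional T u\<bar> \<le> K * (norm (power_sum q n x) * norm (power_sum ?r n z))"
      by (simp add: mult_ac)
  qed
  show "\<forall>u. \<bar>trace_functional T u\<bar> \<le> K * r_pq p q u"
  proof
    fix u
    show "\<bar>trace_functional T u\<bar> \<le> K * r_pq p q u"
    proof (rule r_pq_greatest[OF K])
      fix m :: nat and v assume u: "u = (\<Sum>j<m. v j)"
      have "\<bar>trace_functional T u\<bar> \<le> (\<Sum>j<m. \<bar>trace_functional T (v j)\<bar>)"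
        by (simp add: u linear_sum[OF trace_functional_linear])
      also have "\<dots> \<le> (\<Sum>j<m. K * phi_pq p q (v j))"
        by (intro sum_mono phi)
      finally show "\<bar>trace_functional T u\<bar> \<le> K * (\<Sum>j<m. phi_pq p q (v j))"
        by (simp add: sum_distrib_left)
    qed
  qed
next
  assume bound: "\<forall>u. \<bar>trace_functional T u\<bar> \<le> K * r_pq p q u"
  show "regular_bound p q T K"
    unfolding regular_bound_def
  proof (intro allI impI)
    fix n :: nat and x :: "nat \<Rightarrow> 'a" assume n: "0 < n"
    obtain f where f: "norm (power_sum (conjugate_exponent p) n f) \<le> 1"
      "(\<Sum>i<n. dual_apply (f i) (T (x i))) = norm (power_sum p n (\<lambda>i. T (x i)))"
      using power_sum_norming_family[OF n conjugate_exponent[OF p], of "\<lambda>i. T (x i)"] by blast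
    define u where "u = (\<Sum>i<n. tensor (x i) (f i))"
    have "norm (power_sum p n (\<lambda>i. T (x i))) = trace_functional T u"
      by (simp add: u_def linear_sum[OF trace_functional_linear] trace_functional_tensor[OF T] f(2))
    also have "\<dots> \<le> K * r_pq p q u"
      using bound abs_ge_self order_trans by blast
    also have "\<dots> \<le> K * (norm (power_sum q n x) * norm (power_sum (conjugate_exponent p) n f))"
      using phi_pq_le[OF n u_def] r_pq_le_phi_pq order_trans by (intro mult_left_mono K) blast
    also have "\<dots> \<le> K * (norm (power_sum q n x) * 1)"
      using f(1) by (intro mult_left_mono K) simp_all
    finally show "norm (power_sum p n (\<lambda>i. T (x i))) \<le> K * norm (power_sum q n x)"
      by simp
  qed
qed

lemma regular_iff_tensor_dual: "T \<in> regular_operators p q \<longleftrightarrow> trace_functional T \<in> tensor_dual p q"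
proof
  assume "T \<in> regular_operators p q"
  then obtain K where "0 < K" "regular_bound p q T K"
    by (auto simp: regular_operators_def)
  then show "trace_functional T \<in> tensor_dual p q"
    using trace_functional_bound_iff[of K] trace_functional_linear by (auto simp: tensor_dual_def)
next
  assume "trace_functional T \<in> tensor_dual p q"
  then obtain C where C: "\<And>u. \<bar>trace_functional T u\<bar> \<le> C * r_pq p q u"
    by (auto simp: tensor_dual_def)
  \<comment> \<open>A positive constant is required of regular operators, whereas \<open>C\<close>
    may have any sign.\<close>
  have "\<bar>trace_functional T u\<bar> \<le> (\<bar>C\<bar> + 1) * r_pq p q u" for u
  proof -
    have "C * r_pq p q u \<le> (\<bar>C\<bar> + 1) * r_pq p q u"
      by (intro mult_right_mono r_pq_nonneg) simp
    then show ?thesis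
      using C[of u] by simp
  qed
  then have "regular_bound p q T (\<bar>C\<bar> + 1)"
    by (subst trace_functional_bound_iff) simp_all
  moreover have "0 < \<bar>C\<bar> + 1"
    by simp
  ultimately show "T \<in> regular_operators p q"
    using T unfolding regular_operators_def by blast
qed

text \<open>Every admissible constant bounds the values of the functional on the unit ball, and
  homogeneity of \<open>r_pq\<close> makes their supremum admissible itself. The supremum is thus
  the least admissible constant.\<close>

lemma regular_norm_eq_tensor_dual_norm:
  assumes reg: "T \<in> regular_operators p q"
  shows "regular_norm p q T = tensor_dual_norm p q (trace_functional T)"
proof -
  let ?\<phi> = "trace_functional T"
  define D where "D = {\<bar>?\<phi> u\<bar> | u. r_pq p q u \<le> 1}"
  define A where "A = {K. 0 \<le> K \<and> regular_bound p q T K}"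
  have A_iff: "K \<in> A \<longleftrightarrow> 0 \<le> K \<and> (\<forall>u. \<bar>?\<phi> u\<bar> \<le> K * r_pq p q u)" for K
    using trace_functional_bound_iff[of K] by (auto simp: A_def)
  obtain K0 where "0 < K0" "regular_bound p q T K0"
    using reg by (auto simp: regular_operators_def)
  then have K0: "K0 \<in> A"
    by (simp add: A_def)
  have upper: "d \<le> K" if K: "K \<in> A" and d: "d \<in> D" for K d
  proof -
    obtain u where u: "d = \<bar>?\<phi> u\<bar>" "r_pq p q u \<le> 1"
      using d by (auto simp: D_def)
    have "d \<le> K * r_pq p q u"
      using K by (simp add: A_iff u(1))
    also have "\<dots> \<le> K * 1"
      using K u(2) by (intro mult_left_mono) (simp_all add: A_iff)
    finally show ?thesis
      by simp
  qed
  have bdd: "bdd_above D"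
    using upper[OF K0] by (rule bdd_aboveI)
  have "r_pq p q (0 :: ('a, 'b dual) tensor) \<le> 0"
    using r_pq_scaleR_le[of 0 "0 :: ('a, 'b dual) tensor"] by simp
  then have zero: "0 \<in> D"
    by (auto simp: D_def linear_0[OF trace_functional_linear] intro!: exI[of _ 0])
  have "Sup D \<in> A"
    unfolding A_iff
  proof (intro conjI allI)
    show "0 \<le> Sup D"
      by (rule cSup_upper[OF zero bdd])
    fix u :: "('a, 'b dual) tensor"
    show "\<bar>?\<phi> u\<bar> \<le> Sup D * r_pq p q u"
    proof (cases "r_pq p q u = 0")
      \<comment> \<open>Such a tensor cannot be normalised, but any admissible constant, here
        \<open>K0\<close>, forces the functional to vanish at it.\<close>
      case True
      then show ?thesis
        using K0 by (metis A_iff mult_zero_right)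
    next
      case False
      define t where "t = r_pq p q u"
      have t: "0 < t"
        using False r_pq_nonneg[of p q u] by (simp add: t_def)
      have "r_pq p q (inverse t *\<^sub>R u) \<le> inverse t * r_pq p q u"
        using t by (intro r_pq_scaleR_le) simp
      then have "\<bar>?\<phi> (inverse t *\<^sub>R u)\<bar> \<in> D"
        using t by (auto simp: D_def t_def)
      then have "\<bar>?\<phi> (inverse t *\<^sub>R u)\<bar> \<le> Sup D"
        by (rule cSup_upper[OF _ bdd])
      then have "inverse t * \<bar>?\<phi> u\<bar> \<le> Sup D"
        using t by (simp add: linear_cmul[OF trace_functional_linear] abs_mult)
      then show ?thesis
        using t by (simp add: field_simps flip: t_def)
    qed
  qed
  then have "Inf A = Sup D"
    using upper zero by (intro cInf_eq_minimum cSup_least) auto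
  then show ?thesis
    by (simp add: regular_norm_def tensor_dual_norm_def A_def D_def)
qed

text \<open>Families of length one: both power sums reduce to absolute values, so the constant of
  regularity bounds the operator norm.\<close>

lemma regular_bounded_linear:
  assumes "T \<in> regular_operators p q"
  shows "bounded_linear T"
proof -
  obtain K where K: "regular_bound p q T K"
    using assms by (auto simp: regular_operators_def)
  have "norm (T x) \<le> norm x * K" for x
    using K[unfolded regular_bound_def, rule_format, of 1 "\<lambda>_. x"]
    by (simp only: power_sum_1[OF p] power_sum_1[OF q]) (simp add: mult.commute)
  then show ?thesis
    using T by (intro bounded_linear_intro) (simp_all add: linear_add linear_cmul)
qed

end

end

text \<open>Functionals on Y separate points, so the pointwise choice of preimages in Y is forced,
  and bilinearity of the tensor makes it linear in x.\<close>

lemma trace_operator_representable: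
  fixes \<phi> :: "('a::banach_lattice, 'b::banach_lattice dual) tensor \<Rightarrow> real"
  assumes \<phi>: "linear \<phi>" and range: "range (trace_operator \<phi>) \<subseteq> range canonical_embedding"
  obtains T where "linear T" "\<phi> = trace_functional T"
proof -
  have "\<forall>x. \<exists>y. trace_operator \<phi> x = canonical_embedding y"
    using range by blast
  then obtain T where "\<And>x. trace_operator \<phi> x = canonical_embedding (T x)"
    by metis
  then have T: "\<phi> (tensor x f) = dual_apply f (T x)" for x f
    by (simp add: trace_operator_def canonical_embedding_def fun_eq_iff)
  have eqI: "y = z" if "\<And>f. dual_apply f y = dual_apply f z" for y z :: 'b
    using dual_eq_0_separates[of "y - z"] that by (simp add: dual_apply_linear)
  have "linear T"
  proof (rule linearI)
    show "T (x + y) = T x + T y" for x y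
      by (rule eqI) (simp add: dual_apply_linear tensor_bilinear linear_add[OF \<phi>] flip: T)
    show "T (c *\<^sub>R x) = c *\<^sub>R T x" for c x
      by (rule eqI) (simp add: dual_apply_linear tensor_bilinear linear_cmul[OF \<phi>] flip: T)
  qed
  moreover from this have "\<phi> = trace_functional T"
    using trace_functional_iff \<phi> T by blast
  ultimately show thesis
    by (rule that)
qed

lemma trace_functional_inj:
  fixes S T :: "'a::banach_lattice \<Rightarrow> 'b::banach_lattice"
  assumes "linear S" "linear T" "trace_functional S = trace_functional T"
  shows "S = T"
proof
  fix x
  have eq: "dual_apply f (S x) = dual_apply f (T x)" for f
    using trace_functional_tensor[OF assms(1)] trace_functional_tensor[OF assms(2)] assms(3) by metis
  have "S x - T x = 0"
    by (rule dual_eq_0_separates) (simp add: dual_apply_linear eq)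
  then show "S x = T x"
    by simp
qed

text \<open>The target set of the bijection is the intersection with the bounded operators into Y:
  it asks that the associated operator take values in the canonical copy of Y, and boundedness
  follows from regularity. The last conjunct makes the bijection linear, so that it is an isometric
  isomorphism.\<close>

theorem theorem3p3:
  fixes p q :: ennreal
  assumes "1 \<le> q" and "q \<le> p"
  shows
    "(\<forall>T :: 'a::banach_lattice \<Rightarrow> 'b::banach_lattice. bounded_linear T \<longrightarrow>
        (T \<in> regular_operators p q \<longleftrightarrow> trace_functional T \<in> tensor_dual p q) \<and>
        (T \<in> regular_operators p q \<longrightarrow>
          regular_norm p q T = tensor_dual_norm p q (trace_functional T)))
     \<and> bij_betw trace_functional
         (regular_operators p q :: ('a \<Rightarrow> 'b) set)
         {\<phi> \<in> tensor_dual p q. range (trace_operator \<phi>) \<subseteq> range canonical_embedding}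
     \<and> (\<forall>T \<in> (regular_operators p q :: ('a \<Rightarrow> 'b) set).
          bounded_linear T \<and>
          regular_norm p q T = tensor_dual_norm p q (trace_functional T))
     \<and> (\<forall>S \<in> (regular_operators p q :: ('a \<Rightarrow> 'b) set). \<forall>T \<in> regular_operators p q. \<forall>a b.
          trace_functional (\<lambda>x. a *\<^sub>R S x + b *\<^sub>R T x) =
          (\<lambda>u. a * trace_functional S u + b * trace_functional T u))"
proof (intro conjI allI impI ballI)
  have q: "1 \<le> q" and p: "1 \<le> p"
    using assms by auto
  have lin: "linear T" if "T \<in> regular_operators p q" for T :: "'a \<Rightarrow> 'b"
    using that by (simp add: regular_operators_def)
  show "T \<in> regular_operators p q \<longleftrightarrow> trace_functional T \<in> tensor_dual p q" if "bounded_linear T"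
    for T :: "'a \<Rightarrow> 'b"
    using regular_iff_tensor_dual[OF p q bounded_linear.linear[OF that]] .
  show norm_eq: "regular_norm p q T = tensor_dual_norm p q (trace_functional T)"
    if "T \<in> regular_operators p q" for T :: "'a \<Rightarrow> 'b"
    using regular_norm_eq_tensor_dual_norm[OF p q lin[OF that] that] .
  then show "regular_norm p q T = tensor_dual_norm p q (trace_functional T)"
    if "T \<in> regular_operators p q" for T :: "'a \<Rightarrow> 'b"
    using that .
  show "bounded_linear T" if "T \<in> regular_operators p q" for T :: "'a \<Rightarrow> 'b"
    using regular_bounded_linear[OF p q lin[OF that] that] .
  show "bij_betw trace_functional (regular_operators p q :: ('a \<Rightarrow> 'b) set)
      {\<phi> \<in> tensor_dual p q. range (trace_operator \<phi>) \<subseteq> range canonical_embedding}"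
    unfolding bij_betw_def
  proof (intro conjI inj_onI set_eqI iffI)
    show "S = T" if "S \<in> regular_operators p q" "T \<in> regular_operators p q"
      "trace_functional S = trace_functional T" for S T :: "'a \<Rightarrow> 'b"
      using trace_functional_inj[OF lin[OF that(1)] lin[OF that(2)] that(3)] .
  next
    fix \<phi> :: "('a, 'b dual) tensor \<Rightarrow> real"
    assume "\<phi> \<in> trace_functional ` (regular_operators p q :: ('a \<Rightarrow> 'b) set)"
    then obtain T :: "'a \<Rightarrow> 'b" where T: "T \<in> regular_operators p q" "\<phi> = trace_functional T"
      by blast
    have "trace_operator \<phi> x = canonical_embedding (T x)" for x
      by (simp add: fun_eq_iff trace_operator_def canonical_embedding_def T(2)
          trace_functional_tensor[OF lin[OF T(1)]])
    then show "\<phi> \<in> {\<phi> \<in> tensor_dual p q. range (trace_operator \<phi>) \<subseteq> range canonical_embedding}"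
      using T regular_iff_tensor_dual[OF p q lin[OF T(1)]] by auto
  next
    fix \<phi> :: "('a, 'b dual) tensor \<Rightarrow> real"
    assume \<phi>: "\<phi> \<in> {\<phi> \<in> tensor_dual p q. range (trace_operator \<phi>) \<subseteq> range canonical_embedding}"
    then have "linear \<phi>" "range (trace_operator \<phi>) \<subseteq> range canonical_embedding"
      by (simp_all add: tensor_dual_def)
    then obtain T :: "'a \<Rightarrow> 'b" where T: "linear T" "\<phi> = trace_functional T"
      using trace_operator_representable by metis
    then have "T \<in> regular_operators p q"
      using regular_iff_tensor_dual[OF p q T(1)] \<phi> by simp
    then show "\<phi> \<in> trace_functional ` (regular_operators p q :: ('a \<Rightarrow> 'b) set)"
      using T(2) by blast
  qed
  show "trace_functional (\<lambda>x. a *\<^sub>R S x + b *\<^sub>R T x) =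
      (\<lambda>u. a * trace_functional S u + b * trace_functional T u)"
    if S: "S \<in> regular_operators p q" and T: "T \<in> regular_operators p q"
    for S T :: "'a \<Rightarrow> 'b" and a b
  proof -
    note linS = lin[OF S] and linT = lin[OF T]
    have "linear (\<lambda>x. a *\<^sub>R S x + b *\<^sub>R T x)"
      by (intro linear_compose_add linear_compose_scale_right linS linT)
    moreover have "linear (\<lambda>u. a * trace_functional S u + b * trace_functional T u)"
      using linear_compose_add[OF linear_compose_scale_right[OF trace_functional_linear]
          linear_compose_scale_right[OF trace_functional_linear]] by simp
    ultimately show ?thesis
      by (subst eq_commute, subst trace_functional_iff)
        (simp_all add: trace_functional_tensor[OF linS] trace_functional_tensor[OF linT] dual_apply_linear)
  qed
qed

end
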